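(* Let $\Gamma=(\mathscr V,\mathscr E)$ be an infinite, locally finite, connected graph on which simple random walk is transient, and let $\mathcal V$ be a height function potential. Then there exists an (infinite volume) Gibbs measure on height functions $h:\mathscr V\to\mathbb Z$ on $\Gamma$ with respect to $\mathcal V$. If moreover $\Gamma$ is an amenable Cayley graph, then there exists a translation invariant Gibbs measure.
   Context: A height function potential is $\mathcal V:\mathbb Z\to\mathbb R\cup\{+\infty\}$ with $\mathcal V(n)=\mathcal V(-n)$, $\sum_{n\in\mathbb Z}n^2e^{-\mathcal V(n)}<\infty$, and $e^{-\mathcal V(0)}+\sum_{n\ge1}2e^{-\mathcal V(n)}\cos(n\alpha)>0$ for all $\alpha\in\mathbb R$. For a finite $\Lambda\subset\mathscr V$ let $E(\Lambda)$ be the set of edges with at least one endpoint in $\Lambda$. For $\varphi:\Lambda^c\to\mathbb Z$, let $\nu_\Lambda^\varphi$ be the probability measure on functions $h:\mathscr V\to\mathbb Z$ with $h|_{\Lambda^c}=\varphi$ given by $\nu_\Lambda^\varphi(h)\propto\exp\big(-\sum_{e\in E(\Lambda)}\mathcal V(\mathrm dh_e)\big)$, where $\mathrm dh_{xy}=h_y-h_x$ (defined when the normalising constant is positive). A probability measure $\nu$ on $\mathbb Z^{\mathscr V}$ is a Gibbs measure (on $\Gamma$ with respect to $\mathcal V$) if for all finite $\Lambda\subset\mathscr V$ it satisfies the DLR relation $\nu_\Lambda(\cdot)=\int_{\mathbb Z^{\mathscr V}}\nu_\Lambda^{\varphi}(\cdot)\,d\nu(\varphi)$, where $\nu_\Lambda$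 is the restriction (marginal) of $\nu$ to $\Lambda$, and in $\nu_\Lambda^\varphi$ only the values of $\varphi$ outside $\Lambda$ are used (in particular $\nu_\Lambda^\varphi$ is well defined for $\nu$-a.e. $\varphi$). If $\Gamma$ is a Cayley graph (of a finitely generated group), $\nu$ is translation invariant if it is invariant under the shifts of $\mathscr V$ induced by the group. *)

theory Defs
  imports "HOL-Probability.Probability" "HOL-Algebra.Generated_Groups"
begin

section \<open>Graphs\<close>

text \<open>Simple undirected graphs, possibly infinite: an edge is an unordered pair of distinct vertices.\<close>

definition simple_graph :: "'v set \<Rightarrow> 'v set set \<Rightarrow> bool" where
  "simple_graph V E \<longleftrightarrow> (\<forall>e\<in>E. e \<subseteq> V \<and> card e = 2)"

definition neighbours :: "'v set set \<Rightarrow> 'v \<Rightarrow> 'v set" where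
  "neighbours E x = {y. {x, y} \<in> E}"

definition locally_finite_graph :: "'v set \<Rightarrow> 'v set set \<Rightarrow> bool" where
  "locally_finite_graph V E \<longleftrightarrow> (\<forall>x\<in>V. finite (neighbours E x))"

definition connected_graph :: "'v set \<Rightarrow> 'v set set \<Rightarrow> bool" where
  "connected_graph V E \<longleftrightarrow> (\<forall>x\<in>V. \<forall>y\<in>V. (x, y) \<in> {(u, v). {u, v} \<in> E}\<^sup>*)"

text \<open>Amenability of a graph: its Cheeger constant (with the edge boundary) is zero.\<close>

definition amenable_graph :: "'v set \<Rightarrow> 'v set set \<Rightarrow> bool" where
  "amenable_graph V E \<longleftrightarrow>
     (\<forall>\<epsilon>>0. \<exists>F. finite F \<and> F \<noteq> {} \<and> F \<subseteq> V \<and>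
        real (card {e\<in>E. e \<inter> F \<noteq> {} \<and> \<not> e \<subseteq> F}) \<le> \<epsilon> * real (card F))"

text \<open>Edges join \<open>g\<close> to \<open>g \<otimes> s\<close>, so that left multiplication acts by graph automorphisms. Since edges
  are unordered, \<open>S\<close> need not be closed under inverses.\<close>

definition cayley_graph ::
    "('v, 'm) monoid_scheme \<Rightarrow> 'v set \<Rightarrow> 'v set \<Rightarrow> 'v set set \<Rightarrow> bool" where
  "cayley_graph G S V E \<longleftrightarrow>
     group G \<and> finite S \<and> S \<subseteq> carrier G \<and> \<one>\<^bsub>G\<^esub> \<notin> S \<and> generate G S = carrier G \<and>
     V = carrier G \<and> E = {{g, g \<otimes>\<^bsub>G\<^esub> s} | g s. g \<in> carrier G \<and> s \<in> S}"

section \<open>Simple random walk\<close>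

text \<open>The law, on trajectories \<open>nat \<Rightarrow> 'v\<close>, of the Markov chain that starts at \<open>x\<close> and jumps at each
  step to a uniformly chosen neighbour, obtained from its transition kernels by the
  Ionescu-Tulcea theorem. In a locally finite graph without isolated vertices, \<open>neighbours\<close> is finite
  and nonempty at each vertex, as \<open>pmf_of_set\<close> requires.\<close>

definition srw_kernel :: "'v set set \<Rightarrow> 'v \<Rightarrow> nat \<Rightarrow> (nat \<Rightarrow> 'v) \<Rightarrow> 'v measure" where
  "srw_kernel E x n \<omega> =
     measure_pmf (case n of 0 \<Rightarrow> return_pmf x | Suc m \<Rightarrow> pmf_of_set (neighbours E (\<omega> m)))"

definition srw_law :: "'v set set \<Rightarrow> 'v \<Rightarrow> (nat \<Rightarrow> 'v) measure" where
  "srw_law E x =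
     projective_family.lim UNIV
       (Ionescu_Tulcea.CI (srw_kernel E x) (\<lambda>_. count_space UNIV)) (\<lambda>_. count_space UNIV)"

lemma Ionescu_Tulcea_srw_kernel: "Ionescu_Tulcea (srw_kernel E x) (\<lambda>_. count_space UNIV)"
proof (rule Ionescu_Tulcea.intro)
  show "srw_kernel E x i \<in> (\<Pi>\<^sub>M j\<in>{0..<i}. count_space UNIV) \<rightarrow>\<^sub>M subprob_algebra (count_space UNIV)"
    for i
  proof (cases i)
    case 0
    then show ?thesis
      by (auto simp: srw_kernel_def[abs_def] space_subprob_algebra prob_space_imp_subprob_space
          measure_pmf.prob_space_axioms intro!: measurable_const)
  next
    case (Suc m)
    have "(\<lambda>y. measure_pmf (pmf_of_set (neighbours E y))) \<in>
        count_space UNIV \<rightarrow>\<^sub>M subprob_algebra (count_space UNIV)"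
      by (auto simp: space_subprob_algebra prob_space_imp_subprob_space
          measure_pmf.prob_space_axioms)
    moreover have "(\<lambda>\<omega>. \<omega> m) \<in> (\<Pi>\<^sub>M j\<in>{0..<i}. count_space UNIV) \<rightarrow>\<^sub>M count_space UNIV"
      using Suc by (intro measurable_component_singleton) auto
    ultimately show ?thesis
      using Suc by (auto simp: srw_kernel_def[abs_def] intro: measurable_compose[rotated])
  qed
  show "prob_space (srw_kernel E x i \<omega>)"
    if "\<omega> \<in> space (\<Pi>\<^sub>M j\<in>{0..<i}. count_space UNIV)" for i \<omega>
    by (simp add: srw_kernel_def measure_pmf.prob_space_axioms)
qed

definition srw_transient :: "'v set \<Rightarrow> 'v set set \<Rightarrow> bool" where
  "srw_transient V E \<longleftrightarrow> (\<forall>x\<in>V. \<P>(\<omega> in srw_law E x. \<exists>n\<ge>1. \<omega> n = x) < 1)"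

lemma sets_srw_law: "sets (srw_law E x) = sets (\<Pi>\<^sub>M n\<in>UNIV. count_space UNIV)"
proof -
  interpret Ionescu_Tulcea "srw_kernel E x" "\<lambda>_. count_space UNIV"
    by (rule Ionescu_Tulcea_srw_kernel)
  show ?thesis
    by (simp add: srw_law_def)
qed

lemma sets_srw_return: "{\<omega> \<in> space (srw_law E x). \<exists>n\<ge>1. \<omega> n = x} \<in> sets (srw_law E x)"
  unfolding sets_eq_imp_space_eq[OF sets_srw_law] sets_srw_law by measurable

section \<open>Height functions\<close>

text \<open>\<open>boltzmann t\<close> is \<open>exp (- t)\<close>, with \<open>exp (- \<infinity>) = 0\<close>; the value at \<open>-\<infinity>\<close> is never used.\<close>

definition boltzmann :: "ereal \<Rightarrow> real" where
  "boltzmann t = (if t = \<infinity> then 0 else exp (- real_of_ereal t))"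

definition height_function_potential :: "(int \<Rightarrow> ereal) \<Rightarrow> bool" where
  "height_function_potential U \<longleftrightarrow>
     (\<forall>n. U n \<noteq> -\<infinity>) \<and> (\<forall>n. U n = U (- n)) \<and>
     (\<lambda>n. (of_int n)\<^sup>2 * boltzmann (U n)) summable_on UNIV \<and>
     (\<forall>\<alpha>::real. boltzmann (U 0) + (\<Sum>\<^sub>\<infinity>n\<in>{1..}. 2 * boltzmann (U n) * cos (of_int n * \<alpha>)) > 0)"

text \<open>Height functions on \<open>V\<close>, in the sense of \<open>PiM\<close>: functions that are \<open>undefined\<close> outside \<open>V\<close>.\<close>

abbreviation heights :: "'v set \<Rightarrow> ('v \<Rightarrow> int) measure" where
  "heights V \<equiv> \<Pi>\<^sub>M x\<in>V. count_space UNIV"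

text \<open>The energy of the edge \<open>{x, y}\<close> is \<open>U (h y - h x)\<close>. It does not depend on the orientation
  of the edge because \<open>U\<close> is even.\<close>

definition edge_energy :: "(int \<Rightarrow> ereal) \<Rightarrow> ('v \<Rightarrow> int) \<Rightarrow> 'v set \<Rightarrow> ereal" where
  "edge_energy U h e = (THE t. \<exists>x y. e = {x, y} \<and> t = U (h y - h x))"

lemma edge_energy_insert:
  assumes "\<And>n. U n = U (- n)"
  shows "edge_energy U h {x, y} = U (h y - h x)"
proof -
  have "U (h x - h y) = U (h y - h x)"
    using assms[of "h x - h y"] by simp
  then show ?thesis
    unfolding edge_energy_def by (auto simp: doubleton_eq_iff)
qed

definition edges_touching :: "'v set set \<Rightarrow> 'v set \<Rightarrow> 'v set set" where
  "edges_touching E \<Lambda> = {e\<in>E. e \<inter> \<Lambda> \<noteq> {}}"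

definition gibbs_weight ::
    "'v set set \<Rightarrow> (int \<Rightarrow> ereal) \<Rightarrow> 'v set \<Rightarrow> ('v \<Rightarrow> int) \<Rightarrow> real" where
  "gibbs_weight E U \<Lambda> h = boltzmann (\<Sum>e\<in>edges_touching E \<Lambda>. edge_energy U h e)"

definition with_boundary :: "'v set \<Rightarrow> 'v set \<Rightarrow> ('v \<Rightarrow> int) \<Rightarrow> ('v \<Rightarrow> int) set" where
  "with_boundary V \<Lambda> \<phi> = {h \<in> V \<rightarrow>\<^sub>E UNIV. \<forall>x\<in>V - \<Lambda>. h x = \<phi> x}"

definition partition_function ::
    "'v set \<Rightarrow> 'v set set \<Rightarrow> (int \<Rightarrow> ereal) \<Rightarrow> 'v set \<Rightarrow> ('v \<Rightarrow> int) \<Rightarrow> ennreal" where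
  "partition_function V E U \<Lambda> \<phi> =
     (\<integral>\<^sup>+h. ennreal (gibbs_weight E U \<Lambda> h) \<partial>count_space (with_boundary V \<Lambda> \<phi>))"

text \<open>A probability measure whenever the partition function is neither \<open>0\<close> nor \<open>\<infinity>\<close>.\<close>

definition gibbs_kernel ::
    "'v set \<Rightarrow> 'v set set \<Rightarrow> (int \<Rightarrow> ereal) \<Rightarrow> 'v set \<Rightarrow> ('v \<Rightarrow> int) \<Rightarrow> ('v \<Rightarrow> int) measure" where
  "gibbs_kernel V E U \<Lambda> \<phi> =
     distr
       (density (count_space (with_boundary V \<Lambda> \<phi>))
         (\<lambda>h. ennreal (gibbs_weight E U \<Lambda> h) / partition_function V E U \<Lambda> \<phi>))
       (heights V) (\<lambda>h. h)"

definition marginal :: "'v set \<Rightarrow> ('v \<Rightarrow> int) measure \<Rightarrow> ('v \<Rightarrow> int) measure" where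
  "marginal \<Lambda> \<nu> = distr \<nu> (heights \<Lambda>) (\<lambda>h. restrict h \<Lambda>)"

definition gibbs_measure ::
    "'v set \<Rightarrow> 'v set set \<Rightarrow> (int \<Rightarrow> ereal) \<Rightarrow> ('v \<Rightarrow> int) measure \<Rightarrow> bool" where
  "gibbs_measure V E U \<nu> \<longleftrightarrow>
     prob_space \<nu> \<and> sets \<nu> = sets (heights V) \<and>
     (\<forall>\<Lambda>. finite \<Lambda> \<and> \<Lambda> \<subseteq> V \<longrightarrow>
        (AE \<phi> in \<nu>. 0 < partition_function V E U \<Lambda> \<phi> \<and> partition_function V E U \<Lambda> \<phi> < \<infinity>) \<and>
        (\<forall>A\<in>sets (heights \<Lambda>).
           emeasure (marginal \<Lambda> \<nu>) A =
             (\<integral>\<^sup>+\<phi>. emeasure (marginal \<Lambda> (gibbs_kernel V E U \<Lambda> \<phi>)) A \<partial>\<nu>)))"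

text \<open>Invariance under the action of \<open>G\<close> on height functions on \<open>carrier G\<close> induced by left
  multiplication.\<close>

definition translation_invariant ::
    "('v, 'm) monoid_scheme \<Rightarrow> ('v \<Rightarrow> int) measure \<Rightarrow> bool" where
  "translation_invariant G \<nu> \<longleftrightarrow>
     (\<forall>g\<in>carrier G.
        distr \<nu> (heights (carrier G)) (\<lambda>h. \<lambda>x\<in>carrier G. h (g \<otimes>\<^bsub>G\<^esub> x)) = \<nu>)"

end

(*
  Normalise exp (- U) to a probability mass function q on the integers; its Fourier transform phi is
  positive and C^2, so phi (a + t) * phi (a - t) >= phi a ^ 2 * (1 - K * t ^ 2) for some K. Writing
  q as a Fourier integral, a sum over differences j - k of height functions of
  prod_e q (d(j - k)_e) * cos (t . d(j - k)) is the integral of prod_e phi (a_e - t_e) against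
  the nonnegative density |sum_j exp (i a . dj)|^2. By AM-GM for the shifts t and -t it is at least
  (1 - K |t|^2) times its value at t = 0, and letting t -> 0 along a unit flow from x to the complement
  of a finite set L bounds the variance of h_x, under the zero boundary condition outside L, by
  2 K times the energy of the flow. For the gradient of the Green function this energy is at most
  1 / (deg x * escape probability), uniformly in L, by transience.
  Tightness, a diagonal subsequence and Kolmogorov extension give a local limit, and the DLR relation
  passes to the limit since it involves only finitely many vertices. On an amenable Cayley graph
  the same argument applies to averages, over Foelner sets, of translates of finite volume measures.
*)

theory Submission
  imports Defs "HOL-Real_Asymp.Real_Asymp"
begin

section \<open>Fourier analysis of the increments\<close>

text \<open>The potential need not be convex, so convexity bounds of Brascamp-Lieb type are out of
  reach; positivity of the Fourier transform takes their place. One shift of phi changes the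
  integrand to first order in t with no definite sign. Pairing t with -t cancels that order: the
  product is A^2 - B^2 with A = phi a + O(t^2) and B = O(t), for which a finite second moment
  suffices. K is uniform because phi is continuous and periodic, hence bounded below. Each edge
  costs K t_e^2, so only the energy of the flow enters and never the number of edges. A unit flow is
  the right direction because summation by parts turns t . dh into h x when h vanishes outside the
  volume. As U may be infinite, the partition function of a general boundary condition can vanish.
  This cannot happen on the support of a finite volume measure, and that statement is itself local,
  so it survives the limit. Heights are integers, so every bounded function of finitely many of them
  may serve as a test function, the Gibbs kernel included. The variance bound depends on x but not
  on the volume, so all translates of a volume share it.\<close>

definition circle :: "real measure" where
  "circle = uniform_measure lborel {0..2 * pi}"

interpretation circle: prob_space circle
  unfolding circle_def by (rule prob_space_uniform_measure) auto

lemma sets_circle [measurable_cong, simp]: "sets circle = sets borel"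
  by (simp add: circle_def)

lemma space_circle [simp]: "space circle = UNIV"
  by (simp add: circle_def)

lemma measurable_cis [measurable]: "cis \<in> borel_measurable borel"
  by (intro borel_measurable_continuous_onI continuous_intros)

text \<open>Orthogonality of the characters of the circle. For \<open>k \<noteq> 0\<close> the
  antiderivative has period \<open>2 * pi\<close>, so its boundary terms cancel.\<close>

lemma integral_cis_circle:
  "(\<integral>a. cis (of_int k * a) \<partial>circle) = (if k = 0 then 1 else 0)"
proof -
  have *: "has_bochner_integral lborel (\<lambda>a. indicator {0..2*pi} a *\<^sub>R cis (of_int k * a))
     (if k = 0 then of_real (2*pi) else 0)"
  proof (cases "k = 0")
    case True
    have "has_bochner_integral lborel (\<lambda>a. indicator {0..2*pi} a *\<^sub>R (1::complex)) (measure lborel {0..2*pi} *\<^sub>R 1)"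
      by (intro has_bochner_integral_scaleR_left has_bochner_integral_real_indicator) auto
    then show ?thesis using True by (simp add: scaleR_conv_of_real)
  next
    case False
    have i2: "- (\<i> * (z * \<i>)) = z" for z by (simp add: complex_eq_iff)
    define F where "F a = cis (of_int k * a) / (\<i> * of_int k)" for a :: real
    have "has_bochner_integral lborel (\<lambda>a. indicator {0..2*pi} a *\<^sub>R cis (of_int k * a)) (F (2*pi) - F 0)"
    proof (rule has_bochner_integral_FTC_Icc)
      fix x :: real
      have "((\<lambda>z. exp (\<i> * (of_int k * z)) / (\<i> * of_int k)) has_field_derivative
         exp (\<i> * (of_int k * of_real x))) (at (of_real x))"
        using False i2 by (auto intro!: derivative_eq_intros)
      from has_vector_derivative_real_field[OF this]
      show "(F has_vector_derivative cis (of_int k * x)) (at x within {0..2*pi})"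
        by (simp add: F_def[abs_def] cis_conv_exp)
    qed (auto intro!: continuous_intros)
    moreover have "cis (of_int k * (2*pi)) = 1"
      using cis_multiple_2pi[of "of_int k"] by (simp add: mult_ac)
    ultimately show ?thesis using False by (simp add: F_def)
  qed
  have "(\<integral>a. cis (of_int k * a) \<partial>circle) =
     (\<integral>a. indicator {0..2*pi} a *\<^sub>R cis (of_int k * a) \<partial>lborel) / (2*pi)"
  proof -
    have e: "indicator {0..2*pi} x / emeasure lborel {0..2*pi} = ennreal (indicator {0..2*pi} x / (2*pi))" for x :: real
      by (auto simp: indicator_def divide_ennreal simp flip: ennreal_1)
    have "(\<integral>a. cis (of_int k * a) \<partial>circle) = (\<integral>a. (indicator {0..2*pi} a / (2*pi)) *\<^sub>R cis (of_int k * a) \<partial>lborel)"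
      unfolding circle_def uniform_measure_def e by (subst integral_density) auto
    also have "\<dots> = (\<integral>a. (indicator {0..2*pi} a *\<^sub>R cis (of_int k * a)) / (2*pi) \<partial>lborel)"
      by (intro Bochner_Integration.integral_cong) (auto simp: scaleR_conv_of_real)
    finally show ?thesis by simp
  qed
  then show ?thesis
    using * by (auto dest!: has_bochner_integral_integral_eq)
qed

text \<open>A nonnegative Fourier transform makes \<open>pmf q (m - n)\<close> a positive definite
  kernel in \<open>m\<close> and \<open>n\<close>, whence the name. Strict positivity gives in
  addition a lower bound against which relative errors are measured.\<close>

locale positive_definite_pmf =
  fixes q :: "int pmf"
  assumes symmetric: "pmf q (- n) = pmf q n"
    and second_moment: "integrable (measure_pmf q) (\<lambda>n. (of_int n)\<^sup>2 :: real)"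
    and fourier_pos: "\<And>a::real. 0 < measure_pmf.expectation q (\<lambda>n. cos (of_int n * a))"
begin

definition \<phi> :: "real \<Rightarrow> real" where
  "\<phi> a = measure_pmf.expectation q (\<lambda>n. cos (of_int n * a))"

lemma integrable_bounded: "(\<And>n. \<bar>f n\<bar> \<le> B) \<Longrightarrow> integrable (measure_pmf q) (f :: int \<Rightarrow> real)"
  by (rule measure_pmf.integrable_const_bound[where B=B]) auto

lemma \<phi>_pos: "0 < \<phi> a"
  unfolding \<phi>_def by (rule fourier_pos)

lemma \<phi>_le_1: "\<phi> a \<le> 1"
proof -
  have "\<phi> a \<le> measure_pmf.expectation q (\<lambda>n. 1)"
    unfolding \<phi>_def by (intro integral_mono integrable_bounded[where B=1]) auto
  then show ?thesis by simp
qed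

lemma continuous_\<phi>: "continuous_on UNIV \<phi>"
  unfolding continuous_on_sequentially
proof safe
  fix x :: "nat \<Rightarrow> real" and a assume "x \<longlonglongrightarrow> a"
  then show "(\<phi> \<circ> x) \<longlonglongrightarrow> \<phi> a"
    unfolding \<phi>_def o_def
    by (intro integral_dominated_convergence[where w="\<lambda>_. 1"])
       (auto intro!: tendsto_intros)
qed

lemma measurable_\<phi> [measurable]: "\<phi> \<in> borel_measurable borel"
  using continuous_\<phi> by (rule borel_measurable_continuous_onI)

text \<open>A continuous positive function of period \<open>2 * pi\<close> attains a positive
  minimum over one period. The bound turns the absolute errors in
  \<open>\<phi>_shift_product\<close> into relative ones.\<close>

lemma \<phi>_lower: obtains \<delta> where "0 < \<delta>" "\<delta> \<le> 1" "\<And>a. \<delta> \<le> \<phi> a"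
proof -
  have "continuous_on {0..2*pi} \<phi>"
    using continuous_\<phi> by (rule continuous_on_subset) auto
  then obtain b where b: "b \<in> {0..2*pi}" "\<forall>a\<in>{0..2*pi}. \<phi> b \<le> \<phi> a"
    using continuous_attains_inf[of "{0..2*pi}" \<phi>] by auto
  have "\<phi> b \<le> \<phi> a" for a
  proof -
    define m where "m = \<lfloor>a / (2*pi)\<rfloor>"
    have "a - of_int m * (2*pi) \<in> {0..2*pi}"
      using floor_divide_lower[of "2*pi" a] floor_divide_upper[of "2*pi" a]
      by (auto simp: m_def algebra_simps)
    moreover have "\<phi> (a - of_int m * (2*pi)) = \<phi> a"
      unfolding \<phi>_def
    proof (rule Bochner_Integration.integral_cong[OF refl])
      fix n :: int
      have "cos (of_int n * (a - of_int m * (2*pi))) = cos (of_int n * a - 2 * pi * of_int (n*m))"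
        by (simp add: algebra_simps)
      also have "\<dots> = cos (of_int n * a)"
        by (simp only: cos_diff cos_int_2pin sin_int_2pin)
      finally show "cos (of_int n * (a - of_int m * (2*pi))) = cos (of_int n * a)" .
    qed
    ultimately show ?thesis using b by metis
  qed
  with that[of "\<phi> b"] \<phi>_pos \<phi>_le_1 show ?thesis by auto
qed

text \<open>Fourier inversion: translating \<open>\<phi>\<close> by \<open>t\<close> multiplies its
  \<open>n\<close>-th coefficient by a character of \<open>t\<close>. Symmetry of \<open>q\<close>
  lets the cosine stand for the exponential.\<close>

lemma integral_\<phi>_cis:
  "(\<integral>a. of_real (\<phi> (a - t)) * cis (of_int n * a) \<partial>circle) = of_real (pmf q n) * cis (of_int n * t)"
proof -
  let ?f = "\<lambda>(m::int) a. of_real (cos (of_int m * (a - t))) * cis (of_int n * a)"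
  interpret P: pair_prob_space "measure_pmf q" circle ..
  have [measurable]: "case_prod ?f \<in> borel_measurable (count_space UNIV \<Otimes>\<^sub>M borel)"
    by (rule measurable_pair_measure_countable1) (auto intro!: borel_measurable_continuous_onI continuous_intros)
  have int: "integrable (measure_pmf q \<Otimes>\<^sub>M circle) (case_prod ?f)"
  proof (rule P.integrable_const_bound[where B=1])
    show "AE x in measure_pmf q \<Otimes>\<^sub>M circle. cmod (case_prod ?f x) \<le> 1"
      by (auto simp: norm_mult)
    have "sets (measure_pmf q \<Otimes>\<^sub>M circle) = sets (count_space UNIV \<Otimes>\<^sub>M borel)"
      by (intro sets_pair_measure_cong) auto
    then show "case_prod ?f \<in> borel_measurable (measure_pmf q \<Otimes>\<^sub>M circle)"
      by (subst measurable_cong_sets) auto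
  qed
  have f1: "of_real (\<phi> (a - t)) * cis (of_int n * a) = (\<integral>m. ?f m a \<partial>measure_pmf q)" for a
    unfolding \<phi>_def by (simp flip: integral_complex_of_real)
  have cc: "of_real (cos x) = (cis x + cis (-x)) / 2" for x :: real
    by (simp add: complex_eq_iff)
  have ci: "integrable circle (\<lambda>a. cis (of_int k * a))" for k
    by (intro circle.integrable_const_bound[where B=1]) auto
  \<comment> \<open>The cosine carries the frequencies \<open>m\<close> and \<open>- m\<close> with
    weight 1/2 each. Only \<open>m = n\<close> and \<open>m = - n\<close> survive; for
    \<open>n = 0\<close> both indicators hold at once.\<close>
  have f2: "(\<integral>a. ?f m a \<partial>circle) = ((if m = -n then 1 else 0) * cis (of_int n * t) + (if m = n then 1 else 0) * cis (of_int n * t)) / 2" for m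
  proof -
    have "?f m a = (cis (- (of_int m * t)) * cis (of_int (m + n) * a) + cis (of_int m * t) * cis (of_int (n - m) * a)) / 2" for a
      unfolding cc by (simp add: cis_mult ring_distribs algebra_simps)
    then have "(\<integral>a. ?f m a \<partial>circle) = (cis (- (of_int m * t)) * (\<integral>a. cis (of_int (m + n) * a) \<partial>circle)
       + cis (of_int m * t) * (\<integral>a. cis (of_int (n - m) * a) \<partial>circle)) / 2"
      by (simp only: integral_divide_zero integral_mult_right_zero Bochner_Integration.integral_add[OF integrable_mult_right integrable_mult_right, OF ci ci])
    then show ?thesis
      unfolding integral_cis_circle by auto
  qed
  have "(\<integral>a. of_real (\<phi> (a - t)) * cis (of_int n * a) \<partial>circle) = (\<integral>m. (\<integral>a. ?f m a \<partial>circle) \<partial>measure_pmf q)"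
    unfolding f1 using P.Fubini_integral[OF int] by simp
  also have "\<dots> = (\<integral>m. (of_real (indicator {-n} m) * cis (of_int n * t) + of_real (indicator {n} m) * cis (of_int n * t)) / 2 \<partial>measure_pmf q)"
    unfolding f2 by (intro Bochner_Integration.integral_cong) (auto simp: indicator_def)
  also have "\<dots> = of_real (pmf q n) * cis (of_int n * t)"
  proof -
    have "integrable (measure_pmf q) (\<lambda>m. of_real (indicator {k} m) * (cis (of_int n * t)))" for k
      by (intro integrable_mult_left) (auto intro!: integrable_of_real integrable_bounded[where B=1])
    then show ?thesis
      by (simp add: Bochner_Integration.integral_add) (simp add: measure_pmf_single symmetric)
  qed
  finally show ?thesis .
qed

text \<open>By the addition theorem the product is \<open>(A - B) * (A + B)\<close>. The even part
  \<open>A\<close> loses only order \<open>t\<^sup>2\<close> against \<open>\<phi> a\<close>, and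
  the odd part \<open>B\<close> is of order \<open>t\<close> and enters squared.\<close>

lemma \<phi>_shift_product: obtains K where "0 < K" "\<And>a t. \<phi> (a + t) * \<phi> (a - t) \<ge> (\<phi> a)\<^sup>2 * (1 - K * t\<^sup>2)"
proof -
  obtain \<delta> where \<delta>: "0 < \<delta>" "\<delta> \<le> 1" "\<And>a. \<delta> \<le> \<phi> a" by (rule \<phi>_lower) blast
  define s where "s = measure_pmf.expectation q (\<lambda>n. (of_int n)\<^sup>2 :: real)"
  have s0: "0 \<le> s" unfolding s_def by (intro Bochner_Integration.integral_nonneg) auto
  \<comment> \<open>Both \<open>(\<phi> a)\<^sup>2 - A\<^sup>2\<close> and \<open>B\<^sup>2\<close>
    are at most \<open>s * t\<^sup>2\<close>; the factor
    \<open>(\<phi> a)\<^sup>2 / \<delta>\<^sup>2\<close>, which is at least 1, makes their sum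
    relative. The added 1 keeps \<open>K\<close> positive when \<open>s = 0\<close>.\<close>
  define K where "K = 2 * s / \<delta>\<^sup>2 + 1"
  have "\<phi> (a + t) * \<phi> (a - t) \<ge> (\<phi> a)\<^sup>2 * (1 - K * t\<^sup>2)" for a t
  proof -
    define A where "A = measure_pmf.expectation q (\<lambda>n. cos (of_int n * a) * cos (of_int n * t))"
    define B where "B = measure_pmf.expectation q (\<lambda>n. sin (of_int n * a) * sin (of_int n * t))"
    have iA: "integrable (measure_pmf q) (\<lambda>n. cos (of_int n * a) * cos (of_int n * t))"
      by (rule integrable_bounded[where B=1]) (auto simp: abs_mult intro!: mult_le_one)
    have iB: "integrable (measure_pmf q) (\<lambda>n. sin (of_int n * a) * sin (of_int n * t))"
      by (rule integrable_bounded[where B=1]) (auto simp: abs_mult intro!: mult_le_one)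
    have pm: "\<phi> (a + t) = A - B" "\<phi> (a - t) = A + B"
      unfolding A_def B_def \<phi>_def using iA iB
      by (simp_all add: ring_distribs cos_add cos_diff)
    have sm: "\<bar>sin x\<bar> \<le> \<bar>x\<bar>" "1 - cos x \<le> x\<^sup>2 / 2" for x :: real
    proof -
      show s: "\<bar>sin x\<bar> \<le> \<bar>x\<bar>" for x :: real by (rule abs_sin_x_le_abs_x)
      have "(sin (x/2))\<^sup>2 \<le> (x/2)\<^sup>2" for x :: real by (rule iffD1[OF abs_le_square_iff s])
      then show "1 - cos x \<le> x\<^sup>2 / 2" for x :: real
        using cos_double_sin[of "x/2"] by (simp add: power_divide mult.commute)
    qed
    have Bs: "B\<^sup>2 \<le> s * t\<^sup>2"
    proof -
      \<comment> \<open>Nonnegativity of the variance.\<close>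
      have "B\<^sup>2 \<le> measure_pmf.expectation q (\<lambda>n. (sin (of_int n * a) * sin (of_int n * t))\<^sup>2)"
        using measure_pmf.variance_eq[OF iB integrable_bounded[where B=1]]
          measure_pmf.variance_positive[of q "\<lambda>n. sin (of_int n * a) * sin (of_int n * t)"]
        by (simp add: B_def power_mult_distrib abs_square_le_1 mult_le_one)
      also have "\<dots> \<le> measure_pmf.expectation q (\<lambda>n. (of_int n)\<^sup>2 * t\<^sup>2)"
      proof (rule integral_mono)
        show "integrable (measure_pmf q) (\<lambda>n. (sin (of_int n * a) * sin (of_int n * t))\<^sup>2)"
          by (rule integrable_bounded[where B=1]) (auto simp: power_mult_distrib abs_square_le_1 intro!: mult_le_one)
        show "integrable (measure_pmf q) (\<lambda>n. (of_int n)\<^sup>2 * t\<^sup>2)" using second_moment by simp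
        fix n :: int
        have "\<bar>sin (of_int n * a) * sin (of_int n * t)\<bar> \<le> 1 * \<bar>of_int n * t\<bar>"
          unfolding abs_mult[of "sin _"] by (intro mult_mono sm) auto
        then show "(sin (of_int n * a) * sin (of_int n * t))\<^sup>2 \<le> (of_int n)\<^sup>2 * t\<^sup>2"
          unfolding power_mult_distrib[symmetric] using abs_le_square_iff by fastforce
      qed
      also have "\<dots> = s * t\<^sup>2" by (simp add: s_def)
      finally show ?thesis .
    qed
    have As: "\<phi> a - A \<le> s * t\<^sup>2 / 2"
    proof -
      have "\<phi> a - A = measure_pmf.expectation q (\<lambda>n. cos (of_int n * a) * (1 - cos (of_int n * t)))"
        unfolding \<phi>_def A_def using iA integrable_bounded[of "\<lambda>n. cos (of_int n * a)" 1]
        by (simp add: ring_distribs)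
      also have "\<dots> \<le> measure_pmf.expectation q (\<lambda>n. (of_int n)\<^sup>2 * t\<^sup>2 / 2)"
      proof (rule integral_mono)
        show "integrable (measure_pmf q) (\<lambda>n. cos (of_int n * a) * (1 - cos (of_int n * t)))"
          using iA integrable_bounded[of "\<lambda>n. cos (of_int n * a)" 1] by (simp add: ring_distribs)
        show "integrable (measure_pmf q) (\<lambda>n. (of_int n)\<^sup>2 * t\<^sup>2 / 2)" using second_moment by simp
        fix n :: int
        have "cos (of_int n * a) * (1 - cos (of_int n * t)) \<le> 1 * (1 - cos (of_int n * t))"
          by (intro mult_right_mono) auto
        also have "\<dots> \<le> (of_int n)\<^sup>2 * t\<^sup>2 / 2" using sm(2)[of "of_int n * t"] by (simp add: power_mult_distrib)
        finally show "cos (of_int n * a) * (1 - cos (of_int n * t)) \<le> (of_int n)\<^sup>2 * t\<^sup>2 / 2" .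
      qed
      also have "\<dots> = s * t\<^sup>2 / 2" by (simp add: s_def)
      finally show ?thesis .
    qed
    have p: "0 < \<phi> a" "\<phi> a \<le> 1" "\<delta> \<le> \<phi> a" using \<phi>_pos \<phi>_le_1 \<delta> by auto
    have "(\<phi> a)\<^sup>2 - A\<^sup>2 \<le> 2 * \<phi> a * (\<phi> a - A)"
      using zero_le_power2[of "\<phi> a - A"] by (simp add: power2_eq_square algebra_simps)
    also have "\<dots> \<le> 2 * \<phi> a * (s * t\<^sup>2 / 2)" using As p by (intro mult_left_mono) auto
    also have "\<dots> \<le> s * t\<^sup>2" using p s0 mult_right_mono[of "\<phi> a" 1 "s * t\<^sup>2"] by simp
    finally have "(\<phi> a)\<^sup>2 - (A\<^sup>2 - B\<^sup>2) \<le> 2 * s * t\<^sup>2" using Bs by simp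
    also have "\<dots> \<le> 2 * s * t\<^sup>2 * ((\<phi> a)\<^sup>2 / \<delta>\<^sup>2)"
    proof -
      have "1 \<le> (\<phi> a)\<^sup>2 / \<delta>\<^sup>2" using p \<delta>(1) by (simp add: power_mono)
      then show ?thesis using s0 mult_left_mono[of 1 "(\<phi> a)\<^sup>2 / \<delta>\<^sup>2" "2 * s * t\<^sup>2"] by simp
    qed
    also have "\<dots> \<le> (\<phi> a)\<^sup>2 * (K * t\<^sup>2)"
      unfolding K_def by (simp add: algebra_simps)
    finally show ?thesis unfolding pm by (simp add: algebra_simps power2_eq_square)
  qed
  moreover have "K > 0" unfolding K_def using s0 \<delta>(1) by (simp add: add_nonneg_pos)
  ultimately show ?thesis using that by blast
qed

text \<open>\<open>pmf q 0\<close> is the mean of \<open>\<phi>\<close> over the circle. Flat edges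
  therefore always have positive weight, even if \<open>U\<close> is infinite elsewhere.\<close>

lemma pmf_0_pos: "0 < pmf q 0"
proof -
  obtain \<delta> where \<delta>: "0 < \<delta>" "\<delta> \<le> 1" "\<And>a. \<delta> \<le> \<phi> a" by (rule \<phi>_lower) blast
  have "integrable circle \<phi>"
    by (rule circle.integrable_const_bound[where B=1]) (auto simp: \<phi>_le_1 less_imp_le[OF \<phi>_pos] abs_of_pos[OF \<phi>_pos])
  then have "\<delta> \<le> (\<integral>a. \<phi> a \<partial>circle)"
    using integral_mono[of circle "\<lambda>_. \<delta>" \<phi>] \<delta> circle.prob_space by (simp)
  also have "\<dots> = pmf q 0"
  proof -
    have "complex_of_real (\<integral>a. \<phi> a \<partial>circle) = of_real (pmf q 0)"
      using integral_\<phi>_cis[of 0 0] by simp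
    then show ?thesis by (simp only: of_real_eq_iff)
  qed
  finally show ?thesis using \<delta> by simp
qed

section \<open>Fourier identities for sums over differences\<close>

text \<open>Summing over differences turns the characters into a squared modulus, so that the density is
  nonnegative. This takes the place of the divergence-free constraint in the dual model.\<close>

lemma pairing_integral:
  fixes I :: "'e set" and J :: "'j set" and D :: "'j \<Rightarrow> 'e \<Rightarrow> int" and t :: "'e \<Rightarrow> real"
  assumes I: "finite I"
  defines "T \<equiv> \<lambda>\<alpha>. (cmod (\<Sum>j\<in>J. \<Prod>e\<in>I. cis (of_int (D j e) * \<alpha> e)))\<^sup>2"
  shows "integrable (\<Pi>\<^sub>M e\<in>I. circle) (\<lambda>\<alpha>. (\<Prod>e\<in>I. \<phi> (\<alpha> e - t e)) * T \<alpha>)"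
    and "(\<Sum>j\<in>J. \<Sum>k\<in>J. (\<Prod>e\<in>I. pmf q (D j e - D k e)) * cos (\<Sum>e\<in>I. t e * of_int (D j e - D k e))) =
      (\<integral>\<alpha>. (\<Prod>e\<in>I. \<phi> (\<alpha> e - t e)) * T \<alpha> \<partial>(\<Pi>\<^sub>M e\<in>I. circle))"
proof -
  interpret product_sigma_finite "\<lambda>_::'e. circle" ..
  let ?P = "\<Pi>\<^sub>M e\<in>I. circle"
  define f where "f j k \<alpha> = (\<Prod>e\<in>I. of_real (\<phi> (\<alpha> e - t e)) * cis (of_int (D j e - D k e) * \<alpha> e))" for j k \<alpha>
  have int1: "integrable circle (\<lambda>a. of_real (\<phi> (a - s)) * cis (of_int n * a))" for s n
    by (rule circle.integrable_const_bound[where B=1]) (auto simp: norm_mult \<phi>_le_1 abs_of_pos[OF \<phi>_pos])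
  have intf: "integrable ?P (f j k)" for j k
    unfolding f_def[abs_def] by (rule product_integrable_prod[OF I]) (rule int1)
  have eqf: "(\<integral>\<alpha>. f j k \<alpha> \<partial>?P) = (\<Prod>e\<in>I. of_real (pmf q (D j e - D k e)) * cis (of_int (D j e - D k e) * t e))" for j k
    unfolding f_def by (subst product_integral_prod[OF I int1]) (simp only: integral_\<phi>_cis)
  have split: "(\<Sum>j\<in>J. \<Sum>k\<in>J. f j k \<alpha>) = of_real ((\<Prod>e\<in>I. \<phi> (\<alpha> e - t e)) * T \<alpha>)" for \<alpha>
  proof -
    define X where "X j = (\<Prod>e\<in>I. cis (of_int (D j e) * \<alpha> e))" for j
    have "f j k \<alpha> = of_real (\<Prod>e\<in>I. \<phi> (\<alpha> e - t e)) * (X j * cnj (X k))" for j k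
      unfolding f_def X_def by (simp add: prod.distrib[symmetric] cis_mult cis_cnj ring_distribs)
    then have "(\<Sum>j\<in>J. \<Sum>k\<in>J. f j k \<alpha>) = of_real (\<Prod>e\<in>I. \<phi> (\<alpha> e - t e)) * ((\<Sum>j\<in>J. X j) * cnj (\<Sum>k\<in>J. X k))"
      by (simp only: sum_product cnj_sum) (simp only: sum_distrib_left)
    also have "\<dots> = of_real ((\<Prod>e\<in>I. \<phi> (\<alpha> e - t e)) * T \<alpha>)"
      unfolding T_def X_def complex_norm_square[symmetric] by simp
    finally show ?thesis .
  qed
  have int2: "integrable ?P (\<lambda>\<alpha>. complex_of_real ((\<Prod>e\<in>I. \<phi> (\<alpha> e - t e)) * T \<alpha>))"
    unfolding split[symmetric] using intf by auto
  then show "integrable ?P (\<lambda>\<alpha>. (\<Prod>e\<in>I. \<phi> (\<alpha> e - t e)) * T \<alpha>)"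
    by (simp only: complex_of_real_integrable_eq)
  have "complex_of_real (\<integral>\<alpha>. (\<Prod>e\<in>I. \<phi> (\<alpha> e - t e)) * T \<alpha> \<partial>?P) = (\<integral>\<alpha>. (\<Sum>j\<in>J. \<Sum>k\<in>J. f j k \<alpha>) \<partial>?P)"
    unfolding split by (rule integral_complex_of_real[symmetric])
  also have "\<dots> = (\<Sum>j\<in>J. \<Sum>k\<in>J. (\<Prod>e\<in>I. of_real (pmf q (D j e - D k e)) * cis (of_int (D j e - D k e) * t e)))"
    by (simp add: intf eqf)
  also have "\<dots> = (\<Sum>j\<in>J. \<Sum>k\<in>J. of_real (\<Prod>e\<in>I. pmf q (D j e - D k e)) * cis (\<Sum>e\<in>I. t e * of_int (D j e - D k e)))"
  proof -
    have "(\<Prod>e\<in>I. cis (g e)) = cis (\<Sum>e\<in>I. g e)" for g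
      using I by (induction I) (auto simp: cis_mult)
    then show ?thesis by (simp add: prod.distrib mult.commute)
  qed
  \<comment> \<open>The integral is real, so taking real parts turns the characters into cosines
    without matching \<open>(j, k)\<close> with \<open>(k, j)\<close>.\<close>
  finally have "Re (complex_of_real (\<integral>\<alpha>. (\<Prod>e\<in>I. \<phi> (\<alpha> e - t e)) * T \<alpha> \<partial>?P)) = Re \<dots>" by simp
  then show "(\<Sum>j\<in>J. \<Sum>k\<in>J. (\<Prod>e\<in>I. pmf q (D j e - D k e)) * cos (\<Sum>e\<in>I. t e * of_int (D j e - D k e))) =
      (\<integral>\<alpha>. (\<Prod>e\<in>I. \<phi> (\<alpha> e - t e)) * T \<alpha> \<partial>?P)"
    by (simp del: of_real_prod)
qed

text \<open>Replacing \<open>\<phi>\<close> by its upper bound \<open>1\<close> replaces \<open>pmf q\<close> by the point mass at \<open>0\<close>. This is why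
  partition functions are finite.\<close>

lemma pairing_le_card:
  fixes D :: "'j \<Rightarrow> 'e \<Rightarrow> int"
  assumes I: "finite I" and J: "finite J"
    and inj: "\<And>j k. j \<in> J \<Longrightarrow> k \<in> J \<Longrightarrow> (\<forall>e\<in>I. D j e = D k e) \<Longrightarrow> j = k"
  shows "(\<Sum>j\<in>J. \<Sum>k\<in>J. \<Prod>e\<in>I. pmf q (D j e - D k e)) \<le> real (card J)"
proof -
  interpret product_sigma_finite "\<lambda>_::'e. circle" ..
  let ?P = "\<Pi>\<^sub>M e\<in>I. circle"
  interpret P: prob_space ?P by (rule prob_space_PiM) (rule circle.prob_space_axioms)
  define X where "X \<alpha> j = (\<Prod>e\<in>I. cis (of_int (D j e) * \<alpha> e))" for j \<alpha>
  define T where "T \<alpha> = (cmod (\<Sum>j\<in>J. X \<alpha> j))\<^sup>2" for \<alpha>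
  have int1: "integrable circle (\<lambda>a. cis (of_int n * a))" for n
    by (rule circle.integrable_const_bound[where B=1]) auto
  have XX: "X \<alpha> j * cnj (X \<alpha> k) = (\<Prod>e\<in>I. cis (of_int (D j e - D k e) * \<alpha> e))" for j k \<alpha>
    unfolding X_def by (simp add: prod.distrib[symmetric] cis_mult cis_cnj ring_distribs)
  have intX: "integrable ?P (\<lambda>\<alpha>. X \<alpha> j * cnj (X \<alpha> k))" for j k
    unfolding XX by (rule product_integrable_prod[OF I]) (rule int1)
  \<comment> \<open>By \<open>inj\<close>, different \<open>j\<close> give different characters of
    the torus, hence an orthonormal family; the integral of \<open>T\<close> is then Parseval's
    identity.\<close>
  have eqX: "(\<integral>\<alpha>. X \<alpha> j * cnj (X \<alpha> k) \<partial>?P) = (if j = k then 1 else 0)" if "j \<in> J" "k \<in> J" for j k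
  proof -
    have "(\<integral>\<alpha>. X \<alpha> j * cnj (X \<alpha> k) \<partial>?P) = (\<Prod>e\<in>I. if D j e - D k e = 0 then 1 else 0)"
      unfolding XX by (subst product_integral_prod[OF I int1]) (simp only: integral_cis_circle)
    also have "\<dots> = (if \<forall>e\<in>I. D j e = D k e then 1 else 0)"
      using I by (auto intro!: prod.neutral prod_zero)
    finally show ?thesis using inj[OF that] by auto
  qed
  have TX: "complex_of_real (T \<alpha>) = (\<Sum>j\<in>J. \<Sum>k\<in>J. X \<alpha> j * cnj (X \<alpha> k))" for \<alpha>
    unfolding T_def complex_norm_square by (simp add: sum_product)
  have intT: "integrable ?P T"
  proof -
    have "integrable ?P (\<lambda>\<alpha>. complex_of_real (T \<alpha>))"
      unfolding TX using intX by auto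
    then show ?thesis by (simp only: complex_of_real_integrable_eq)
  qed
  have "complex_of_real (\<integral>\<alpha>. T \<alpha> \<partial>?P) = (\<Sum>j\<in>J. \<Sum>k\<in>J. if j = k then 1 else 0)"
    unfolding integral_complex_of_real[symmetric] TX by (simp add: intX eqX)
  also have "\<dots> = of_real (real (card J))" using J by simp
  finally have eqT: "(\<integral>\<alpha>. T \<alpha> \<partial>?P) = real (card J)" by (simp only: of_real_eq_iff)
  have "(\<Sum>j\<in>J. \<Sum>k\<in>J. \<Prod>e\<in>I. pmf q (D j e - D k e)) = (\<integral>\<alpha>. (\<Prod>e\<in>I. \<phi> (\<alpha> e)) * T \<alpha> \<partial>?P)"
    using pairing_integral(2)[OF I, where t="\<lambda>_. 0" and J=J and D=D] by (simp add: T_def X_def)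
  also have "\<dots> \<le> (\<integral>\<alpha>. T \<alpha> \<partial>?P)"
  proof (rule integral_mono)
    show "integrable ?P (\<lambda>\<alpha>. (\<Prod>e\<in>I. \<phi> (\<alpha> e)) * T \<alpha>)"
      using pairing_integral(1)[OF I, where t="\<lambda>_. 0" and J=J and D=D] by (simp add: T_def X_def)
    show "(\<Prod>e\<in>I. \<phi> (\<alpha> e)) * T \<alpha> \<le> T \<alpha>" for \<alpha>
      using mult_right_mono[of "\<Prod>e\<in>I. \<phi> (\<alpha> e)" 1 "T \<alpha>"]
      by (simp add: T_def prod_le_1 \<phi>_le_1 less_imp_le[OF \<phi>_pos])
  qed (rule intT)
  finally show ?thesis unfolding eqT .
qed

text \<open>The cosine is even, so the shifts by \<open>t\<close> and \<open>- t\<close> give the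
  same integral, and their mean may be compared pointwise with the unshifted integrand.
  Nonnegativity of \<open>T\<close> preserves that comparison under the integral.\<close>

lemma pairing_cos_bound:
  fixes D :: "'j \<Rightarrow> 'e \<Rightarrow> int"
  assumes I: "finite I" and K: "0 < K" "\<And>a t. \<phi> (a + t) * \<phi> (a - t) \<ge> (\<phi> a)\<^sup>2 * (1 - K * t\<^sup>2)"
    and small: "K * (\<Sum>e\<in>I. (t e)\<^sup>2) \<le> 1"
  shows "(\<Sum>j\<in>J. \<Sum>k\<in>J. (\<Prod>e\<in>I. pmf q (D j e - D k e)) * (1 - cos (\<Sum>e\<in>I. t e * of_int (D j e - D k e))))
     \<le> K * (\<Sum>e\<in>I. (t e)\<^sup>2) * (\<Sum>j\<in>J. \<Sum>k\<in>J. \<Prod>e\<in>I. pmf q (D j e - D k e))"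
proof -
  let ?P = "\<Pi>\<^sub>M e\<in>(I::'e set). circle"
  define T where "T \<alpha> = (cmod (\<Sum>j\<in>J. \<Prod>e\<in>I. cis (of_int (D j e) * \<alpha> e)))\<^sup>2" for \<alpha>
  define S where "S t = (\<Sum>j\<in>J. \<Sum>k\<in>J. (\<Prod>e\<in>I. pmf q (D j e - D k e)) * cos (\<Sum>e\<in>I. t e * of_int (D j e - D k e)))" for t
  define W where "W t \<alpha> = (\<Prod>e\<in>I. \<phi> (\<alpha> e - t e))" for t \<alpha>
  define \<epsilon> where "\<epsilon> = K * (\<Sum>e\<in>I. (t e)\<^sup>2)"
  have S: "S t = (\<integral>\<alpha>. W t \<alpha> * T \<alpha> \<partial>?P)" and iS: "integrable ?P (\<lambda>\<alpha>. W t \<alpha> * T \<alpha>)" for t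
    unfolding S_def W_def T_def by (rule pairing_integral[OF I])+
  have sym: "S (\<lambda>e. - t e) = S t"
    unfolding S_def by (simp add: sum_negf)
  have eps: "0 \<le> \<epsilon>" "\<epsilon> \<le> 1"
    using small K(1) by (auto simp: \<epsilon>_def intro!: mult_nonneg_nonneg sum_nonneg)
  have Wpos: "0 < W t \<alpha>" for t \<alpha> unfolding W_def by (intro prod_pos) (auto simp: \<phi>_pos)
  \<comment> \<open>The comparison is made after squaring. By \<open>small\<close> every factor
    \<open>1 - K * (t e)\<^sup>2\<close> lies in [0, 1], so
    \<open>(1 - \<epsilon>)\<^sup>2 \<le> 1 - \<epsilon>\<close> and the Weierstrass product
    inequality reduce the claim to the shift bound on each edge; AM-GM for the two shifted products
    concludes.\<close>
  have key: "(1 - \<epsilon>) * W (\<lambda>_. 0) \<alpha> \<le> (W t \<alpha> + W (\<lambda>e. - t e) \<alpha>) / 2" for \<alpha>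
  proof -
    have te: "K * (t e)\<^sup>2 \<le> 1" if "e \<in> I" for e
    proof -
      have "(t e)\<^sup>2 \<le> (\<Sum>e\<in>I. (t e)\<^sup>2)" using I that by (intro member_le_sum) auto
      then have "K * (t e)\<^sup>2 \<le> \<epsilon>" unfolding \<epsilon>_def using K(1) by (intro mult_left_mono) auto
      then show ?thesis using eps by simp
    qed
    have "((1 - \<epsilon>) * W (\<lambda>_. 0) \<alpha>)\<^sup>2 \<le> (1 - \<epsilon>) * (W (\<lambda>_. 0) \<alpha>)\<^sup>2"
      unfolding power_mult_distrib using eps by (intro mult_right_mono) (auto simp: power2_eq_square mult_left_le)
    also have "\<dots> \<le> (\<Prod>e\<in>I. 1 - K * (t e)\<^sup>2) * (W (\<lambda>_. 0) \<alpha>)\<^sup>2"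
    proof (intro mult_right_mono)
      have "1 - (\<Sum>e\<in>I. K * (t e)\<^sup>2) \<le> (\<Prod>e\<in>I. 1 - K * (t e)\<^sup>2)"
        using te K(1) by (intro Weierstrass_prod_ineq) auto
      then show "1 - \<epsilon> \<le> (\<Prod>e\<in>I. 1 - K * (t e)\<^sup>2)" by (simp add: \<epsilon>_def sum_distrib_left)
    qed auto
    also have "\<dots> = (\<Prod>e\<in>I. (\<phi> (\<alpha> e))\<^sup>2 * (1 - K * (t e)\<^sup>2))"
      by (simp add: W_def prod.distrib prod_power_distrib mult.commute)
    also have "\<dots> \<le> (\<Prod>e\<in>I. \<phi> (\<alpha> e + t e) * \<phi> (\<alpha> e - t e))"
      using te K(2) by (intro prod_mono) auto
    also have "\<dots> = W t \<alpha> * W (\<lambda>e. - t e) \<alpha>"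
      by (simp add: W_def prod.distrib mult.commute)
    also have "\<dots> \<le> ((W t \<alpha> + W (\<lambda>e. - t e) \<alpha>) / 2)\<^sup>2"
      using zero_le_power2[of "W t \<alpha> - W (\<lambda>e. - t e) \<alpha>"] by (simp add: power2_eq_square field_simps)
    finally show ?thesis
      by (rule power2_le_imp_le) (simp add: less_imp_le Wpos)
  qed
  have "(1 - \<epsilon>) * S (\<lambda>_. 0) = (\<integral>\<alpha>. (1 - \<epsilon>) * (W (\<lambda>_. 0) \<alpha> * T \<alpha>) \<partial>?P)"
    unfolding S by simp
  also have "\<dots> \<le> (\<integral>\<alpha>. (W t \<alpha> * T \<alpha> + W (\<lambda>e. - t e) \<alpha> * T \<alpha>) / 2 \<partial>?P)"
  proof (intro integral_mono)
    show "(1 - \<epsilon>) * (W (\<lambda>_. 0) \<alpha> * T \<alpha>) \<le> (W t \<alpha> * T \<alpha> + W (\<lambda>e. - t e) \<alpha> * T \<alpha>) / 2" for \<alpha>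
      using mult_right_mono[OF key[of \<alpha>], of "T \<alpha>"] by (simp add: T_def algebra_simps add_divide_distrib)
  qed (use iS in auto)
  also have "\<dots> = S t"
    using iS sym unfolding S by simp
  finally have "S (\<lambda>_. 0) - S t \<le> \<epsilon> * S (\<lambda>_. 0)" by (simp add: algebra_simps)
  then show ?thesis unfolding S_def \<epsilon>_def
    by (simp add: sum_subtractf right_diff_distrib)
qed

text \<open>Apply \<open>pairing_cos_bound\<close> to \<open>s * t\<close> and let \<open>s\<close>
  tend to 0. Its smallness hypothesis then holds by itself, and
  \<open>(1 - cos (s * y)) / s\<^sup>2\<close> tends to \<open>y\<^sup>2 / 2\<close>, the origin of
  the factor 2.\<close>

lemma pairing_second_moment:
  fixes D :: "'j \<Rightarrow> 'e \<Rightarrow> int"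
  assumes I: "finite I" and K: "0 < K" "\<And>a t. \<phi> (a + t) * \<phi> (a - t) \<ge> (\<phi> a)\<^sup>2 * (1 - K * t\<^sup>2)"
  shows "(\<Sum>j\<in>J. \<Sum>k\<in>J. (\<Prod>e\<in>I. pmf q (D j e - D k e)) * (\<Sum>e\<in>I. t e * of_int (D j e - D k e))\<^sup>2)
     \<le> 2 * K * (\<Sum>e\<in>I. (t e)\<^sup>2) * (\<Sum>j\<in>J. \<Sum>k\<in>J. \<Prod>e\<in>I. pmf q (D j e - D k e))"
proof -
  define Q where "Q j k = (\<Prod>e\<in>I. pmf q (D j e - D k e))" for j k
  define y where "y j k = (\<Sum>e\<in>I. t e * of_int (D j e - D k e))" for j k
  define R where "R = (\<Sum>e\<in>I. (t e)\<^sup>2)"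
  have lim: "((\<lambda>s. (1 - cos (s * y)) / s\<^sup>2) \<longlongrightarrow> y\<^sup>2 / 2) (at_right 0)" for y :: real
  proof (cases "y = 0")
    case False
    then have "((\<lambda>s. (1 - cos (s * y)) / s\<^sup>2) \<longlongrightarrow> y * y / 2) (at_right 0)" by real_asymp
    then show ?thesis by (simp add: power2_eq_square)
  qed simp
  have "((\<lambda>s. \<Sum>j\<in>J. \<Sum>k\<in>J. Q j k * ((1 - cos (s * y j k)) / s\<^sup>2)) \<longlongrightarrow> (\<Sum>j\<in>J. \<Sum>k\<in>J. Q j k * ((y j k)\<^sup>2 / 2))) (at_right 0)"
    by (intro tendsto_intros lim)
  moreover have "eventually (\<lambda>s. (\<Sum>j\<in>J. \<Sum>k\<in>J. Q j k * ((1 - cos (s * y j k)) / s\<^sup>2)) \<le> K * R * (\<Sum>j\<in>J. \<Sum>k\<in>J. Q j k)) (at_right 0)"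
  proof -
    have "((\<lambda>s. K * (s\<^sup>2 * R)) \<longlongrightarrow> K * (0\<^sup>2 * R)) (at_right 0)" by (intro tendsto_intros)
    then have "eventually (\<lambda>s. K * (s\<^sup>2 * R) < 1) (at_right 0)" by (rule order_tendstoD) simp
    moreover have "eventually (\<lambda>s::real. s > 0) (at_right 0)" by (simp add: eventually_at_right_less)
    ultimately show ?thesis
    proof eventually_elim
      case (elim s)
      have "(\<Sum>j\<in>J. \<Sum>k\<in>J. Q j k * (1 - cos (s * y j k))) \<le> K * (s\<^sup>2 * R) * (\<Sum>j\<in>J. \<Sum>k\<in>J. Q j k)"
        using pairing_cos_bound[OF I K, of "\<lambda>e. s * t e" D J] elim
        unfolding Q_def y_def R_def by (simp add: power_mult_distrib sum_distrib_left[symmetric] mult.assoc)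
      then have "(\<Sum>j\<in>J. \<Sum>k\<in>J. Q j k * (1 - cos (s * y j k))) / s\<^sup>2 \<le> K * R * (\<Sum>j\<in>J. \<Sum>k\<in>J. Q j k)"
        using elim by (simp add: field_simps)
      then show ?case by (simp add: sum_divide_distrib)
    qed
  qed
  ultimately have "(\<Sum>j\<in>J. \<Sum>k\<in>J. Q j k * ((y j k)\<^sup>2 / 2)) \<le> K * R * (\<Sum>j\<in>J. \<Sum>k\<in>J. Q j k)"
    by (intro tendsto_upperbound) auto
  then show ?thesis unfolding Q_def[symmetric] y_def[symmetric] R_def[symmetric]
    by (simp add: sum_divide_distrib[symmetric])
qed

end

section \<open>Transience and unit flows of finite energy\<close>

text \<open>The probability that the walk from \<open>y\<close> is away from \<open>x\<close> at all
  times 0, ..., \<open>k\<close>, its starting time included.\<close>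

primrec avoidance :: "'v set set \<Rightarrow> 'v \<Rightarrow> nat \<Rightarrow> 'v \<Rightarrow> ennreal" where
  "avoidance E x 0 y = (if y = x then 0 else 1)"
| "avoidance E x (Suc k) y = (if y = x then 0 else \<integral>\<^sup>+z. avoidance E x k z \<partial>pmf_of_set (neighbours E y))"

text \<open>The Markov property at time 1. A walk from the first step \<open>z\<close> that avoids
  \<open>x\<close> at its own times 0 to \<open>k\<close> avoids it at times 1 to
  \<open>k + 1\<close> of the trajectory, hence the range \<open>{1..<k + 2}\<close>.\<close>

lemma srw_no_return_eq:
  fixes E :: "'v set set" and x :: 'v
  shows "emeasure (srw_law E x) {\<omega>\<in>space (srw_law E x). \<forall>i\<in>{1..<k + 2}. \<omega> i \<noteq> x} =
     (\<integral>\<^sup>+z. avoidance E x k z \<partial>pmf_of_set (neighbours E x))"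
proof -
  let ?M = "\<lambda>_::nat. count_space UNIV :: 'v measure"
  interpret IT: Ionescu_Tulcea "srw_kernel E x" ?M
    by (rule Ionescu_Tulcea_srw_kernel)
  let ?u = "\<lambda>_::nat. undefined :: 'v"
  have u: "?u \<in> space (PiM {0..<0} ?M)" by (simp add: space_PiM)
  \<comment> \<open>A hybrid of the two descriptions: coordinates 0 to \<open>m\<close> follow the
    trajectory law \<open>IT.C 0 (Suc m)\<close>, and the next \<open>k\<close> steps are left to
    the recursion \<open>avoidance\<close>.\<close>
  define Q where "Q m k = (\<integral>\<^sup>+\<omega>. (if \<forall>i\<in>{1..<m}. \<omega> i \<noteq> x then avoidance E x k (\<omega> m) else 0) \<partial>IT.C 0 (Suc m) ?u)" for m k
  have meas: "(\<lambda>\<omega>. if \<forall>i\<in>{1..<m}. \<omega> i \<noteq> x then f (\<omega> m) else 0) \<in> borel_measurable (PiM {0..<Suc m} ?M)"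
    for m and f :: "'v \<Rightarrow> ennreal"
  proof -
    have "(\<lambda>\<omega>. f (\<omega> m)) \<in> borel_measurable (PiM {0..<Suc m} ?M)"
      by (rule measurable_compose[OF measurable_component_singleton[of m]]) auto
    moreover have "Measurable.pred (PiM {0..<Suc m} ?M) (\<lambda>\<omega>. \<omega> i \<noteq> x)" if "i \<in> {1..<m}" for i
      by (rule measurable_compose[OF measurable_component_singleton[of i]]) (use that in auto)
    ultimately show ?thesis by measurable
  qed
  have integral_Suc: "(\<integral>\<^sup>+\<omega>. f \<omega> \<partial>IT.C 0 (Suc m) ?u) = (\<integral>\<^sup>+\<omega>. (\<integral>\<^sup>+y. f (fun_upd \<omega> m y) \<partial>srw_kernel E x m \<omega>) \<partial>IT.C 0 m ?u)"
    if [measurable]: "f \<in> borel_measurable (PiM {0..<Suc m} ?M)" for f :: "(nat \<Rightarrow> 'v) \<Rightarrow> ennreal" and m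
  proof -
    have "(\<integral>\<^sup>+\<omega>. f \<omega> \<partial>IT.C 0 (Suc m) ?u) = (\<integral>\<^sup>+\<omega>. (\<integral>\<^sup>+y. f y \<partial>IT.eP m \<omega>) \<partial>IT.C 0 m ?u)"
      unfolding IT.C.simps
    proof (subst nn_integral_bind[where B="PiM {0..<Suc m} ?M"])
      show "IT.eP (0 + m) \<in> IT.C 0 m ?u \<rightarrow>\<^sub>M subprob_algebra (PiM {0..<Suc m} ?M)"
        using IT.measurable_eP[of m] by (simp add: measurable_cong_sets[OF IT.sets_C[OF u]])
    qed auto
    also have "\<dots> = (\<integral>\<^sup>+\<omega>. (\<integral>\<^sup>+y. f (fun_upd \<omega> m y) \<partial>srw_kernel E x m \<omega>) \<partial>IT.C 0 m ?u)"
      using IT.space_C[OF u, of m]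
      by (intro nn_integral_cong IT.nn_integral_eP) (auto simp: that)
    finally show ?thesis .
  qed
  \<comment> \<open>One step is moved from the recursion to the trajectory. At \<open>m = 0\<close>
    this would fail: the walk is at \<open>x\<close> at time 0, and that must not count as a
    visit.\<close>
  have step: "Q m (Suc k) = Q (Suc m) k" if "1 \<le> m" for m k
  proof -
    have "Q (Suc m) k = (\<integral>\<^sup>+\<omega>. (\<integral>\<^sup>+y. (if \<forall>i\<in>{1..<Suc m}. \<omega> i \<noteq> x then avoidance E x k y else 0)
      \<partial>pmf_of_set (neighbours E (\<omega> m))) \<partial>IT.C 0 (Suc m) ?u)"
      unfolding Q_def by (subst integral_Suc[OF meas]) (auto simp: srw_kernel_def intro!: nn_integral_cong)
    also have "\<dots> = Q m (Suc k)"
    proof -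
      have eq: "(\<forall>i\<in>{1..<Suc m}. \<omega> i \<noteq> x) \<longleftrightarrow> (\<forall>i\<in>{1..<m}. \<omega> i \<noteq> x) \<and> \<omega> m \<noteq> x" for \<omega> :: "nat \<Rightarrow> 'v"
        using that by (auto simp: less_Suc_eq)
      have eq2: "(\<integral>\<^sup>+y. (if c \<and> a \<noteq> b then f y else 0) \<partial>M) = (if c then if a = b then 0 else \<integral>\<^sup>+y. f y \<partial>M else 0)"
        for c and a b :: 'v and f and M :: "'v measure"
        by simp
      show ?thesis unfolding Q_def eq eq2 avoidance.simps by (rule refl)
    qed
    finally show ?thesis ..
  qed
  have Q_shift: "Q (Suc j) k = Q (Suc (j + k)) 0" for j
  proof (induction k arbitrary: j)
    case (Suc k)
    then show ?case using step[of "Suc j" k] Suc[of "Suc j"] by simp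
  qed simp
  have "Q 1 k = (\<integral>\<^sup>+\<omega>. (\<integral>\<^sup>+y. avoidance E x k y \<partial>pmf_of_set (neighbours E (\<omega> 0))) \<partial>IT.C 0 (Suc 0) ?u)"
    unfolding Q_def One_nat_def by (subst integral_Suc[OF meas[of 1, unfolded One_nat_def]]) (auto simp: srw_kernel_def)
  also have "\<dots> = (\<integral>\<^sup>+y. avoidance E x k y \<partial>pmf_of_set (neighbours E x))"
  proof (subst integral_Suc)
    show "(\<lambda>\<omega>. \<integral>\<^sup>+y. avoidance E x k y \<partial>pmf_of_set (neighbours E (\<omega> 0))) \<in> borel_measurable (PiM {0..<Suc 0} ?M)"
      by (rule measurable_compose[OF measurable_component_singleton[of 0]]) auto
    show "(\<integral>\<^sup>+\<omega>. (\<integral>\<^sup>+y. (\<integral>\<^sup>+z. avoidance E x k z \<partial>pmf_of_set (neighbours E (fun_upd \<omega> 0 y 0))) \<partial>srw_kernel E x 0 \<omega>) \<partial>IT.C 0 0 ?u) =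
      (\<integral>\<^sup>+y. avoidance E x k y \<partial>pmf_of_set (neighbours E x))"
      by (simp add: srw_kernel_def nn_integral_return u)
  qed
  finally have Q1: "Q 1 k = (\<integral>\<^sup>+y. avoidance E x k y \<partial>pmf_of_set (neighbours E x))" .
  let ?n = "k + 2"
  define X where "X = {\<omega>\<in>space (PiM {0..<?n} ?M). \<forall>i\<in>{1..<?n}. \<omega> i \<noteq> x}"
  have X: "X \<in> sets (PiM {0..<?n} ?M)"
  proof -
    have "Measurable.pred (PiM {0..<?n} ?M) (\<lambda>\<omega>. \<omega> i \<noteq> x)" if "i \<in> {1..<?n}" for i
      by (rule measurable_compose[OF measurable_component_singleton[of i]]) (use that in auto)
    then show ?thesis unfolding X_def by measurable
  qed
  have "emeasure (srw_law E x) {\<omega>\<in>space (srw_law E x). \<forall>i\<in>{1..<?n}. \<omega> i \<noteq> x} =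
    emeasure IT.PF.lim (prod_emb UNIV ?M {0..<?n} X)"
    unfolding srw_law_def by (intro arg_cong2[where f=emeasure]) (auto simp: X_def prod_emb_def space_PiM)
  also have "\<dots> = emeasure (IT.C 0 ?n ?u) (prod_emb {0..<?n} ?M {0..<?n} X)"
    using X by (simp only: IT.lim finite_atLeastLessThan IT.emeasure_CI[OF order_refl])
  also have "prod_emb {0..<?n} ?M {0..<?n} X = X"
    by (rule prod_emb_id) (auto simp: X_def space_PiM)
  also have "emeasure (IT.C 0 ?n ?u) X = (\<integral>\<^sup>+\<omega>. indicator X \<omega> \<partial>IT.C 0 ?n ?u)"
    using X IT.sets_C[OF u, of ?n] by (simp add: nn_integral_indicator)
  also have "\<dots> = Q (Suc k) 0"
  proof -
    have sp: "space (IT.C 0 ?n ?u) = space (PiM {0..<?n} ?M)" using IT.space_C[OF u, of ?n] by simp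
    have n: "?n = Suc (Suc k)" by simp
    have "indicator X \<omega> = (if \<forall>i\<in>{1..<Suc k}. \<omega> i \<noteq> x then avoidance E x 0 (\<omega> (Suc k)) else 0)"
      if "\<omega> \<in> space (IT.C 0 ?n ?u)" for \<omega>
    proof -
      have "\<omega> \<in> X \<longleftrightarrow> (\<forall>i\<in>{1..<Suc k}. \<omega> i \<noteq> x) \<and> \<omega> (Suc k) \<noteq> x"
        using that[unfolded sp] unfolding X_def n by (auto simp: less_Suc_eq)
      then show ?thesis by (auto simp: indicator_def)
    qed
    then show ?thesis unfolding Q_def n by (rule nn_integral_cong)
  qed
  also have "\<dots> = Q 1 k" using Q_shift[of 0] by simp
  finally show ?thesis using Q1 by simp
qed

lemma avoidance_le_1: "avoidance E x k y \<le> 1"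
proof (induction k arbitrary: y)
  case (Suc k)
  have "(\<integral>\<^sup>+z. avoidance E x k z \<partial>pmf_of_set (neighbours E y)) \<le> (\<integral>\<^sup>+z. 1 \<partial>pmf_of_set (neighbours E y))"
    by (intro nn_integral_mono Suc.IH)
  then show ?case by simp
qed simp

text \<open>A walk that never returns has not returned by time \<open>k + 1\<close>.\<close>

lemma srw_no_return_ge:
  "ennreal (1 - \<P>(\<omega> in srw_law E x. \<exists>n\<ge>1. \<omega> n = x)) \<le> (\<integral>\<^sup>+z. avoidance E x k z \<partial>pmf_of_set (neighbours E x))"
proof -
  interpret IT: Ionescu_Tulcea "srw_kernel E x" "\<lambda>_. count_space UNIV"
    by (rule Ionescu_Tulcea_srw_kernel)
  \<comment> \<open>The total mass is read off the cylinder over the empty index set.\<close>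
  interpret prob_space "srw_law E x"
  proof
    have [simp]: "{\<lambda>x. undefined :: 'a} \<in> sets (PiM {} (\<lambda>_::nat. count_space UNIV))"
      using sets.top[of "PiM {} (\<lambda>_::nat. count_space UNIV :: 'a measure)"] by (simp add: space_PiM)
    have "emeasure IT.PF.lim (prod_emb UNIV (\<lambda>_. count_space UNIV) {} (space (PiM {} (\<lambda>_. count_space UNIV)))) = 1"
      by (subst IT.lim) (auto simp: space_PiM IT.PF.prob_space_P[THEN prob_space.emeasure_space_1, of "{}", unfolded IT.PF.space_P[of "{}", simplified] space_PiM, simplified])
    then show "emeasure (srw_law E x) (space (srw_law E x)) = 1"
      unfolding srw_law_def by (simp add: prod_emb_def space_PiM restrict_def vimage_def)
  qed
  have "1 - \<P>(\<omega> in srw_law E x. \<exists>n\<ge>1. \<omega> n = x) = prob (space (srw_law E x) - {\<omega>\<in>space (srw_law E x). \<exists>n\<ge>1. \<omega> n = x})"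
    by (rule prob_compl[symmetric]) (rule sets_srw_return)
  also have "ennreal \<dots> \<le> emeasure (srw_law E x) {\<omega>\<in>space (srw_law E x). \<forall>i\<in>{1..<k + 2}. \<omega> i \<noteq> x}"
    unfolding emeasure_eq_measure[symmetric]
  proof (rule emeasure_mono)
    show "{\<omega> \<in> space (srw_law E x). \<forall>i\<in>{1..<k + 2}. \<omega> i \<noteq> x} \<in> events"
      unfolding sets_eq_imp_space_eq[OF sets_srw_law] sets_srw_law by measurable
  qed auto
  finally show ?thesis unfolding srw_no_return_eq .
qed

lemma nn_integral_pmf_of_set_real:
  assumes "finite A" "A \<noteq> {}" and "\<And>z. 0 \<le> f z"
  shows "(\<integral>\<^sup>+z. ennreal (f z) \<partial>pmf_of_set A) = ennreal ((\<Sum>z\<in>A. f z) / card A)"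
  using assms set_pmf_of_set[OF assms(2,1)] by (subst nn_integral_eq_integral)
    (auto simp: integral_pmf_of_set simp del: set_pmf_of_set intro!: integrable_measure_pmf_finite)

section \<open>The killed walk, its Green function and the flow\<close>

locale transient_graph =
  fixes V :: "'v set" and E :: "'v set set"
  assumes simple: "simple_graph V E" and inf: "infinite V" and loc_fin: "locally_finite_graph V E"
    and conn: "connected_graph V E" and transient: "srw_transient V E"
begin

abbreviation N :: "'v \<Rightarrow> 'v set" where "N \<equiv> neighbours E"

lemma edge_endpoints: "{x, y} \<in> E \<Longrightarrow> x \<in> V \<and> y \<in> V \<and> x \<noteq> y"
  using simple unfolding simple_graph_def by (metis card_2_iff insert_absorb2 insert_subset is_singletonI is_singleton_altdef numeral_eq_one_iff semiring_norm(85))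

lemma finite_N: "x \<in> V \<Longrightarrow> finite (N x)"
  using loc_fin by (auto simp: locally_finite_graph_def)

lemma N_subset: "N x \<subseteq> V"
  using edge_endpoints by (auto simp: neighbours_def)

lemma N_nonempty: assumes "x \<in> V" shows "N x \<noteq> {}"
proof -
  obtain y where "y \<in> V" "y \<noteq> x" using inf assms by (metis finite.emptyI finite_insert finite_subset insertCI subsetI)
  then have "(x, y) \<in> {(u, v). {u, v} \<in> E}\<^sup>*" using conn assms by (auto simp: connected_graph_def)
  then show ?thesis using \<open>y \<noteq> x\<close> by (cases rule: converse_rtranclE) (auto simp: neighbours_def)
qed

lemma card_N_pos: "x \<in> V \<Longrightarrow> 0 < card (N x)"
  using N_nonempty finite_N by (auto simp: card_gt_0_iff)

definition escape :: "'v \<Rightarrow> real" where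
  "escape x = 1 - \<P>(\<omega> in srw_law E x. \<exists>n\<ge>1. \<omega> n = x)"

lemma escape_pos: "x \<in> V \<Longrightarrow> 0 < escape x"
  using transient by (auto simp: escape_def srw_transient_def)

text \<open>The walk is killed when it leaves \<open>\<Lambda>\<close>. As \<open>k\<close> grows, \<open>hit\<close> increases to a multiple of the Green
  function of \<open>\<Lambda>\<close> with pole at \<open>x\<close>.\<close>

primrec hit :: "'v set \<Rightarrow> 'v \<Rightarrow> nat \<Rightarrow> 'v \<Rightarrow> real" where
  "hit \<Lambda> x 0 y = (if y = x then 1 else 0)"
| "hit \<Lambda> x (Suc k) y = (if y = x then 1 else if y \<in> \<Lambda> then (\<Sum>z\<in>N y. hit \<Lambda> x k z) / card (N y) else 0)"

lemma average_le:
  assumes "\<And>z. f z \<le> (c :: real)" "0 \<le> c"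
  shows "(\<Sum>z\<in>N y. f z) / card (N y) \<le> c"
proof (cases "card (N y) = 0")
  case False
  have "(\<Sum>z\<in>N y. f z) \<le> real (card (N y)) * c" using assms by (intro sum_bounded_above) auto
  then show ?thesis using False by (simp add: divide_le_eq mult.commute)
qed (use assms in simp)

lemma hit_bounds: "0 \<le> hit \<Lambda> x k y" "hit \<Lambda> x k y \<le> 1"
proof -
  show "0 \<le> hit \<Lambda> x k y" by (induction k arbitrary: y) (auto intro!: divide_nonneg_nonneg sum_nonneg)
  show "hit \<Lambda> x k y \<le> 1"
    by (induction k arbitrary: y) (auto simp del: of_nat_0_less_iff intro!: average_le)
qed

text \<open>One step of the killed walk is a monotone operator, so the inequality between times 0
  and 1 propagates.\<close>

lemma hit_Suc_mono: "hit \<Lambda> x k y \<le> hit \<Lambda> x (Suc k) y"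
proof (induction k arbitrary: y)
  case 0
  then show ?case using hit_bounds(1)[of \<Lambda> x "Suc 0" y] by (simp split: if_splits)
next
  case (Suc k)
  define A where "A f = (if y = x then 1 else if y \<in> \<Lambda> then (\<Sum>z\<in>N y. f z) / card (N y) else 0 :: real)" for f
  have A: "hit \<Lambda> x (Suc k) y = A (hit \<Lambda> x k)" for k by (simp add: A_def)
  show ?case unfolding A[of k] A[of "Suc k"]
    unfolding A_def using Suc.IH by (auto simp del: hit.simps intro!: divide_right_mono sum_mono)
qed

text \<open>Killing can only prevent visits to \<open>x\<close>. This carries information on the
  full walk over to \<open>\<Lambda>\<close>.\<close>

lemma avoidance_le_hit:
  assumes "\<Lambda> \<subseteq> V" "x \<in> \<Lambda>"
  shows "avoidance E x k y \<le> ennreal (1 - hit \<Lambda> x k y)"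
proof (induction k arbitrary: y)
  case (Suc k)
  show ?case
  proof (cases "y \<noteq> x \<and> y \<in> \<Lambda>")
    case True
    then have y: "y \<in> V" using assms by auto
    have "avoidance E x (Suc k) y = (\<integral>\<^sup>+z. avoidance E x k z \<partial>pmf_of_set (N y))" using True by simp
    also have "\<dots> \<le> (\<integral>\<^sup>+z. ennreal (1 - hit \<Lambda> x k z) \<partial>pmf_of_set (N y))" by (intro nn_integral_mono Suc.IH)
    also have "\<dots> = ennreal ((\<Sum>z\<in>N y. 1 - hit \<Lambda> x k z) / card (N y))"
      using finite_N N_nonempty hit_bounds y by (intro nn_integral_pmf_of_set_real) auto
    also have "(\<Sum>z\<in>N y. 1 - hit \<Lambda> x k z) / card (N y) = 1 - hit \<Lambda> x (Suc k) y"
      using True card_N_pos[OF y] by (simp add: sum_subtractf diff_divide_distrib)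
    finally show ?thesis .
  next
    case False
    then show ?thesis using avoidance_le_1[of E x "Suc k" y] by auto
  qed
qed simp

text \<open>The return probability of the killed walk, decomposed at its first step. The bound
  involves neither \<open>\<Lambda>\<close> nor \<open>k\<close>: this is the place where transience
  becomes a volume-independent estimate.\<close>

lemma hit_average_le:
  assumes "\<Lambda> \<subseteq> V" "x \<in> \<Lambda>"
  shows "(\<Sum>z\<in>N x. hit \<Lambda> x k z) / card (N x) \<le> 1 - escape x"
proof -
  have x: "x \<in> V" using assms by auto
  have "ennreal (escape x) \<le> (\<integral>\<^sup>+z. avoidance E x k z \<partial>pmf_of_set (N x))"
    unfolding escape_def by (rule srw_no_return_ge)
  also have "\<dots> \<le> (\<integral>\<^sup>+z. ennreal (1 - hit \<Lambda> x k z) \<partial>pmf_of_set (N x))"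
    by (intro nn_integral_mono avoidance_le_hit assms)
  also have "\<dots> = ennreal ((\<Sum>z\<in>N x. 1 - hit \<Lambda> x k z) / card (N x))"
    using finite_N N_nonempty hit_bounds x by (intro nn_integral_pmf_of_set_real) auto
  also have "(\<Sum>z\<in>N x. 1 - hit \<Lambda> x k z) / card (N x) = 1 - (\<Sum>z\<in>N x. hit \<Lambda> x k z) / card (N x)"
    using card_N_pos[OF x] by (simp add: sum_subtractf diff_divide_distrib)
  finally show ?thesis
    using average_le[of "hit \<Lambda> x k" 1 x] hit_bounds by (subst (asm) ennreal_le_iff) auto
qed

text \<open>The limit \<open>v\<close> of \<open>hit\<close> is the probability of reaching
  \<open>x\<close> before leaving \<open>\<Lambda>\<close>: it is harmonic on
  \<open>\<Lambda>\<close> off \<open>x\<close>, equals 1 at \<open>x\<close> and vanishes outside.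
  Monotonicity in \<open>k\<close> gives its existence directly, and rescaling yields
  \<open>g\<close>.\<close>

lemma green_function:
  assumes \<Lambda>: "\<Lambda> \<subseteq> V" "x \<in> \<Lambda>"
  obtains g where "\<And>y. y \<notin> \<Lambda> \<Longrightarrow> g y = 0"
    and "\<And>y. y \<in> \<Lambda> \<Longrightarrow> (\<Sum>z\<in>N y. g y - g z) = (if y = x then 1 else 0)"
    and "g x \<le> 1 / (card (N x) * escape x)"
proof -
  have x: "x \<in> V" using \<Lambda> by auto
  define v where "v y = lim (\<lambda>k. hit \<Lambda> x k y)" for y
  have lim: "(\<lambda>k. hit \<Lambda> x k y) \<longlonglongrightarrow> v y" for y
  proof -
    have "convergent (\<lambda>k. hit \<Lambda> x k y)"
    proof (rule Bseq_mono_convergent)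
      show "Bseq (\<lambda>k. hit \<Lambda> x k y)"
        using hit_bounds[of \<Lambda> x _ y] by (intro BseqI'[where K=1]) simp
      show "\<forall>m n. m \<le> n \<longrightarrow> hit \<Lambda> x m y \<le> hit \<Lambda> x n y"
        using lift_Suc_mono_le[of "\<lambda>k. hit \<Lambda> x k y", OF hit_Suc_mono] by blast
    qed
    then show ?thesis by (simp add: v_def convergent_LIMSEQ_iff)
  qed
  define avg where "avg y = (\<Sum>z\<in>N y. v z) / card (N y)" for y
  have lim_avg: "(\<lambda>k. (\<Sum>z\<in>N y. hit \<Lambda> x k z) / card (N y)) \<longlonglongrightarrow> avg y" for y
    unfolding avg_def divide_inverse by (intro tendsto_mult tendsto_sum lim tendsto_const)
  have vx: "v x = 1"
  proof -
    have "hit \<Lambda> x k x = 1" for k by (cases k) auto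
    then show ?thesis using LIMSEQ_unique[OF lim[of x]] by auto
  qed
  have v_out: "v y = 0" if "y \<notin> \<Lambda>" for y
  proof -
    have "hit \<Lambda> x k y = 0" for k using that \<Lambda> by (cases k) auto
    then show ?thesis using LIMSEQ_unique[OF lim[of y]] by auto
  qed
  have v_in: "v y = avg y" if "y \<in> \<Lambda>" "y \<noteq> x" for y
  proof -
    have "(\<lambda>k. hit \<Lambda> x (Suc k) y) \<longlonglongrightarrow> avg y" using lim_avg[of y] that by simp
    then show ?thesis using LIMSEQ_Suc[OF lim[of y]] LIMSEQ_unique by blast
  qed
  have avgx: "escape x \<le> 1 - avg x"
    using LIMSEQ_le_const2[OF lim_avg[of x], of "1 - escape x"] hit_average_le[OF \<Lambda>] by auto
  \<comment> \<open>The Laplacian of \<open>v\<close> at \<open>x\<close>; dividing by it makes the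
    source at \<open>x\<close> equal to 1, so that \<open>g x = 1 / c\<close>.\<close>
  define c where "c = card (N x) * (1 - avg x)"
  have c: "card (N x) * escape x \<le> c" "0 < c"
    using avgx escape_pos[OF x] card_N_pos[OF x] by (auto simp: c_def)
  have lap: "(\<Sum>z\<in>N y. v y - v z) = card (N y) * (v y - avg y)" if "y \<in> V" for y
    using card_N_pos[OF that] by (simp add: sum_subtractf avg_def field_simps)
  show ?thesis
  proof (rule that[of "\<lambda>y. v y / c"])
    show "v y / c = 0" if "y \<notin> \<Lambda>" for y using v_out[OF that] by simp
    show "(\<Sum>z\<in>N y. v y / c - v z / c) = (if y = x then 1 else 0)" if "y \<in> \<Lambda>" for y
      using lap[of y] that \<Lambda> v_in[of y] c vx card_N_pos[OF x]
      by (auto simp: diff_divide_distrib[symmetric] sum_divide_distrib[symmetric] c_def)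
    show "v x / c \<le> 1 / (card (N x) * escape x)"
      using c vx escape_pos[OF x] card_N_pos[OF x] by (auto intro!: divide_left_mono)
  qed
qed

lemma edge_doubleton: "e \<in> E \<Longrightarrow> \<exists>x y. e = {x, y}"
  using simple unfolding simple_graph_def by (metis card_2_iff)

lemma finite_edges_touching: assumes "finite \<Lambda>" "\<Lambda> \<subseteq> V" shows "finite (edges_touching E \<Lambda>)"
proof (rule finite_subset)
  show "edges_touching E \<Lambda> \<subseteq> (\<Union>x\<in>\<Lambda>. (\<lambda>z. {x, z}) ` N x)"
  proof
    fix e assume "e \<in> edges_touching E \<Lambda>"
    then obtain x where "e \<in> E" "x \<in> e" "x \<in> \<Lambda>" by (auto simp: edges_touching_def)
    moreover obtain z where "e = {x, z}" using edge_doubleton[OF \<open>e \<in> E\<close>] \<open>x \<in> e\<close> by auto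
    ultimately show "e \<in> (\<Union>x\<in>\<Lambda>. (\<lambda>z. {x, z}) ` N x)" by (auto simp: neighbours_def)
  qed
  show "finite (\<Union>x\<in>\<Lambda>. (\<lambda>z. {x, z}) ` N x)" using assms finite_N by auto
qed

lemma orientation: obtains a b where "\<And>e. e \<in> E \<Longrightarrow> e = {a e, b e}"
  using edge_doubleton by metis

text \<open>Green's identity, by counting incident pairs of a vertex of \<open>\<Lambda>\<close> and
  an edge in two ways. Endpoints outside \<open>\<Lambda>\<close> may be added freely because
  \<open>h\<close> vanishes there.\<close>

lemma summation_by_parts:
  fixes g h :: "'v \<Rightarrow> real"
  assumes \<Lambda>: "finite \<Lambda>" "\<Lambda> \<subseteq> V" and h: "\<And>y. y \<notin> \<Lambda> \<Longrightarrow> h y = 0"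
    and ab: "\<And>e. e \<in> E \<Longrightarrow> e = {a e, b e}"
  shows "(\<Sum>e\<in>edges_touching E \<Lambda>. (g (b e) - g (a e)) * (h (b e) - h (a e))) = (\<Sum>y\<in>\<Lambda>. h y * (\<Sum>z\<in>N y. g y - g z))"
proof -
  let ?T = "edges_touching E \<Lambda>"
  have T: "finite ?T" using \<Lambda> by (rule finite_edges_touching)
  \<comment> \<open>For an edge from \<open>y\<close> to \<open>z\<close> the bracket equals
    \<open>g y - g z\<close>; in this form it mentions neither the other endpoint nor the
    orientation.\<close>
  define \<psi> where "\<psi> y e = h y * (2 * g y - (g (a e) + g (b e)))" for y e
  have ab_ne: "a e \<noteq> b e" if "e \<in> E" for e
    using edge_endpoints[of "a e" "b e"] ab[OF that] that by auto
  have "h y * (\<Sum>z\<in>N y. g y - g z) = (\<Sum>e\<in>{e\<in>?T. y \<in> e}. \<psi> y e)" if y: "y \<in> \<Lambda>" for y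
  proof -
    have bij: "bij_betw (\<lambda>z. {y, z}) (N y) {e\<in>?T. y \<in> e}"
    proof (rule bij_betwI')
      show "({y, z} = {y, z'}) = (z = z')" for z z' by (auto simp: doubleton_eq_iff)
      show "{y, z} \<in> {e\<in>?T. y \<in> e}" if "z \<in> N y" for z
        using that y by (auto simp: neighbours_def edges_touching_def)
      show "\<exists>z\<in>N y. e = {y, z}" if "e \<in> {e\<in>?T. y \<in> e}" for e
      proof -
        have "e \<in> E" "y \<in> e" using that by (auto simp: edges_touching_def)
        then obtain z where "e = {y, z}" using edge_doubleton[of e] by auto
        then show ?thesis using that by (auto simp: neighbours_def edges_touching_def)
      qed
    qed
    have "\<psi> y {y, z} = h y * (g y - g z)" if "z \<in> N y" for z
    proof -
      have E: "{y, z} \<in> E" using that by (simp add: neighbours_def)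
      have "g (a {y, z}) + g (b {y, z}) = g y + g z"
        using ab[OF E] by (auto simp: doubleton_eq_iff)
      then show ?thesis by (simp add: \<psi>_def)
    qed
    then have "h y * (\<Sum>z\<in>N y. g y - g z) = (\<Sum>z\<in>N y. \<psi> y {y, z})"
      by (simp add: sum_distrib_left)
    also have "\<dots> = (\<Sum>e\<in>{e\<in>?T. y \<in> e}. \<psi> y e)"
      by (rule sum.reindex_bij_betw[OF bij])
    finally show ?thesis .
  qed
  then have "(\<Sum>y\<in>\<Lambda>. h y * (\<Sum>z\<in>N y. g y - g z)) = (\<Sum>y\<in>\<Lambda>. \<Sum>e\<in>{e\<in>?T. y \<in> e}. \<psi> y e)"
    by simp
  also have "\<dots> = (\<Sum>e\<in>?T. \<Sum>y\<in>{y\<in>\<Lambda>. y \<in> e}. \<psi> y e)"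
    using \<Lambda> T by (intro sum.swap_restrict)
  also have "\<dots> = (\<Sum>e\<in>?T. (g (b e) - g (a e)) * (h (b e) - h (a e)))"
  proof (rule sum.cong[OF refl])
    fix e assume "e \<in> ?T"
    then have e: "e \<in> E" by (simp add: edges_touching_def)
    have "(\<Sum>y\<in>{y\<in>\<Lambda>. y \<in> e}. \<psi> y e) = (\<Sum>y\<in>{a e, b e}. \<psi> y e)"
    proof (rule sum.mono_neutral_left)
      show "{y\<in>\<Lambda>. y \<in> e} \<subseteq> {a e, b e}" using ab[OF e] by blast
      show "\<forall>y\<in>{a e, b e} - {y\<in>\<Lambda>. y \<in> e}. \<psi> y e = 0" using ab[OF e] h unfolding \<psi>_def by auto
    qed simp
    also have "\<dots> = (g (b e) - g (a e)) * (h (b e) - h (a e))"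
      using ab_ne[OF e] by (simp add: \<psi>_def algebra_simps)
    finally show "(\<Sum>y\<in>{y\<in>\<Lambda>. y \<in> e}. \<psi> y e) = (g (b e) - g (a e)) * (h (b e) - h (a e))" .
  qed
  finally show ?thesis ..
qed

text \<open>The gradient of the Green function is a unit flow from \<open>x\<close> to the complement of \<open>\<Lambda>\<close>.\<close>

lemma unit_flow:
  assumes \<Lambda>: "finite \<Lambda>" "\<Lambda> \<subseteq> V" "x \<in> \<Lambda>" and ab: "\<And>e. e \<in> E \<Longrightarrow> e = {a e, b e}"
  obtains t where "(\<Sum>e\<in>edges_touching E \<Lambda>. (t e)\<^sup>2) \<le> 1 / (card (N x) * escape x)"
    and "\<And>h :: 'v \<Rightarrow> real. (\<And>y. y \<notin> \<Lambda> \<Longrightarrow> h y = 0) \<Longrightarrow>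
      (\<Sum>e\<in>edges_touching E \<Lambda>. t e * (h (b e) - h (a e))) = h x"
proof -
  obtain g where g: "\<And>y. y \<notin> \<Lambda> \<Longrightarrow> g y = 0"
    "\<And>y. y \<in> \<Lambda> \<Longrightarrow> (\<Sum>z\<in>N y. g y - g z) = (if y = x then 1 else 0)"
    "g x \<le> 1 / (card (N x) * escape x)"
    using green_function[OF \<Lambda>(2,3)] by metis
  have flow: "(\<Sum>e\<in>edges_touching E \<Lambda>. (g (b e) - g (a e)) * (h (b e) - h (a e))) = h x"
    if "\<And>y. y \<notin> \<Lambda> \<Longrightarrow> h y = 0" for h
  proof -
    have "(\<Sum>e\<in>edges_touching E \<Lambda>. (g (b e) - g (a e)) * (h (b e) - h (a e))) = (\<Sum>y\<in>\<Lambda>. h y * (\<Sum>z\<in>N y. g y - g z))"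
      by (rule summation_by_parts[OF \<Lambda>(1,2) that ab])
    also have "\<dots> = (\<Sum>y\<in>\<Lambda>. if y = x then h x else 0)" using g(2) by (intro sum.cong) auto
    finally show ?thesis using \<Lambda> by simp
  qed
  show ?thesis
  proof (rule that[of "\<lambda>e. g (b e) - g (a e)"])
    \<comment> \<open>The flow identity tested on \<open>g\<close> itself: the energy is the
      potential \<open>g x\<close> at the source.\<close>
    show "(\<Sum>e\<in>edges_touching E \<Lambda>. (g (b e) - g (a e))\<^sup>2) \<le> 1 / (card (N x) * escape x)"
      using flow[of g] g by (simp add: power2_eq_square)
  qed (rule flow)
qed

end

section \<open>Finite volume measures\<close>

lemma nn_integral_count_space_le:
  assumes nonneg: "\<And>x. x \<in> X \<Longrightarrow> 0 \<le> f x"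
    and le: "\<And>H. finite H \<Longrightarrow> H \<subseteq> X \<Longrightarrow> (\<Sum>x\<in>H. f x) \<le> (B :: real)"
  shows "(\<integral>\<^sup>+x. ennreal (f x) \<partial>count_space X) \<le> ennreal B"
proof -
  have s: "f summable_on X"
    using nonneg le by (intro nonneg_bdd_above_summable_on) (auto simp: bdd_above_def)
  then have abs: "Infinite_Set_Sum.abs_summable_on f X"
    using nonneg by (auto simp flip: abs_summable_equivalent cong: summable_on_cong)
  have "(\<integral>\<^sup>+x. ennreal (f x) \<partial>count_space X) = ennreal (infsum f X)"
    using nn_integral_conv_infsetsum[OF abs] nonneg infsetsum_infsum[OF abs] by simp
  also have "infsum f X \<le> B" using s le by (intro infsum_le_finite_sums)
  finally show ?thesis by (simp add: ennreal_leI)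
qed

lemma boltzmann_nonneg: "0 \<le> boltzmann t"
  by (simp add: boltzmann_def)

lemma boltzmann_add: "x \<noteq> -\<infinity> \<Longrightarrow> y \<noteq> -\<infinity> \<Longrightarrow> boltzmann (x + y) = boltzmann x * boltzmann y"
  by (cases x; cases y) (auto simp: boltzmann_def mult_exp_exp)

lemma boltzmann_sum:
  assumes "finite A" "\<And>a. a \<in> A \<Longrightarrow> f a \<noteq> -\<infinity>"
  shows "boltzmann (\<Sum>a\<in>A. f a) = (\<Prod>a\<in>A. boltzmann (f a))"
proof -
  \<comment> \<open>The induction also carries that the partial sum is not minus infinity, a
    hypothesis of \<open>boltzmann_add\<close>.\<close>
  have "boltzmann (\<Sum>a\<in>A. f a) = (\<Prod>a\<in>A. boltzmann (f a)) \<and> (\<Sum>a\<in>A. f a) \<noteq> -\<infinity>"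
    using assms by (induction A) (auto simp: boltzmann_add, simp add: boltzmann_def)
  then show ?thesis ..
qed

section \<open>The potential as a law of increments\<close>

context
  fixes U :: "int \<Rightarrow> ereal"
  assumes potential: "height_function_potential U"
begin

definition total_weight :: real where
  "total_weight = (\<Sum>\<^sub>\<infinity>n. boltzmann (U n))"

definition increment_pmf :: "int pmf" where
  "increment_pmf = embed_pmf (\<lambda>n. boltzmann (U n) / total_weight)"

lemma boltzmann_minus: "boltzmann (U (- n)) = boltzmann (U n)"
  using potential unfolding height_function_potential_def by metis

lemma summable_second_moment: "(\<lambda>n. (of_int n)\<^sup>2 * boltzmann (U n)) summable_on UNIV"
  using potential unfolding height_function_potential_def by blast

lemma summable_boltzmann: "(\<lambda>n. boltzmann (U n)) summable_on UNIV"
proof -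
  have "(\<lambda>n. boltzmann (U n)) summable_on (UNIV - {0})"
  proof (rule summable_on_comparison_test)
    show "(\<lambda>n. (of_int n)\<^sup>2 * boltzmann (U n)) summable_on (UNIV - {0})"
      by (rule summable_on_subset_banach[OF summable_second_moment]) auto
    show "boltzmann (U n) \<le> (of_int n)\<^sup>2 * boltzmann (U n)" if "n \<in> UNIV - {0}" for n
    proof -
      have "1 \<le> n\<^sup>2" using that by (simp add: int_one_le_iff_zero_less)
      then have "(1::real) \<le> (of_int n)\<^sup>2" by (metis of_int_1_le_iff of_int_power)
      then show ?thesis using mult_right_mono[of 1 "(of_int n)\<^sup>2 :: real" "boltzmann (U n)"] boltzmann_nonneg by simp
    qed
  qed (simp add: boltzmann_nonneg)
  then show ?thesis by (subst (asm) summable_on_insert_iff[symmetric, of _ _ 0]) (simp add: insert_UNIV)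
qed

lemma cosine_series_split:
  "(\<Sum>\<^sub>\<infinity>n. boltzmann (U n) * cos (of_int n * a)) =
    boltzmann (U 0) + (\<Sum>\<^sub>\<infinity>n\<in>{1..}. 2 * boltzmann (U n) * cos (of_int n * a))"
proof -
  let ?f = "\<lambda>n. boltzmann (U n) * cos (of_int n * a)"
  have s: "?f summable_on A" for A
  proof -
    have "?f summable_on UNIV"
    proof (rule iffD2[OF summable_on_iff_abs_summable_on_real], rule summable_on_comparison_test)
      show "(\<lambda>n. boltzmann (U n)) summable_on UNIV" by (rule summable_boltzmann)
      show "norm (?f n) \<le> boltzmann (U n)" for n
        using boltzmann_nonneg[of "U n"] by (simp add: abs_mult mult_left_le)
    qed simp
    then show ?thesis by (rule summable_on_subset_banach) auto
  qed
  have U: "(UNIV :: int set) = {..-1} \<union> ({0} \<union> {1..})" by auto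
  have neg: "infsum ?f {..-1} = infsum ?f {1..}"
  proof -
    have "bij_betw uminus {1..} {..-1::int}" by (rule bij_betwI[where g=uminus]) auto
    from infsum_reindex_bij_betw[OF this, of ?f]
    show ?thesis by (simp add: boltzmann_minus)
  qed
  have "infsum ?f UNIV = infsum ?f {..-1} + (infsum ?f {0} + infsum ?f {1..})"
    unfolding U by (subst infsum_Un_disjoint, (auto intro: s)[3], subst infsum_Un_disjoint) (auto intro: s)
  also have "\<dots> = boltzmann (U 0) + 2 * infsum ?f {1..}" unfolding neg by simp
  also have "2 * infsum ?f {1..} = (\<Sum>\<^sub>\<infinity>n\<in>{1..}. 2 * boltzmann (U n) * cos (of_int n * a))"
    by (simp add: infsum_cmult_right'[symmetric] mult.assoc)
  finally show ?thesis .
qed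

lemma cosine_series_pos: "0 < (\<Sum>\<^sub>\<infinity>n. boltzmann (U n) * cos (of_int n * a))"
  unfolding cosine_series_split using potential unfolding height_function_potential_def by blast

text \<open>At \<open>a = 0\<close> the positive cosine series is the total weight itself.\<close>

lemma total_weight_pos: "0 < total_weight"
  using cosine_series_pos[of 0] by (simp add: total_weight_def)

lemma pmf_increment: "pmf increment_pmf n = boltzmann (U n) / total_weight"
  unfolding increment_pmf_def
proof (rule pmf_embed_pmf)
  show "0 \<le> boltzmann (U n) / total_weight" for n
    using total_weight_pos boltzmann_nonneg by simp
  let ?f = "\<lambda>n. boltzmann (U n) / total_weight"
  have "?f summable_on UNIV" unfolding divide_inverse using summable_boltzmann by (rule summable_on_cmult_left)
  then have abs: "Infinite_Set_Sum.abs_summable_on ?f UNIV"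
    using total_weight_pos by (auto simp: boltzmann_nonneg simp flip: abs_summable_equivalent)
  have "(\<integral>\<^sup>+n. ennreal (?f n) \<partial>count_space UNIV) = ennreal (infsum ?f UNIV)"
    using nn_integral_conv_infsetsum[OF abs] infsetsum_infsum[OF abs] total_weight_pos boltzmann_nonneg by simp
  also have "infsum ?f UNIV = 1"
    using total_weight_pos by (simp add: divide_inverse infsum_cmult_left' total_weight_def)
  finally show "(\<integral>\<^sup>+n. ennreal (?f n) \<partial>count_space UNIV) = 1" by simp
qed

lemma positive_definite_increment: "positive_definite_pmf increment_pmf"
proof
  show "pmf increment_pmf (- n) = pmf increment_pmf n" for n
    by (simp add: pmf_increment boltzmann_minus)
  have "(\<lambda>n. pmf increment_pmf n * (of_int n)\<^sup>2) summable_on UNIV"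
    using summable_on_cmult_left[OF summable_second_moment, of "inverse total_weight"]
    by (simp add: pmf_increment divide_inverse mult_ac)
  then have "Infinite_Set_Sum.abs_summable_on (\<lambda>n. pmf increment_pmf n * (of_int n)\<^sup>2) UNIV"
    by (auto simp flip: abs_summable_equivalent)
  then show "integrable (measure_pmf increment_pmf) (\<lambda>n. (of_int n)\<^sup>2 :: real)"
    unfolding measure_pmf_eq_density by (subst integrable_density) (auto simp: abs_summable_on_def)
  show "0 < measure_pmf.expectation increment_pmf (\<lambda>n. cos (of_int n * a))" for a :: real
  proof -
    have "(\<lambda>n. pmf increment_pmf n) summable_on UNIV"
      unfolding pmf_increment divide_inverse using summable_boltzmann by (rule summable_on_cmult_left)
    then have "(\<lambda>n. norm (pmf increment_pmf n * cos (of_int n * a))) summable_on UNIV"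
      by (rule summable_on_comparison_test) (auto simp: abs_mult mult_left_le)
    then have abs: "Infinite_Set_Sum.abs_summable_on (\<lambda>n. pmf increment_pmf n * cos (of_int n * a)) UNIV"
      by (simp flip: abs_summable_equivalent)
    have "measure_pmf.expectation increment_pmf (\<lambda>n. cos (of_int n * a)) = (\<Sum>\<^sub>\<infinity>n. boltzmann (U n) * cos (of_int n * a) / total_weight)"
      using infsetsum_infsum[OF abs] by (simp add: pmf_expectation_eq_infsetsum pmf_increment)
    also have "\<dots> = (\<Sum>\<^sub>\<infinity>n. boltzmann (U n) * cos (of_int n * a)) / total_weight"
      by (simp add: divide_inverse infsum_cmult_left')
    finally show ?thesis using cosine_series_pos total_weight_pos by simp
  qed
qed

end

section \<open>From sums over differences to sums over configurations\<close>

definition height_box :: "'v set \<Rightarrow> nat \<Rightarrow> ('v \<Rightarrow> int) set" where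
  "height_box \<Lambda> n = (\<Lambda> \<rightarrow>\<^sub>E {- int n..int n})"

lemma finite_height_box: "finite \<Lambda> \<Longrightarrow> finite (height_box \<Lambda> n)"
  by (simp add: height_box_def finite_PiE)

lemma card_height_box: "finite \<Lambda> \<Longrightarrow> card (height_box \<Lambda> n) = (2 * n + 1) ^ card \<Lambda>"
  by (simp add: height_box_def card_PiE nat_add_distrib nat_mult_distrib)

text \<open>Boxes are Foelner sets for \<open>\<int>\<^sup>\<Lambda>\<close>, so that sums over differences recover sums over configurations.\<close>

lemma sum_le_of_box_average:
  fixes F :: "('v \<Rightarrow> int) \<Rightarrow> real" and B :: real
  assumes \<Lambda>: "finite \<Lambda>" and F: "\<And>\<eta>. 0 \<le> F \<eta>"
    and avg: "\<And>n. (\<Sum>j\<in>height_box \<Lambda> n. \<Sum>k\<in>height_box \<Lambda> n. F (\<lambda>y\<in>\<Lambda>. j y - k y)) \<le> B * card (height_box \<Lambda> n)"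
    and H: "finite H" "H \<subseteq> \<Lambda> \<rightarrow>\<^sub>E UNIV"
  shows "(\<Sum>\<eta>\<in>H. F \<eta>) \<le> B"
proof -
  have "finite (\<Union>\<eta>\<in>H. (\<lambda>y. nat \<bar>\<eta> y\<bar>) ` \<Lambda>)" using \<Lambda> H by auto
  then obtain m where "\<forall>i\<in>(\<Union>\<eta>\<in>H. (\<lambda>y. nat \<bar>\<eta> y\<bar>) ` \<Lambda>). i \<le> m"
    using finite_nat_set_iff_bounded_le by blast
  then have m: "\<bar>\<eta> y\<bar> \<le> int m" if "\<eta> \<in> H" "y \<in> \<Lambda>" for \<eta> y using that by (auto simp: nat_le_iff)
  let ?d = "card \<Lambda>"
  \<comment> \<open>Adding any \<open>k\<close> from the box of radius \<open>l\<close> moves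
    \<open>H\<close> into the box of radius \<open>m + l\<close>, so each element of
    \<open>H\<close> occurs as a difference \<open>j - k\<close>. Dividing by the number of such
    \<open>k\<close> leaves the ratio of the two box sizes, which tends to 1 as \<open>l\<close>
    grows.\<close>
  have le: "(\<Sum>\<eta>\<in>H. F \<eta>) \<le> B * ((2 * (real m + real l) + 1) / (2 * real l + 1)) ^ ?d" for l
  proof -
    have "(\<Sum>\<eta>\<in>H. F \<eta>) \<le> (\<Sum>j\<in>height_box \<Lambda> (m + l). F (\<lambda>y\<in>\<Lambda>. j y - k y))" if k: "k \<in> height_box \<Lambda> l" for k
    proof -
      define s where "s \<eta> = (\<lambda>y\<in>\<Lambda>. \<eta> y + k y)" for \<eta>
      have undo: "(\<lambda>y\<in>\<Lambda>. s \<eta> y - k y) = \<eta>" if "\<eta> \<in> H" for \<eta>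
        using that H(2) by (auto simp: s_def fun_eq_iff PiE_iff extensional_def)
      have "(\<Sum>\<eta>\<in>H. F \<eta>) = (\<Sum>j\<in>s ` H. F (\<lambda>y\<in>\<Lambda>. j y - k y))"
        by (rule sum.reindex_bij_witness[where i="\<lambda>j. \<lambda>y\<in>\<Lambda>. j y - k y" and j=s])
           (use undo in \<open>auto simp del: restrict_apply\<close>)
      also have "\<dots> \<le> (\<Sum>j\<in>height_box \<Lambda> (m + l). F (\<lambda>y\<in>\<Lambda>. j y - k y))"
      proof (rule sum_mono2)
        show "s ` H \<subseteq> height_box \<Lambda> (m + l)"
        proof
          fix j assume "j \<in> s ` H"
          then obtain \<eta> where \<eta>: "\<eta> \<in> H" "j = s \<eta>" by auto
          have "- int (m + l) \<le> \<eta> y + k y \<and> \<eta> y + k y \<le> int (m + l)" if "y \<in> \<Lambda>" for y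
            using m[OF \<eta>(1) that] k that by (force simp: height_box_def PiE_iff abs_le_iff)
          then show "j \<in> height_box \<Lambda> (m + l)" by (auto simp: height_box_def s_def \<eta>(2))
        qed
      qed (auto intro: finite_height_box \<Lambda> F)
      finally show ?thesis .
    qed
    then have "card (height_box \<Lambda> l) * (\<Sum>\<eta>\<in>H. F \<eta>) \<le> (\<Sum>k\<in>height_box \<Lambda> l. \<Sum>j\<in>height_box \<Lambda> (m + l). F (\<lambda>y\<in>\<Lambda>. j y - k y))"
      by (intro sum_bounded_below)
    also have "\<dots> \<le> (\<Sum>k\<in>height_box \<Lambda> (m + l). \<Sum>j\<in>height_box \<Lambda> (m + l). F (\<lambda>y\<in>\<Lambda>. j y - k y))"
    proof (rule sum_mono2)
      show "height_box \<Lambda> l \<subseteq> height_box \<Lambda> (m + l)"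
        unfolding height_box_def by (rule PiE_mono) auto
    qed (auto intro!: finite_height_box \<Lambda> F sum_nonneg)
    also have "\<dots> \<le> B * card (height_box \<Lambda> (m + l))"
      by (subst sum.swap) (rule avg)
    finally show ?thesis
      unfolding card_height_box[OF \<Lambda>] by (simp add: power_divide field_simps)
  qed
  have "(\<lambda>l. B * ((2 * (real m + real l) + 1) / (2 * real l + 1)) ^ ?d) \<longlonglongrightarrow> B * 1 ^ ?d"
    by (intro tendsto_intros) real_asymp
  then show ?thesis
    using le by (intro LIMSEQ_le_const) auto
qed

definition glue :: "'v set \<Rightarrow> 'v set \<Rightarrow> ('v \<Rightarrow> int) \<Rightarrow> ('v \<Rightarrow> int) \<Rightarrow> 'v \<Rightarrow> int" where
  "glue V \<Lambda> \<phi> \<eta> = (\<lambda>y\<in>V. if y \<in> \<Lambda> then \<eta> y else \<phi> y)"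

lemma bij_glue: "\<Lambda> \<subseteq> V \<Longrightarrow> bij_betw (glue V \<Lambda> \<phi>) (\<Lambda> \<rightarrow>\<^sub>E UNIV) (with_boundary V \<Lambda> \<phi>)"
  by (rule bij_betwI[where g="\<lambda>h. restrict h \<Lambda>"])
     (auto simp: glue_def with_boundary_def fun_eq_iff PiE_iff extensional_def)

lemma restrict_glue: "\<Lambda> \<subseteq> V \<Longrightarrow> \<eta> \<in> \<Lambda> \<rightarrow>\<^sub>E UNIV \<Longrightarrow> restrict (glue V \<Lambda> \<phi> \<eta>) \<Lambda> = \<eta>"
  by (auto simp: glue_def fun_eq_iff PiE_iff extensional_def)

lemma nn_integral_with_boundary:
  "\<Lambda> \<subseteq> V \<Longrightarrow> (\<integral>\<^sup>+h. f h \<partial>count_space (with_boundary V \<Lambda> \<phi>)) = (\<integral>\<^sup>+\<eta>. f (glue V \<Lambda> \<phi> \<eta>) \<partial>count_space (\<Lambda> \<rightarrow>\<^sub>E UNIV))"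
  by (rule nn_integral_bij_count_space[OF bij_glue, symmetric])

section \<open>Finite volume measures with zero boundary values\<close>

locale height_model = transient_graph V E for V :: "'v set" and E +
  fixes U :: "int \<Rightarrow> ereal"
  assumes potential: "height_function_potential U"
begin

abbreviation T :: "'v set \<Rightarrow> 'v set set" where "T \<equiv> edges_touching E"
abbreviation w :: "'v set \<Rightarrow> ('v \<Rightarrow> int) \<Rightarrow> real" where "w \<equiv> gibbs_weight E U"
abbreviation zero_heights :: "'v \<Rightarrow> int" where "zero_heights \<equiv> \<lambda>_. 0"

sublocale increment: positive_definite_pmf "increment_pmf U"
  using potential by (rule positive_definite_increment)

lemma boltzmann_eq: "boltzmann (U n) = total_weight U * pmf (increment_pmf U) n"
  using pmf_increment[OF potential] total_weight_pos[OF potential] by simp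

lemma edge_energy_eq: "{x, y} = e \<Longrightarrow> edge_energy U h e = U (h y - h x)"
  using edge_energy_insert[of U h x y] potential unfolding height_function_potential_def by blast

lemma U_not_minfty: "U n \<noteq> -\<infinity>"
  using potential unfolding height_function_potential_def by blast

lemma edge_energy_not_minfty: "e \<in> E \<Longrightarrow> edge_energy U h e \<noteq> -\<infinity>"
  using edge_doubleton[of e] edge_energy_eq U_not_minfty by metis

lemma weight_prod:
  assumes "finite \<Lambda>" "\<Lambda> \<subseteq> V"
  shows "w \<Lambda> h = (\<Prod>e\<in>T \<Lambda>. boltzmann (edge_energy U h e))"
  unfolding gibbs_weight_def
  by (rule boltzmann_sum[OF finite_edges_touching[OF assms]]) (auto simp: edges_touching_def edge_energy_not_minfty)

lemma weight_nonneg: "0 \<le> w \<Lambda> h"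
  by (simp add: gibbs_weight_def boltzmann_nonneg)

lemma edge_energy_cong:
  assumes "e \<in> E" "\<And>y. y \<in> e \<Longrightarrow> h y = h' y"
  shows "edge_energy U h e = edge_energy U h' e"
proof -
  obtain x y where e: "{x, y} = e" using edge_doubleton[OF assms(1)] by metis
  then have "h x = h' x" "h y = h' y" using assms(2) by auto
  then show ?thesis using edge_energy_eq[OF e] by simp
qed

lemma weight_cong:
  assumes "\<And>e y. e \<in> T \<Lambda> \<Longrightarrow> y \<in> e \<Longrightarrow> h y = h' y"
  shows "w \<Lambda> h = w \<Lambda> h'"
  unfolding gibbs_weight_def using assms
  by (intro arg_cong[where f=boltzmann] sum.cong edge_energy_cong) (auto simp: edges_touching_def)

lemma edge_in_V: "e \<in> E \<Longrightarrow> y \<in> e \<Longrightarrow> y \<in> V"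
  using simple by (auto simp: simple_graph_def)

lemma weight_increments:
  assumes "finite \<Lambda>" "\<Lambda> \<subseteq> V" and ab: "\<And>e. e \<in> E \<Longrightarrow> e = {a e, b e}"
  shows "w \<Lambda> h = total_weight U ^ card (T \<Lambda>) * (\<Prod>e\<in>T \<Lambda>. pmf (increment_pmf U) (h (b e) - h (a e)))"
proof -
  have "w \<Lambda> h = (\<Prod>e\<in>T \<Lambda>. total_weight U * pmf (increment_pmf U) (h (b e) - h (a e)))"
    unfolding weight_prod[OF assms(1,2)]
  proof (rule prod.cong[OF refl])
    fix e assume "e \<in> T \<Lambda>"
    then have "{a e, b e} = e" using ab by (auto simp: edges_touching_def)
    from edge_energy_eq[OF this] show "boltzmann (edge_energy U h e) = total_weight U * pmf (increment_pmf U) (h (b e) - h (a e))"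
      by (simp add: boltzmann_eq)
  qed
  then show ?thesis by (simp add: prod.distrib)
qed

text \<open>An infinite graph has a vertex outside the finite set \<open>\<Lambda>\<close>, where
  \<open>u\<close> is 0; follow a path back from it. A path vertex inside \<open>\<Lambda>\<close>
  leaves along an edge touching \<open>\<Lambda>\<close>, and one outside already has value 0. This
  gives the injectivity hypothesis of \<open>pairing_le_card\<close>.\<close>

lemma constant_gradient_zero:
  fixes u :: "'v \<Rightarrow> int"
  assumes \<Lambda>: "finite \<Lambda>" and out: "\<And>y. y \<notin> \<Lambda> \<Longrightarrow> u y = 0" and ab: "\<And>e. e \<in> E \<Longrightarrow> e = {a e, b e}"
    and grad: "\<And>e. e \<in> T \<Lambda> \<Longrightarrow> u (b e) = u (a e)" and y: "y \<in> V"
  shows "u y = 0"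
proof -
  obtain z where z: "z \<in> V" "z \<notin> \<Lambda>" using inf \<Lambda> by (metis finite_subset subsetI)
  have "(y, z) \<in> {(u, v). {u, v} \<in> E}\<^sup>*" using conn y z by (auto simp: connected_graph_def)
  then show ?thesis
  proof (induction rule: converse_rtrancl_induct)
    case base
    then show ?case using out z by simp
  next
    case (step y' z')
    show ?case
    proof (cases "y' \<in> \<Lambda>")
      case True
      then have e: "{y', z'} \<in> T \<Lambda>" "{y', z'} \<in> E" using step.hyps by (auto simp: edges_touching_def)
      have "u y' = u z'" using grad[OF e(1)] ab[OF e(2)] by (auto simp: doubleton_eq_iff)
      then show ?thesis using step.IH by simp
    qed (rule out)
  qed
qed

text \<open>Zero boundary values are preserved under subtraction, so the weight of
  \<open>j - k\<close> is a product of \<open>pmf (increment_pmf U) (D j e - D k e)\<close> times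
  one \<open>total_weight U\<close> per edge. Then \<open>pairing_le_card\<close> bounds the box
  averages.\<close>

lemma finite_volume_sum_le:
  assumes \<Lambda>: "finite \<Lambda>" "\<Lambda> \<subseteq> V" and H: "finite H" "H \<subseteq> \<Lambda> \<rightarrow>\<^sub>E UNIV"
  shows "(\<Sum>\<eta>\<in>H. w \<Lambda> (glue V \<Lambda> zero_heights \<eta>)) \<le> total_weight U ^ card (T \<Lambda>)"
proof -
  obtain a b where ab: "\<And>e. e \<in> E \<Longrightarrow> e = {a e, b e}" using orientation by metis
  have abV: "a e \<in> V" "b e \<in> V" if "e \<in> T \<Lambda>" for e
    using edge_in_V[of e] ab[of e] that by (auto simp: edges_touching_def)
  define g where "g \<eta> y = (if y \<in> \<Lambda> then \<eta> y else 0 :: int)" for \<eta> y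
  define D where "D \<eta> e = g \<eta> (b e) - g \<eta> (a e)" for \<eta> e
  let ?c = "total_weight U ^ card (T \<Lambda>)"
  have c: "0 < ?c" using total_weight_pos[OF potential] by simp
  have wD: "w \<Lambda> (glue V \<Lambda> zero_heights (\<lambda>y\<in>\<Lambda>. j y - k y)) = ?c * (\<Prod>e\<in>T \<Lambda>. pmf (increment_pmf U) (D j e - D k e))" for j k
    proof -
      have w: "w \<Lambda> h = ?c * (\<Prod>e\<in>T \<Lambda>. pmf (increment_pmf U) (h (b e) - h (a e)))" for h
        by (rule weight_increments[OF \<Lambda> ab])
      show ?thesis
        unfolding w by (rule arg_cong[where f="(*) ?c"], rule prod.cong[OF refl]) (use abV in \<open>auto simp: glue_def D_def g_def algebra_simps\<close>)
    qed
  show ?thesis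
  proof (rule sum_le_of_box_average[where F="\<lambda>\<eta>. w \<Lambda> (glue V \<Lambda> zero_heights \<eta>)", OF \<Lambda>(1) _ _ H])
    fix n
    have "(\<Sum>j\<in>height_box \<Lambda> n. \<Sum>k\<in>height_box \<Lambda> n. \<Prod>e\<in>T \<Lambda>. pmf (increment_pmf U) (D j e - D k e)) \<le> card (height_box \<Lambda> n)"
    proof (rule increment.pairing_le_card)
      fix j k assume jk: "j \<in> height_box \<Lambda> n" "k \<in> height_box \<Lambda> n" and eq: "\<forall>e\<in>T \<Lambda>. D j e = D k e"
      have "g j y - g k y = 0" if "y \<in> V" for y
        by (rule constant_gradient_zero[OF \<Lambda>(1) _ ab _ that]) (use eq in \<open>auto simp: g_def D_def algebra_simps\<close>)
      then have "j y = k y" if "y \<in> \<Lambda>" for y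
        using \<Lambda>(2) that by (force simp: g_def)
      then show "j = k" using jk unfolding height_box_def by (intro PiE_ext) auto
    qed (rule finite_edges_touching[OF \<Lambda>], rule finite_height_box[OF \<Lambda>(1)])
    then have "?c * (\<Sum>j\<in>height_box \<Lambda> n. \<Sum>k\<in>height_box \<Lambda> n. \<Prod>e\<in>T \<Lambda>. pmf (increment_pmf U) (D j e - D k e)) \<le> ?c * card (height_box \<Lambda> n)"
      using c by (intro mult_left_mono) auto
    then show "(\<Sum>j\<in>height_box \<Lambda> n. \<Sum>k\<in>height_box \<Lambda> n. w \<Lambda> (glue V \<Lambda> zero_heights (\<lambda>y\<in>\<Lambda>. j y - k y))) \<le> ?c * card (height_box \<Lambda> n)"
      unfolding wD by (simp add: sum_distrib_left)
  qed (rule weight_nonneg)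
qed

text \<open>The constant \<open>K\<close> is chosen before \<open>\<Lambda>\<close> and
  \<open>x\<close>. \<open>Z\<close> stands for any common bound of the partial sums of the weights;
  taking for it the partition function itself turns the estimate into a variance bound.\<close>

lemma finite_volume_second_moment:
  obtains K where "0 < K" and "\<And>\<Lambda> x H Z. finite \<Lambda> \<Longrightarrow> \<Lambda> \<subseteq> V \<Longrightarrow> x \<in> \<Lambda> \<Longrightarrow> finite H \<Longrightarrow> H \<subseteq> \<Lambda> \<rightarrow>\<^sub>E UNIV \<Longrightarrow>
    (\<And>H. finite H \<Longrightarrow> H \<subseteq> \<Lambda> \<rightarrow>\<^sub>E UNIV \<Longrightarrow> (\<Sum>\<eta>\<in>H. w \<Lambda> (glue V \<Lambda> zero_heights \<eta>)) \<le> Z) \<Longrightarrow>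
    (\<Sum>\<eta>\<in>H. w \<Lambda> (glue V \<Lambda> zero_heights \<eta>) * (of_int (\<eta> x))\<^sup>2) \<le> K / (card (N x) * escape x) * Z"
proof -
  obtain K where K: "0 < K" "\<And>a t. increment.\<phi> (a + t) * increment.\<phi> (a - t) \<ge> (increment.\<phi> a)\<^sup>2 * (1 - K * t\<^sup>2)"
    using increment.\<phi>_shift_product by metis
  have "(\<Sum>\<eta>\<in>H. w \<Lambda> (glue V \<Lambda> zero_heights \<eta>) * (of_int (\<eta> x))\<^sup>2) \<le> (2 * K) / (card (N x) * escape x) * Z"
    if \<Lambda>: "finite \<Lambda>" "\<Lambda> \<subseteq> V" "x \<in> \<Lambda>" and H: "finite H" "H \<subseteq> \<Lambda> \<rightarrow>\<^sub>E UNIV"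
      and Z: "\<And>H. finite H \<Longrightarrow> H \<subseteq> \<Lambda> \<rightarrow>\<^sub>E UNIV \<Longrightarrow> (\<Sum>\<eta>\<in>H. w \<Lambda> (glue V \<Lambda> zero_heights \<eta>)) \<le> Z" for \<Lambda> x H Z
  proof -
    obtain a b where ab: "\<And>e. e \<in> E \<Longrightarrow> e = {a e, b e}" using orientation by metis
    obtain t where t: "(\<Sum>e\<in>T \<Lambda>. (t e)\<^sup>2) \<le> 1 / (card (N x) * escape x)"
      "\<And>h :: 'v \<Rightarrow> real. (\<And>y. y \<notin> \<Lambda> \<Longrightarrow> h y = 0) \<Longrightarrow> (\<Sum>e\<in>T \<Lambda>. t e * (h (b e) - h (a e))) = h x"
      using unit_flow[OF \<Lambda> ab] by metis
    have abV: "a e \<in> V" "b e \<in> V" if "e \<in> T \<Lambda>" for e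
      using edge_in_V[of e] ab[of e] that by (auto simp: edges_touching_def)
    define g where "g \<eta> y = (if y \<in> \<Lambda> then \<eta> y else 0 :: int)" for \<eta> y
    define D where "D \<eta> e = g \<eta> (b e) - g \<eta> (a e)" for \<eta> e
    let ?c = "total_weight U ^ card (T \<Lambda>)"
    have c: "0 < ?c" using total_weight_pos[OF potential] by simp
    have wD: "w \<Lambda> (glue V \<Lambda> zero_heights (\<lambda>y\<in>\<Lambda>. j y - k y)) = ?c * (\<Prod>e\<in>T \<Lambda>. pmf (increment_pmf U) (D j e - D k e))" for j k
      proof -
      have w: "w \<Lambda> h = ?c * (\<Prod>e\<in>T \<Lambda>. pmf (increment_pmf U) (h (b e) - h (a e)))" for h
        by (rule weight_increments[OF \<Lambda>(1,2) ab])
      show ?thesis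
        unfolding w by (rule arg_cong[where f="(*) ?c"], rule prod.cong[OF refl]) (use abV in \<open>auto simp: glue_def D_def g_def algebra_simps\<close>)
    qed
    \<comment> \<open>The unit flow tested on the zero extension of \<open>j - k\<close>.\<close>
    have tD: "(\<Sum>e\<in>T \<Lambda>. t e * of_int (D j e - D k e)) = of_int (j x - k x)" for j k
      using t(2)[of "\<lambda>y. of_int (g j y - g k y)"] \<Lambda>(3) by (simp add: D_def g_def algebra_simps)
    show ?thesis
    proof (rule sum_le_of_box_average[where F="\<lambda>\<eta>. w \<Lambda> (glue V \<Lambda> zero_heights \<eta>) * (of_int (\<eta> x))\<^sup>2", OF \<Lambda>(1) _ _ H])
      fix n
      let ?J = "height_box \<Lambda> n"
      let ?w = "\<lambda>j k. w \<Lambda> (glue V \<Lambda> zero_heights (\<lambda>y\<in>\<Lambda>. j y - k y))"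
      have "(\<Sum>j\<in>?J. \<Sum>k\<in>?J. ?w j k * (of_int ((\<lambda>y\<in>\<Lambda>. j y - k y) x))\<^sup>2) =
          ?c * (\<Sum>j\<in>?J. \<Sum>k\<in>?J. (\<Prod>e\<in>T \<Lambda>. pmf (increment_pmf U) (D j e - D k e)) * (\<Sum>e\<in>T \<Lambda>. t e * of_int (D j e - D k e))\<^sup>2)"
        unfolding tD wD using \<Lambda>(3) by (simp add: sum_distrib_left mult.assoc)
      also have "\<dots> \<le> ?c * (2 * K * (\<Sum>e\<in>T \<Lambda>. (t e)\<^sup>2) * (\<Sum>j\<in>?J. \<Sum>k\<in>?J. \<Prod>e\<in>T \<Lambda>. pmf (increment_pmf U) (D j e - D k e)))"
        using c by (intro mult_left_mono increment.pairing_second_moment[OF finite_edges_touching[OF \<Lambda>(1,2)] K]) auto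
      also have "\<dots> = 2 * K * (\<Sum>e\<in>T \<Lambda>. (t e)\<^sup>2) * (\<Sum>j\<in>?J. \<Sum>k\<in>?J. ?w j k)"
        unfolding wD by (simp add: sum_distrib_left[symmetric])
      also have "\<dots> \<le> 2 * K * (1 / (card (N x) * escape x)) * (\<Sum>j\<in>?J. Z)"
      proof (intro mult_mono sum_mono)
        fix j assume "j \<in> ?J"
        \<comment> \<open>For fixed \<open>j\<close> the map from \<open>k\<close> to
          \<open>j - k\<close> is injective, so the inner sum is a partial sum of the
          weights.\<close>
        have "(\<Sum>k\<in>?J. ?w j k) = (\<Sum>\<eta>\<in>(\<lambda>k. \<lambda>y\<in>\<Lambda>. j y - k y) ` ?J. w \<Lambda> (glue V \<Lambda> zero_heights \<eta>))"
        proof (rule sum.reindex_cong[symmetric, OF _ refl])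
          show "inj_on (\<lambda>k. \<lambda>y\<in>\<Lambda>. j y - k y) ?J"
          proof (rule inj_onI)
            fix k k' assume kk: "k \<in> ?J" "k' \<in> ?J" and eq: "(\<lambda>y\<in>\<Lambda>. j y - k y) = (\<lambda>y\<in>\<Lambda>. j y - k' y)"
            have "k y = k' y" if "y \<in> \<Lambda>" for y using fun_cong[OF eq, of y] that by simp
            then show "k = k'" using kk unfolding height_box_def by (intro PiE_ext) auto
          qed
        qed auto
        also have "\<dots> \<le> Z" using finite_height_box[OF \<Lambda>(1)] by (intro Z) auto
        finally show "(\<Sum>k\<in>?J. ?w j k) \<le> Z" .
      qed (use K(1) t(1) in \<open>auto intro!: mult_nonneg_nonneg sum_nonneg weight_nonneg simp: less_imp_le escape_pos[of x] \<Lambda> subsetD[OF \<Lambda>(2,3)]\<close>)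
      finally show "(\<Sum>j\<in>?J. \<Sum>k\<in>?J. ?w j k * (of_int ((\<lambda>y\<in>\<Lambda>. j y - k y) x))\<^sup>2) \<le> 2 * K / (card (N x) * escape x) * Z * card ?J"
        by (simp add: mult_ac)
    qed (simp add: weight_nonneg)
  qed
  then show ?thesis using that[of "2 * K"] K(1) by auto
qed

definition partition_sum :: "'v set \<Rightarrow> ('v \<Rightarrow> int) \<Rightarrow> ennreal" where
  "partition_sum \<Lambda> \<phi> = partition_function V E U \<Lambda> \<phi>"

lemma partition_glue:
  "\<Lambda> \<subseteq> V \<Longrightarrow> partition_sum \<Lambda> \<phi> = (\<integral>\<^sup>+\<eta>. ennreal (w \<Lambda> (glue V \<Lambda> \<phi> \<eta>)) \<partial>count_space (\<Lambda> \<rightarrow>\<^sub>E UNIV))"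
  unfolding partition_sum_def partition_function_def by (rule nn_integral_with_boundary)

text \<open>The flat configuration alone has positive weight, by
  \<open>increment.pmf_0_pos\<close>.\<close>

lemma partition_zero_pos:
  assumes \<Lambda>: "finite \<Lambda>" "\<Lambda> \<subseteq> V"
  shows "0 < partition_sum \<Lambda> zero_heights"
proof -
  obtain a b where ab: "\<And>e. e \<in> E \<Longrightarrow> e = {a e, b e}" using orientation by metis
  have abV: "a e \<in> V" "b e \<in> V" if "e \<in> T \<Lambda>" for e
    using edge_in_V[of e] ab[of e] that by (auto simp: edges_touching_def)
  let ?\<eta> = "\<lambda>y\<in>\<Lambda>. 0 :: int"
  have "0 < w \<Lambda> (glue V \<Lambda> zero_heights ?\<eta>)"
  proof -
    have w: "w \<Lambda> h = total_weight U ^ card (T \<Lambda>) * (\<Prod>e\<in>T \<Lambda>. pmf (increment_pmf U) (h (b e) - h (a e)))" for h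
      by (rule weight_increments[OF \<Lambda> ab])
    show ?thesis unfolding w
      using total_weight_pos[OF potential] increment.pmf_0_pos
      by (intro mult_pos_pos prod_pos) (auto simp: glue_def abV)
  qed
  then have "0 < ennreal (w \<Lambda> (glue V \<Lambda> zero_heights ?\<eta>))" by simp
  also have "\<dots> \<le> partition_sum \<Lambda> zero_heights"
    unfolding partition_glue[OF \<Lambda>(2)] by (rule nn_integral_ge_point) auto
  finally show ?thesis .
qed

lemma partition_zero_finite:
  assumes \<Lambda>: "finite \<Lambda>" "\<Lambda> \<subseteq> V"
  shows "partition_sum \<Lambda> zero_heights < \<infinity>"
proof -
  have "partition_sum \<Lambda> zero_heights \<le> ennreal (total_weight U ^ card (T \<Lambda>))"
    unfolding partition_glue[OF \<Lambda>(2)]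
    by (rule nn_integral_count_space_le) (auto intro: weight_nonneg finite_volume_sum_le[OF \<Lambda>])
  then show ?thesis by (auto simp: less_top[symmetric] top_unique)
qed

definition norm_const :: "'v set \<Rightarrow> real" where
  "norm_const \<Lambda> = enn2real (partition_sum \<Lambda> zero_heights)"

lemma norm_const:
  assumes \<Lambda>: "finite \<Lambda>" "\<Lambda> \<subseteq> V"
  shows "0 < norm_const \<Lambda>" "partition_sum \<Lambda> zero_heights = ennreal (norm_const \<Lambda>)"
  using partition_zero_pos[OF \<Lambda>] partition_zero_finite[OF \<Lambda>]
  by (auto simp: norm_const_def enn2real_positive_iff less_top)

text \<open>Only countably many configurations agree with 0 outside a finite set, so the measure can
  be a \<open>pmf\<close>, for which every set of heights is measurable.\<close>

definition finite_volume :: "'v set \<Rightarrow> ('v \<Rightarrow> int) pmf" where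
  "finite_volume \<Lambda> = embed_pmf (\<lambda>h. if h \<in> with_boundary V \<Lambda> zero_heights then w \<Lambda> h / norm_const \<Lambda> else 0)"

lemma pmf_finite_volume:
  assumes \<Lambda>: "finite \<Lambda>" "\<Lambda> \<subseteq> V"
  shows "pmf (finite_volume \<Lambda>) h = (if h \<in> with_boundary V \<Lambda> zero_heights then w \<Lambda> h / norm_const \<Lambda> else 0)"
  unfolding finite_volume_def
proof (rule pmf_embed_pmf)
  show "0 \<le> (if h \<in> with_boundary V \<Lambda> zero_heights then w \<Lambda> h / norm_const \<Lambda> else 0)" for h
    using norm_const(1)[OF \<Lambda>] weight_nonneg by auto
  have "(\<integral>\<^sup>+h. ennreal (if h \<in> with_boundary V \<Lambda> zero_heights then w \<Lambda> h / norm_const \<Lambda> else 0) \<partial>count_space UNIV) =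
     (\<integral>\<^sup>+h. ennreal (w \<Lambda> h) / ennreal (norm_const \<Lambda>) \<partial>count_space (with_boundary V \<Lambda> zero_heights))"
    using norm_const(1)[OF \<Lambda>] weight_nonneg
    by (subst nn_integral_count_space_indicator[of "with_boundary V \<Lambda> zero_heights"]) (auto simp: indicator_def divide_ennreal intro!: nn_integral_cong)
  also have "\<dots> = partition_sum \<Lambda> zero_heights / ennreal (norm_const \<Lambda>)"
    unfolding partition_sum_def partition_function_def by (rule nn_integral_divide) auto
  also have "\<dots> = 1"
    using norm_const[OF \<Lambda>] by (simp add: ennreal_divide_self)
  finally show "(\<integral>\<^sup>+h. ennreal (if h \<in> with_boundary V \<Lambda> zero_heights then w \<Lambda> h / norm_const \<Lambda> else 0) \<partial>count_space UNIV) = 1" .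
qed

lemma set_pmf_finite_volume:
  "finite \<Lambda> \<Longrightarrow> \<Lambda> \<subseteq> V \<Longrightarrow> set_pmf (finite_volume \<Lambda>) \<subseteq> with_boundary V \<Lambda> zero_heights"
  by (auto simp: set_pmf_eq pmf_finite_volume)

text \<open>Chebyshev's inequality for the second moment at \<open>x\<close>. The constant involves
  the degree and the escape probability of \<open>x\<close> but not \<open>\<Lambda>\<close>, which
  is tightness; for \<open>x\<close> outside \<open>\<Lambda>\<close> the height is frozen at
  0.\<close>

lemma finite_volume_tail:
  obtains C :: "'v \<Rightarrow> real" where
    "\<And>\<Lambda> x (m::nat). finite \<Lambda> \<Longrightarrow> \<Lambda> \<subseteq> V \<Longrightarrow> x \<in> V \<Longrightarrow> 0 < m \<Longrightarrow> measure (finite_volume \<Lambda>) {h. int m \<le> \<bar>h x\<bar>} \<le> C x / (real m)\<^sup>2"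
proof (rule finite_volume_second_moment)
  fix K assume K: "0 < K" and sm: "\<And>\<Lambda> x H Z. finite \<Lambda> \<Longrightarrow> \<Lambda> \<subseteq> V \<Longrightarrow> x \<in> \<Lambda> \<Longrightarrow> finite H \<Longrightarrow> H \<subseteq> \<Lambda> \<rightarrow>\<^sub>E UNIV \<Longrightarrow>
    (\<And>H. finite H \<Longrightarrow> H \<subseteq> \<Lambda> \<rightarrow>\<^sub>E UNIV \<Longrightarrow> (\<Sum>\<eta>\<in>H. w \<Lambda> (glue V \<Lambda> zero_heights \<eta>)) \<le> Z) \<Longrightarrow>
    (\<Sum>\<eta>\<in>H. w \<Lambda> (glue V \<Lambda> zero_heights \<eta>) * (of_int (\<eta> x))\<^sup>2) \<le> K / (card (N x) * escape x) * Z"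
  define C where "C x = K / (card (N x) * escape x)" for x
  have C: "0 \<le> C x" if "x \<in> V" for x
    using K escape_pos[OF that] by (simp add: C_def)
  have "measure (finite_volume \<Lambda>) {h. int m \<le> \<bar>h x\<bar>} \<le> C x / (real m)\<^sup>2"
    if \<Lambda>: "finite \<Lambda>" "\<Lambda> \<subseteq> V" and x: "x \<in> V" and m: "0 < m" for \<Lambda> x and m :: nat
  proof (cases "x \<in> \<Lambda>")
    case False
    have "measure (finite_volume \<Lambda>) {h. int m \<le> \<bar>h x\<bar>} = 0"
      using set_pmf_finite_volume[OF \<Lambda>] False x m
      by (subst measure_pmf_zero_iff) (auto simp: with_boundary_def)
    then show ?thesis using C[OF x] by simp
  next
    case True
    let ?X = "with_boundary V \<Lambda> zero_heights"
    let ?Z = "norm_const \<Lambda>"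
    note Z = norm_const[OF \<Lambda>]
    have sums: "(\<Sum>\<eta>\<in>H. w \<Lambda> (glue V \<Lambda> zero_heights \<eta>)) \<le> ?Z" if "finite H" "H \<subseteq> \<Lambda> \<rightarrow>\<^sub>E UNIV" for H
    proof -
      have "ennreal (\<Sum>\<eta>\<in>H. w \<Lambda> (glue V \<Lambda> zero_heights \<eta>)) = (\<integral>\<^sup>+\<eta>. ennreal (w \<Lambda> (glue V \<Lambda> zero_heights \<eta>)) \<partial>count_space H)"
        using that(1) by (simp add: nn_integral_count_space_finite sum_ennreal weight_nonneg)
      also have "\<dots> \<le> (\<integral>\<^sup>+\<eta>. ennreal (w \<Lambda> (glue V \<Lambda> zero_heights \<eta>)) \<partial>count_space (\<Lambda> \<rightarrow>\<^sub>E UNIV))"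
        using that(2) by (subst (1 2) nn_integral_count_space_indicator) (auto intro!: nn_integral_mono simp: indicator_def)
      also have "\<dots> = ennreal ?Z" using Z(2) partition_glue[OF \<Lambda>(2)] by simp
      finally show ?thesis using Z(1) by (simp add: ennreal_le_iff)
    qed
    have "emeasure (finite_volume \<Lambda>) {h. int m \<le> \<bar>h x\<bar>} = (\<integral>\<^sup>+h. ennreal (pmf (finite_volume \<Lambda>) h) \<partial>count_space {h. int m \<le> \<bar>h x\<bar>})"
      by (rule nn_integral_pmf[symmetric])
    also have "\<dots> \<le> (\<integral>\<^sup>+h. ennreal (w \<Lambda> h * (of_int (h x))\<^sup>2 / (?Z * (real m)\<^sup>2)) \<partial>count_space ?X)"
    proof (subst (1 2) nn_integral_count_space_indicator, simp, simp, rule nn_integral_mono)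
      fix h
      have "w \<Lambda> h / ?Z \<le> w \<Lambda> h * (of_int (h x))\<^sup>2 / (?Z * (real m)\<^sup>2)" if "int m \<le> \<bar>h x\<bar>"
      proof -
        have "real m \<le> \<bar>of_int (h x)\<bar>" using that by linarith
        then have "(real m)\<^sup>2 \<le> (of_int (h x))\<^sup>2" by (metis of_nat_0_le_iff power2_abs power_mono)
        then have "w \<Lambda> h / ?Z * 1 \<le> w \<Lambda> h / ?Z * ((of_int (h x))\<^sup>2 / (real m)\<^sup>2)"
          using m Z(1) weight_nonneg by (intro mult_left_mono) auto
        then show ?thesis by simp
      qed
      then show "ennreal (pmf (finite_volume \<Lambda>) h) * indicator {h. int m \<le> \<bar>h x\<bar>} h \<le> ennreal (w \<Lambda> h * (of_int (h x))\<^sup>2 / (?Z * (real m)\<^sup>2)) * indicator ?X h"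
        by (auto simp: pmf_finite_volume[OF \<Lambda>] indicator_def intro!: ennreal_leI)
    qed
    also have "\<dots> = (\<integral>\<^sup>+\<eta>. ennreal (w \<Lambda> (glue V \<Lambda> zero_heights \<eta>) * (of_int (\<eta> x))\<^sup>2 / (?Z * (real m)\<^sup>2)) \<partial>count_space (\<Lambda> \<rightarrow>\<^sub>E UNIV))"
      unfolding nn_integral_with_boundary[OF \<Lambda>(2)] using True x by (simp add: glue_def)
    also have "\<dots> \<le> ennreal (C x / (real m)\<^sup>2)"
    proof (rule nn_integral_count_space_le)
      show "0 \<le> w \<Lambda> (glue V \<Lambda> zero_heights \<eta>) * (of_int (\<eta> x))\<^sup>2 / (?Z * (real m)\<^sup>2)" for \<eta>
        using Z(1) weight_nonneg by auto
      fix H assume H: "finite H" "H \<subseteq> \<Lambda> \<rightarrow>\<^sub>E (UNIV :: int set)"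
      have "(\<Sum>\<eta>\<in>H. w \<Lambda> (glue V \<Lambda> zero_heights \<eta>) * (of_int (\<eta> x))\<^sup>2) / (?Z * (real m)\<^sup>2) \<le> C x * ?Z / (?Z * (real m)\<^sup>2)"
        unfolding C_def using Z(1) by (intro divide_right_mono sm[OF \<Lambda> True H sums]) auto
      then show "(\<Sum>\<eta>\<in>H. w \<Lambda> (glue V \<Lambda> zero_heights \<eta>) * (of_int (\<eta> x))\<^sup>2 / (?Z * (real m)\<^sup>2)) \<le> C x / (real m)\<^sup>2"
        using Z(1) by (simp add: sum_divide_distrib)
    qed
    finally show ?thesis
      using C[OF x] by (simp add: measure_pmf.emeasure_eq_measure ennreal_le_iff)
  qed
  then show thesis using that by blast
qed

section \<open>The Gibbs kernel and the DLR relation in finite volume\<close>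

definition dlr_kernel :: "'v set \<Rightarrow> ('v \<Rightarrow> int) set \<Rightarrow> ('v \<Rightarrow> int) \<Rightarrow> ennreal" where
  "dlr_kernel \<Lambda> A \<phi> = emeasure (marginal \<Lambda> (gibbs_kernel V E U \<Lambda> \<phi>)) A"

lemma dlr_kernel_eq:
  assumes \<Lambda>: "\<Lambda> \<subseteq> V" and A: "A \<in> sets (heights \<Lambda>)"
  shows "dlr_kernel \<Lambda> A \<phi> = (\<integral>\<^sup>+h. ennreal (w \<Lambda> h) / partition_sum \<Lambda> \<phi> * indicator A (restrict h \<Lambda>) \<partial>count_space (with_boundary V \<Lambda> \<phi>))"
proof -
  let ?X = "with_boundary V \<Lambda> \<phi>"
  let ?D = "density (count_space ?X) (\<lambda>h. ennreal (w \<Lambda> h) / partition_sum \<Lambda> \<phi>)"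
  have sp: "?X \<subseteq> space (heights V)" by (auto simp: with_boundary_def space_PiM)
  have m1: "(\<lambda>h. h) \<in> measurable ?D (heights V)"
    using sp by (auto simp: measurable_def with_boundary_def)
  have m2: "(\<lambda>h. restrict h \<Lambda>) \<in> measurable (heights V) (heights \<Lambda>)"
    by (rule measurable_restrict_subset[OF \<Lambda>])
  have "dlr_kernel \<Lambda> A \<phi> = emeasure ?D {h \<in> ?X. restrict h \<Lambda> \<in> A}"
    unfolding dlr_kernel_def marginal_def gibbs_kernel_def partition_sum_def[symmetric]
    using A m2 sp
    by (subst emeasure_distr) (auto simp: emeasure_distr[OF m1] measurable_sets[OF m2] intro!: arg_cong[where f="emeasure ?D"])
  also have "\<dots> = (\<integral>\<^sup>+h. ennreal (w \<Lambda> h) / partition_sum \<Lambda> \<phi> * indicator {h \<in> ?X. restrict h \<Lambda> \<in> A} h \<partial>count_space ?X)"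
    by (rule emeasure_density) auto
  also have "\<dots> = (\<integral>\<^sup>+h. ennreal (w \<Lambda> h) / partition_sum \<Lambda> \<phi> * indicator A (restrict h \<Lambda>) \<partial>count_space ?X)"
    by (intro nn_integral_cong) (auto simp: indicator_def)
  finally show ?thesis .
qed

lemma dlr_kernel_glue:
  assumes "\<Lambda> \<subseteq> V" "A \<in> sets (heights \<Lambda>)"
  shows "dlr_kernel \<Lambda> A \<phi> = (\<integral>\<^sup>+\<eta>. ennreal (w \<Lambda> (glue V \<Lambda> \<phi> \<eta>)) / partition_sum \<Lambda> \<phi> * indicator A \<eta> \<partial>count_space (\<Lambda> \<rightarrow>\<^sub>E UNIV))"
  unfolding dlr_kernel_eq[OF assms] nn_integral_with_boundary[OF assms(1)]
  by (intro nn_integral_cong) (auto simp: restrict_glue[OF assms(1)])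

text \<open>This covers degenerate \<open>\<phi>\<close> too, since 0/0 and \<infinity>/\<infinity>
  are 0 in \<open>ennreal\<close>. The kernel is thus a bounded function on all height
  functions.\<close>

lemma dlr_kernel_le_1:
  assumes "\<Lambda> \<subseteq> V" "A \<in> sets (heights \<Lambda>)"
  shows "dlr_kernel \<Lambda> A \<phi> \<le> 1"
proof -
  have "dlr_kernel \<Lambda> A \<phi> \<le> (\<integral>\<^sup>+\<eta>. ennreal (w \<Lambda> (glue V \<Lambda> \<phi> \<eta>)) / partition_sum \<Lambda> \<phi> \<partial>count_space (\<Lambda> \<rightarrow>\<^sub>E UNIV))"
    unfolding dlr_kernel_glue[OF assms] by (intro nn_integral_mono) (auto simp: indicator_def)
  also have "\<dots> = partition_sum \<Lambda> \<phi> / partition_sum \<Lambda> \<phi>"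
    by (subst nn_integral_divide) (auto simp: partition_glue[OF assms(1)])
  also have "\<dots> \<le> 1"
    by (cases "partition_sum \<Lambda> \<phi> = 0 \<or> partition_sum \<Lambda> \<phi> = \<infinity>") (auto simp: ennreal_divide_self less_top)
  finally show ?thesis .
qed

definition halo :: "'v set \<Rightarrow> 'v set" where
  "halo \<Lambda> = \<Lambda> \<union> (\<Union>x\<in>\<Lambda>. N x)"

lemma halo: "finite \<Lambda> \<Longrightarrow> \<Lambda> \<subseteq> V \<Longrightarrow> finite (halo \<Lambda>)" "\<Lambda> \<subseteq> V \<Longrightarrow> halo \<Lambda> \<subseteq> V" "\<Lambda> \<subseteq> halo \<Lambda>"
  using finite_N N_subset by (auto simp: halo_def)

lemma edge_in_halo: "e \<in> T \<Lambda> \<Longrightarrow> y \<in> e \<Longrightarrow> y \<in> halo \<Lambda>"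
proof -
  assume e: "e \<in> T \<Lambda>" and y: "y \<in> e"
  then obtain x where x: "x \<in> e" "x \<in> \<Lambda>" "e \<in> E" by (auto simp: edges_touching_def)
  then obtain z where "e = {x, z}" using edge_doubleton[of e] by auto
  then show ?thesis using x y by (auto simp: halo_def neighbours_def)
qed

lemma weight_glue_local:
  assumes "\<Lambda> \<subseteq> V" "\<And>y. y \<in> halo \<Lambda> \<Longrightarrow> \<phi> y = \<phi>' y"
  shows "w \<Lambda> (glue V \<Lambda> \<phi> \<eta>) = w \<Lambda> (glue V \<Lambda> \<phi>' \<eta>)"
  by (rule weight_cong) (use assms edge_in_halo in \<open>auto simp: glue_def\<close>)

lemma partition_local:
  assumes "\<Lambda> \<subseteq> V" "\<And>y. y \<in> halo \<Lambda> \<Longrightarrow> \<phi> y = \<phi>' y"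
  shows "partition_sum \<Lambda> \<phi> = partition_sum \<Lambda> \<phi>'"
  unfolding partition_glue[OF assms(1)] using weight_glue_local[OF assms] by simp

text \<open>Edges touching \<open>\<Lambda>\<close> see only \<open>\<Lambda>\<close> and its
  neighbours. The kernel is therefore a function of finitely many heights and a legitimate test
  function for local convergence.\<close>

lemma dlr_kernel_local:
  assumes "\<Lambda> \<subseteq> V" "A \<in> sets (heights \<Lambda>)" "\<And>y. y \<in> halo \<Lambda> \<Longrightarrow> \<phi> y = \<phi>' y"
  shows "dlr_kernel \<Lambda> A \<phi> = dlr_kernel \<Lambda> A \<phi>'"
proof -
  have p: "partition_sum \<Lambda> \<phi> = partition_sum \<Lambda> \<phi>'" by (rule partition_local[OF assms(1,3)])
  have g: "w \<Lambda> (glue V \<Lambda> \<phi> \<eta>) = w \<Lambda> (glue V \<Lambda> \<phi>' \<eta>)" for \<eta> by (rule weight_glue_local[OF assms(1,3)])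
  show ?thesis unfolding dlr_kernel_glue[OF assms(1,2)] p g ..
qed

lemma weight_split:
  assumes "finite \<Lambda>'" "\<Lambda>' \<subseteq> V" "\<Lambda> \<subseteq> \<Lambda>'"
  shows "w \<Lambda>' h = w \<Lambda> h * (\<Prod>e\<in>T \<Lambda>' - T \<Lambda>. boltzmann (edge_energy U h e))"
proof -
  have "T \<Lambda> \<subseteq> T \<Lambda>'" using assms by (auto simp: edges_touching_def)
  then show ?thesis
    using prod.subset_diff[of "T \<Lambda>" "T \<Lambda>'"] finite_edges_touching[OF assms(1,2)] assms
    by (simp add: weight_prod finite_subset mult.commute)
qed

text \<open>An edge that misses \<open>\<Lambda>\<close> has both endpoints where \<open>h\<close>
  and \<open>\<phi>\<close> agree.\<close>

lemma outer_weight_eq: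
  assumes "h \<in> with_boundary V \<Lambda> \<phi>"
  shows "(\<Prod>e\<in>T \<Lambda>' - T \<Lambda>. boltzmann (edge_energy U h e)) = (\<Prod>e\<in>T \<Lambda>' - T \<Lambda>. boltzmann (edge_energy U \<phi> e))"
proof (intro prod.cong refl arg_cong[where f=boltzmann] edge_energy_cong)
  fix e y assume e: "e \<in> T \<Lambda>' - T \<Lambda>" and y: "y \<in> e"
  then have "y \<in> V - \<Lambda>" using edge_in_V[of e y] by (auto simp: edges_touching_def)
  then show "h y = \<phi> y" using assms by (auto simp: with_boundary_def)
qed (auto simp: edges_touching_def)

text \<open>Positive, because \<open>\<phi>\<close> is itself an admissible configuration and its
  positive weight in \<open>\<Lambda>'\<close> has \<open>w \<Lambda> \<phi>\<close> as a factor.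
  Finite, because after multiplication by the outer weight \<open>R > 0\<close> it is part of the
  finite partition function of \<open>\<Lambda>'\<close>.\<close>

lemma finite_volume_partition:
  assumes \<Lambda>: "finite \<Lambda>'" "\<Lambda>' \<subseteq> V" "\<Lambda> \<subseteq> \<Lambda>'" and \<phi>: "\<phi> \<in> set_pmf (finite_volume \<Lambda>')"
  shows "0 < partition_sum \<Lambda> \<phi>" "partition_sum \<Lambda> \<phi> < \<infinity>"
proof -
  define R where "R = (\<Prod>e\<in>T \<Lambda>' - T \<Lambda>. boltzmann (edge_energy U \<phi> e))"
  have X: "\<phi> \<in> with_boundary V \<Lambda>' zero_heights" using set_pmf_finite_volume[OF \<Lambda>(1,2)] \<phi> by auto
  then have "w \<Lambda>' \<phi> \<noteq> 0" using \<phi> by (auto simp: set_pmf_eq pmf_finite_volume[OF \<Lambda>(1,2)])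
  then have pos: "0 < w \<Lambda> \<phi>" "0 < R"
    using weight_split[OF \<Lambda>, of \<phi>] weight_nonneg[of \<Lambda> \<phi>] prod_nonneg[of "T \<Lambda>' - T \<Lambda>" "\<lambda>e. boltzmann (edge_energy U \<phi> e)"]
    by (auto simp: R_def boltzmann_nonneg less_le)
  have \<phi>X: "\<phi> \<in> with_boundary V \<Lambda> \<phi>" using X by (auto simp: with_boundary_def)
  have "ennreal (w \<Lambda> \<phi>) \<le> partition_sum \<Lambda> \<phi>"
    unfolding partition_sum_def partition_function_def by (rule nn_integral_ge_point[OF \<phi>X])
  then show "0 < partition_sum \<Lambda> \<phi>" using pos(1) by (metis ennreal_0 ennreal_less_zero_iff less_le_trans ennreal_lessI)
  have sub: "with_boundary V \<Lambda> \<phi> \<subseteq> with_boundary V \<Lambda>' zero_heights"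
    using X \<Lambda> by (auto simp: with_boundary_def subset_eq)
  have "partition_sum \<Lambda> \<phi> * ennreal R = (\<integral>\<^sup>+h. ennreal (w \<Lambda> h) * ennreal R \<partial>count_space (with_boundary V \<Lambda> \<phi>))"
    unfolding partition_sum_def partition_function_def by (rule nn_integral_multc[symmetric]) auto
  also have "\<dots> = (\<integral>\<^sup>+h. ennreal (w \<Lambda>' h) \<partial>count_space (with_boundary V \<Lambda> \<phi>))"
    by (intro nn_integral_cong) (auto simp: weight_split[OF \<Lambda>] outer_weight_eq R_def[symmetric] ennreal_mult' weight_nonneg)
  also have "\<dots> \<le> partition_sum \<Lambda>' zero_heights"
    unfolding partition_sum_def partition_function_def using sub
    by (subst (1 2) nn_integral_count_space_indicator) (auto intro!: nn_integral_mono simp: indicator_def)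
  also have "\<dots> < \<infinity>" by (rule partition_zero_finite[OF \<Lambda>(1,2)])
  finally show "partition_sum \<Lambda> \<phi> < \<infinity>"
    using pos(2) by (auto simp: less_top[symmetric] ennreal_top_mult top_unique split: if_splits)
qed

lemma partition_boundary_eq:
  assumes "\<Lambda> \<subseteq> V" "h \<in> with_boundary V \<Lambda> \<phi>"
  shows "partition_sum \<Lambda> h = partition_sum \<Lambda> \<phi>"
proof -
  have "with_boundary V \<Lambda> h = with_boundary V \<Lambda> \<phi>" using assms by (auto simp: with_boundary_def)
  then show ?thesis by (simp add: partition_sum_def partition_function_def)
qed

text \<open>The DLR relation is detailed balance between the two configurations.\<close>

lemma finite_volume_dlr:
  assumes \<Lambda>: "finite \<Lambda>'" "\<Lambda>' \<subseteq> V" "\<Lambda> \<subseteq> \<Lambda>'" and A: "A \<in> sets (heights \<Lambda>)"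
  shows "(\<integral>\<^sup>+\<phi>. dlr_kernel \<Lambda> A \<phi> \<partial>finite_volume \<Lambda>') = emeasure (finite_volume \<Lambda>') {h. restrict h \<Lambda> \<in> A}"
proof -
  let ?p = "pmf (finite_volume \<Lambda>')"
  let ?X = "with_boundary V \<Lambda>' zero_heights"
  let ?wb = "with_boundary V \<Lambda>"
  have \<Lambda>V: "\<Lambda> \<subseteq> V" using \<Lambda> by auto
  \<comment> \<open>\<open>f \<phi> h\<close> is the mass of drawing \<open>\<phi>\<close> and
    resampling it inside \<open>\<Lambda>\<close> to \<open>h\<close>, with the event tested on
    \<open>h\<close>; \<open>g h \<phi>\<close> is the mass of the reverse move from
    \<open>h\<close> to \<open>\<phi>\<close>, with the event still tested on
    \<open>h\<close>.\<close>
  define f where "f \<phi> h = ennreal (?p \<phi>) * (ennreal (w \<Lambda> h) / partition_sum \<Lambda> \<phi> * indicator A (restrict h \<Lambda>)) * indicator (?wb \<phi>) h" for \<phi> h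
  define g where "g h \<phi> = ennreal (?p h) * indicator A (restrict h \<Lambda>) * (ennreal (w \<Lambda> \<phi>) / partition_sum \<Lambda> h) * indicator (?wb h) \<phi>" for \<phi> h
  have sym: "h \<in> ?X \<and> \<phi> \<in> ?wb h" if "\<phi> \<in> ?X \<and> h \<in> ?wb \<phi>" for \<phi> h
    using that \<Lambda> by (auto simp: with_boundary_def subset_eq)
  have fg: "f \<phi> h = g h \<phi>" for \<phi> h
  proof (cases "\<phi> \<in> ?X \<and> h \<in> ?wb \<phi>")
    case True
    then have \<phi>: "\<phi> \<in> ?X" and h: "h \<in> ?wb \<phi>" by auto
    have \<phi>': "\<phi> \<in> ?wb h" and hX: "h \<in> ?X" using sym[OF True] by auto
    \<comment> \<open>Both masses split into an inner weight and the outer weight, and the latter is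
      the same for \<open>\<phi>\<close> and \<open>h\<close>.\<close>
    have "?p \<phi> * w \<Lambda> h = ?p h * w \<Lambda> \<phi>"
      using \<phi> hX by (simp add: pmf_finite_volume[OF \<Lambda>(1,2)] weight_split[OF \<Lambda>] outer_weight_eq[OF h])
    then have "ennreal (?p \<phi>) * ennreal (w \<Lambda> h) = ennreal (?p h) * ennreal (w \<Lambda> \<phi>)"
      by (simp add: ennreal_mult'[symmetric] weight_nonneg)
    then show ?thesis
      unfolding f_def g_def partition_boundary_eq[OF \<Lambda>V h] using h \<phi>'
      by (simp add: ennreal_times_divide mult_ac)
  next
    case False
    then have "(\<phi> \<notin> ?X \<or> h \<notin> ?wb \<phi>) \<and> (h \<notin> ?X \<or> \<phi> \<notin> ?wb h)"
      using sym[of h \<phi>] by blast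
    then show ?thesis unfolding f_def g_def by (auto simp: pmf_finite_volume[OF \<Lambda>(1,2)] indicator_def)
  qed
  have "(\<integral>\<^sup>+\<phi>. dlr_kernel \<Lambda> A \<phi> \<partial>finite_volume \<Lambda>') = (\<integral>\<^sup>+\<phi>. ennreal (?p \<phi>) * dlr_kernel \<Lambda> A \<phi> \<partial>count_space UNIV)"
    by (rule nn_integral_measure_pmf)
  also have "\<dots> = (\<integral>\<^sup>+\<phi>. (\<integral>\<^sup>+h. f \<phi> h \<partial>count_space UNIV) \<partial>count_space UNIV)"
  proof (intro nn_integral_cong)
    fix \<phi>
    show "ennreal (?p \<phi>) * dlr_kernel \<Lambda> A \<phi> = (\<integral>\<^sup>+h. f \<phi> h \<partial>count_space UNIV)"
      unfolding dlr_kernel_eq[OF \<Lambda>V A] f_def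
      by (subst nn_integral_cmult[symmetric]) (auto simp: nn_integral_count_space_indicator[of "?wb \<phi>"])
  qed
  also have "\<dots> = (\<integral>\<^sup>+h. (\<integral>\<^sup>+\<phi>. f \<phi> h \<partial>count_space UNIV) \<partial>count_space UNIV)"
    using nn_integral_fst_count_space[of "\<lambda>(x, y). f x y"] nn_integral_snd_count_space[of "\<lambda>(x, y). f x y"] by simp
  also have "\<dots> = (\<integral>\<^sup>+h. ennreal (?p h) * indicator A (restrict h \<Lambda>) \<partial>count_space UNIV)"
  proof (intro nn_integral_cong)
    fix h
    show "(\<integral>\<^sup>+\<phi>. f \<phi> h \<partial>count_space UNIV) = ennreal (?p h) * indicator A (restrict h \<Lambda>)"
    proof (cases "h \<in> set_pmf (finite_volume \<Lambda>')")
      case True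
      note Z = finite_volume_partition[OF \<Lambda> True]
      have "(\<integral>\<^sup>+\<phi>. f \<phi> h \<partial>count_space UNIV) = (\<integral>\<^sup>+\<phi>. ennreal (?p h) * indicator A (restrict h \<Lambda>) * (ennreal (w \<Lambda> \<phi>) / partition_sum \<Lambda> h) \<partial>count_space (?wb h))"
        unfolding fg g_def by (simp add: nn_integral_count_space_indicator[of "?wb h"])
      also have "\<dots> = ennreal (?p h) * indicator A (restrict h \<Lambda>) * (partition_sum \<Lambda> h / partition_sum \<Lambda> h)"
        by (simp add: nn_integral_cmult nn_integral_divide) (simp add: partition_sum_def partition_function_def)
      \<comment> \<open>Resampling probabilities add up to 1 exactly when the partition function is
        nondegenerate, as it is on the support.\<close>
      also have "partition_sum \<Lambda> h / partition_sum \<Lambda> h = 1" using Z by (intro ennreal_divide_self) auto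
      finally show ?thesis by (simp only: mult_1_right)
    next
      case False
      then have "?p h = 0" by (simp add: set_pmf_eq)
      then show ?thesis unfolding fg g_def by simp
    qed
  qed
  also have "\<dots> = (\<integral>\<^sup>+h. indicator {h. restrict h \<Lambda> \<in> A} h \<partial>finite_volume \<Lambda>')"
    by (subst nn_integral_measure_pmf) (auto intro!: nn_integral_cong simp: indicator_def)
  also have "\<dots> = emeasure (finite_volume \<Lambda>') {h. restrict h \<Lambda> \<in> A}"
    by (rule nn_integral_indicator) simp
  finally show ?thesis .
qed

end

section \<open>Local limits of tight sequences\<close>

lemma sets_heights_finite: "finite J \<Longrightarrow> sets (heights J) = Pow (J \<rightarrow>\<^sub>E UNIV)"
  by (simp add: count_space_PiM_finite)

lemma measurable_restrict_heights: "J \<subseteq> I \<Longrightarrow> (\<lambda>h. restrict h J) \<in> measurable (heights I) (heights J)"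
  by (rule measurable_restrict_subset)

lemma sets_heights_local:
  assumes "finite J" "J \<subseteq> I"
  shows "{h\<in>space (heights I). restrict h J \<in> X} \<in> sets (heights I)"
proof -
  have "(\<lambda>h. restrict h J) -` (X \<inter> (J \<rightarrow>\<^sub>E UNIV)) \<inter> space (heights I) \<in> sets (heights I)"
    using assms by (intro measurable_sets[OF measurable_restrict_heights]) (auto simp: sets_heights_finite)
  also have "(\<lambda>h. restrict h J) -` (X \<inter> (J \<rightarrow>\<^sub>E UNIV)) \<inter> space (heights I) = {h\<in>space (heights I). restrict h J \<in> X}"
    by auto
  finally show ?thesis .
qed

lemma measurable_heights_local:
  assumes "finite J" "J \<subseteq> I"
  shows "(\<lambda>h. f (restrict h J)) \<in> borel_measurable (heights I)"
proof (rule measurable_compose[OF measurable_restrict_heights[OF assms(2)]])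
  show "f \<in> borel_measurable (heights J)"
    using assms(1) by (subst count_space_PiM_finite) auto
qed

text \<open>The library proves the Kolmogorov extension theorem for Polish spaces; the integers are embedded
  into the reals.\<close>

lemma kolmogorov_extension_heights:
  fixes m :: "'v set \<Rightarrow> ('v \<Rightarrow> int) pmf"
  assumes supp: "\<And>J. finite J \<Longrightarrow> J \<subseteq> I \<Longrightarrow> set_pmf (m J) \<subseteq> J \<rightarrow>\<^sub>E UNIV"
    and cons: "\<And>J H. J \<subseteq> H \<Longrightarrow> finite H \<Longrightarrow> H \<subseteq> I \<Longrightarrow> m J = map_pmf (\<lambda>f. restrict f J) (m H)"
  obtains \<nu> where "prob_space \<nu>" "sets \<nu> = sets (heights I)"
    "\<And>J X. finite J \<Longrightarrow> J \<subseteq> I \<Longrightarrow> emeasure \<nu> {h\<in>space (heights I). restrict h J \<in> X} = emeasure (m J) X"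
proof -
  let ?B = "\<lambda>_::'v. borel :: real measure"
  let ?r = "\<lambda>J f. \<lambda>x\<in>J. real_of_int (f x)"
  let ?fl = "\<lambda>J f. \<lambda>x\<in>J. \<lfloor>f x :: real\<rfloor>"
  define P where "P J = distr (m J) (PiM J ?B) (?r J)" for J
  have mr: "?r J \<in> measurable (measure_pmf p) (PiM J ?B)" for J and p :: "('v \<Rightarrow> int) pmf"
    by (auto simp: space_PiM)
  have mfl: "?fl J \<in> measurable (PiM J ?B) (heights J)" for J
  proof (rule measurable_restrict)
    fix x assume "x \<in> J"
    then have "(\<lambda>f. f x) \<in> borel_measurable (PiM J ?B)" by (rule measurable_component_singleton)
    then show "(\<lambda>f. \<lfloor>f x\<rfloor>) \<in> measurable (PiM J ?B) (count_space UNIV)" by measurable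
  qed
  interpret polish_projective I P
  proof (intro polish_projective.intro projective_family.intro)
    show "prob_space (P J)" for J
      unfolding P_def by (rule prob_space.prob_space_distr[OF measure_pmf.prob_space_axioms mr])
    show "P J = distr (P H) (PiM J ?B) (\<lambda>f. restrict f J)" if "J \<subseteq> H" "finite H" "H \<subseteq> I" for J H
    proof -
      have "P J = distr (distr (m H) (count_space UNIV) (\<lambda>f. restrict f J)) (PiM J ?B) (?r J)"
        unfolding P_def cons[OF that] map_pmf_rep_eq ..
      also have "\<dots> = distr (m H) (PiM J ?B) (\<lambda>f. ?r J (restrict f J))"
        by (subst distr_distr) (auto simp: space_PiM o_def)
      also have "(\<lambda>f. ?r J (restrict f J)) = (\<lambda>f. restrict (?r H f) J)"
        using that by (auto simp: fun_eq_iff)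
      also have "distr (m H) (PiM J ?B) \<dots> = distr (P H) (PiM J ?B) (\<lambda>f. restrict f J)"
        unfolding P_def by (subst distr_distr) (auto simp: o_def space_PiM intro!: measurable_restrict_subset[OF that(1)])
      finally show ?thesis .
    qed
  qed
  \<comment> \<open>The floor is a measurable left inverse of the embedding of the integers and
    brings the limit back to integer heights.\<close>
  define \<nu> where "\<nu> = distr lim (heights I) (?fl I)"
  have mfl': "?fl I \<in> measurable lim (heights I)"
    using mfl[of I] by (simp add: measurable_cong_sets[OF sets_lim refl])
  show ?thesis
  proof (rule that[of \<nu>])
    show "prob_space \<nu>" unfolding \<nu>_def by (rule P.prob_space_distr[OF mfl'])
    show "sets \<nu> = sets (heights I)" by (simp add: \<nu>_def)
    fix J X assume J: "finite J" "J \<subseteq> I"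
    define Y where "Y = {f\<in>space (PiM J ?B). ?fl J f \<in> X \<inter> (J \<rightarrow>\<^sub>E UNIV)}"
    have Y: "Y \<in> sets (PiM J ?B)"
    proof -
      have "?fl J -` (X \<inter> (J \<rightarrow>\<^sub>E UNIV)) \<inter> space (PiM J ?B) \<in> sets (PiM J ?B)"
        by (rule measurable_sets[OF mfl]) (auto simp: sets_heights_finite[OF J(1)])
      also have "?fl J -` (X \<inter> (J \<rightarrow>\<^sub>E UNIV)) \<inter> space (PiM J ?B) = Y"
        unfolding Y_def by blast
      finally show ?thesis .
    qed
    have "emeasure \<nu> {h\<in>space (heights I). restrict h J \<in> X} =
        emeasure lim (?fl I -` {h\<in>space (heights I). restrict h J \<in> X} \<inter> space lim)"
      unfolding \<nu>_def by (rule emeasure_distr[OF mfl' sets_heights_local[OF J]])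
    also have "?fl I -` {h\<in>space (heights I). restrict h J \<in> X} \<inter> space lim = emb I J Y"
    proof -
      have "restrict (?fl I f) J = ?fl J (restrict f J)" for f using J by (auto simp: fun_eq_iff)
      then show ?thesis by (auto simp: Y_def prod_emb_def space_PiM simp del: restrict_apply)
    qed
    also have "emeasure lim (emb I J Y) = emeasure (P J) Y" by (rule emeasure_lim_emb[OF J(2,1) Y])
    also have "\<dots> = emeasure (m J) (?r J -` Y \<inter> space (m J))"
      unfolding P_def by (rule emeasure_distr[OF mr Y])
    also have "\<dots> = emeasure (m J) X"
    proof (rule emeasure_eq_AE)
      show "AE f in m J. (f \<in> ?r J -` Y \<inter> space (m J)) = (f \<in> X)"
        unfolding AE_measure_pmf_iff
      proof
        fix f assume "f \<in> set_pmf (m J)"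
        then have f: "f \<in> J \<rightarrow>\<^sub>E UNIV" using supp[OF J] by auto
        have "?fl J (?r J f) = f" using f by (auto simp: fun_eq_iff PiE_iff extensional_def)
        then show "(f \<in> ?r J -` Y \<inter> space (m J)) = (f \<in> X)"
          using f by (auto simp: Y_def space_PiM simp del: restrict_apply)
      qed
    qed auto
    finally show "emeasure \<nu> {h\<in>space (heights I). restrict h J \<in> X} = emeasure (m J) X" .
  qed
qed

text \<open>Scheffe's lemma: if the masses converge pointwise and the limit has total mass 1, they
  converge in L1, hence against every bounded function.\<close>

lemma pmf_tendsto_expectation:
  fixes p :: "nat \<Rightarrow> 'a pmf" and f :: "'a \<Rightarrow> real"
  assumes lim: "\<And>x. (\<lambda>n. pmf (p n) x) \<longlonglongrightarrow> pmf q x" and f: "\<And>x. \<bar>f x\<bar> \<le> 1"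
  shows "(\<lambda>n. measure_pmf.expectation (p n) f) \<longlonglongrightarrow> measure_pmf.expectation q f"
proof -
  let ?M = "count_space UNIV :: 'a measure"
  define d where "d n = (\<integral>x. \<bar>pmf (p n) x - pmf q x\<bar> \<partial>?M)" for n
  have int: "integrable ?M (pmf r)" for r :: "'a pmf" by (rule integrable_pmf)
  have "(\<lambda>n. \<integral>\<^sup>+x. norm (pmf (p n) x - pmf q x) \<partial>?M) \<longlonglongrightarrow> 0"
    by (rule Scheffe_lemma2) (auto simp: lim int nn_integral_pmf measure_pmf.emeasure_space_1[simplified])
  then have "(\<lambda>n. ennreal (d n)) \<longlonglongrightarrow> ennreal 0"
    unfolding d_def by (subst nn_integral_eq_integral[symmetric]) (auto simp: int)
  then have d: "d \<longlonglongrightarrow> 0" by (rule tendsto_ennrealD) (auto simp: d_def)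
  have intf: "integrable ?M (\<lambda>x. pmf r x * f x)" for r
    by (rule Bochner_Integration.integrable_bound[OF int[of r]]) (auto simp: abs_mult f mult_left_le)
  have eq: "measure_pmf.expectation r f = (\<integral>x. pmf r x * f x \<partial>?M)" for r
    unfolding measure_pmf_eq_density by (subst integral_density) auto
  show ?thesis
  proof (rule metric_tendsto_imp_tendsto[OF d], rule always_eventually, rule allI)
    fix n
    have "dist (measure_pmf.expectation (p n) f) (measure_pmf.expectation q f) = \<bar>\<integral>x. (pmf (p n) x - pmf q x) * f x \<partial>?M\<bar>"
      unfolding eq dist_real_def by (simp add: left_diff_distrib Bochner_Integration.integral_diff[OF intf intf])
    also have "\<dots> \<le> (\<integral>x. \<bar>(pmf (p n) x - pmf q x) * f x\<bar> \<partial>?M)"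
      by (rule integral_abs_bound)
    also have "\<dots> \<le> d n"
      unfolding d_def
    proof (rule integral_mono)
      show "integrable ?M (\<lambda>x. \<bar>(pmf (p n) x - pmf q x) * f x\<bar>)"
        using intf[of "p n"] intf[of q] by (simp add: left_diff_distrib)
    qed (auto simp: int abs_mult f mult_left_le)
    finally show "dist (measure_pmf.expectation (p n) f) (measure_pmf.expectation q f) \<le> dist (d n) 0" by simp
  qed
qed

text \<open>Sequential compactness of the countable product of unit intervals contains the diagonal
  argument.\<close>

lemma countable_diagonal_subsequence:
  fixes a :: "nat \<Rightarrow> 'i \<Rightarrow> real"
  assumes "countable Q" and a: "\<And>n i. 0 \<le> a n i" "\<And>n i. a n i \<le> 1"
  obtains r where "strict_mono (r :: nat \<Rightarrow> nat)" "\<And>i. i \<in> Q \<Longrightarrow> convergent (\<lambda>n. a (r n) i)"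
proof -
  define b where "b n k = a n (from_nat_into Q k)" for n k
  have "compactin (product_topology (\<lambda>_::nat. euclidean :: real topology) UNIV) (PiE UNIV (\<lambda>_. {0..1}))"
    unfolding compactin_PiE by auto
  then have "compact (PiE UNIV (\<lambda>_::nat. {0..1::real}))"
    by (simp add: euclidean_product_topology)
  then have "seq_compact (PiE UNIV (\<lambda>_::nat. {0..1::real}))"
    by (rule compact_imp_seq_compact)
  moreover have "\<forall>n. b n \<in> PiE UNIV (\<lambda>_::nat. {0..1::real})" using a by (auto simp: b_def)
  ultimately obtain l r where r: "strict_mono r" "(b \<circ> r) \<longlonglongrightarrow> l"
    unfolding seq_compact_def by metis
  have "convergent (\<lambda>n. a (r n) i)" if i: "i \<in> Q" for i
  proof -
    obtain k where k: "i = from_nat_into Q k" using from_nat_into_surj[OF assms(1) i] by auto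
    have "isCont (\<lambda>f. f k) l"
      using continuous_on_eq_continuous_at[OF open_UNIV] continuous_on_product_coordinates[of k] by blast
    then have "(\<lambda>n. (b \<circ> r) n k) \<longlonglongrightarrow> l k"
      using isCont_tendsto_compose[OF _ r(2), of "\<lambda>f. f k"] by simp
    then show ?thesis by (auto simp: b_def k o_def convergent_def)
  qed
  with r(1) that show ?thesis by blast
qed

text \<open>There are countably many patterns on finite windows, so all their probabilities converge
  along one subsequence. Tightness keeps the limits of total mass 1, and consistency between windows
  passes to the limit, as Kolmogorov's theorem requires.\<close>

lemma tight_heights_limit:
  fixes \<mu> :: "nat \<Rightarrow> ('v \<Rightarrow> int) pmf" and C :: "'v \<Rightarrow> real"
  assumes I: "countable I"
    and tight: "\<And>x n m. x \<in> I \<Longrightarrow> 0 < m \<Longrightarrow> measure (\<mu> n) {h. int m \<le> \<bar>h x\<bar>} \<le> C x / (real m)\<^sup>2"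
  obtains r :: "nat \<Rightarrow> nat" and \<nu> where "strict_mono r" "prob_space \<nu>" "sets \<nu> = sets (heights I)"
    "\<And>J (f :: ('v \<Rightarrow> int) \<Rightarrow> real). finite J \<Longrightarrow> J \<subseteq> I \<Longrightarrow> (\<And>\<eta>. \<bar>f \<eta>\<bar> \<le> 1) \<Longrightarrow>
      (\<lambda>n. measure_pmf.expectation (\<mu> (r n)) (\<lambda>h. f (restrict h J))) \<longlonglongrightarrow> (\<integral>h. f (restrict h J) \<partial>\<nu>)"
proof -
  define p where "p n J = map_pmf (\<lambda>h. restrict h J) (\<mu> n)" for n J
  define Q where "Q = (SIGMA J:{J. finite J \<and> J \<subseteq> I}. J \<rightarrow>\<^sub>E (UNIV :: int set))"
  have Q: "countable Q"
    unfolding Q_def using I by (intro countable_SIGMA countable_Collect_finite_subset countable_PiE) auto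
  obtain r where r: "strict_mono r" "\<And>i. i \<in> Q \<Longrightarrow> convergent (\<lambda>n. pmf (p (r n) (fst i)) (snd i))"
    using countable_diagonal_subsequence[OF Q, of "\<lambda>n i. pmf (p n (fst i)) (snd i)"] pmf_le_1 pmf_nonneg by metis
  define l where "l J \<eta> = lim (\<lambda>n. pmf (p (r n) J) \<eta>)" for J \<eta>
  have p_supp: "set_pmf (p n J) \<subseteq> J \<rightarrow>\<^sub>E UNIV" for n J by (auto simp: p_def)
  have l: "(\<lambda>n. pmf (p (r n) J) \<eta>) \<longlonglongrightarrow> l J \<eta>" if "finite J" "J \<subseteq> I" for J \<eta>
  proof (cases "\<eta> \<in> J \<rightarrow>\<^sub>E UNIV")
    case True
    then show ?thesis using r(2)[of "(J, \<eta>)"] that by (simp add: Q_def l_def convergent_LIMSEQ_iff)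
  next
    case False
    then have "pmf (p n J) \<eta> = 0" for n using p_supp[of n J] by (auto simp: set_pmf_eq)
    then show ?thesis by (simp add: l_def)
  qed
  have l0: "0 \<le> l J \<eta>" if "finite J" "J \<subseteq> I" for J \<eta>
    by (rule LIMSEQ_le_const[OF l[OF that]]) auto
  have l_out: "l J \<eta> = 0" if "\<eta> \<notin> J \<rightarrow>\<^sub>E UNIV" for J \<eta>
  proof -
    have "pmf (p n J) \<eta> = 0" for n using p_supp[of n J] that by (auto simp: set_pmf_eq)
    then show ?thesis by (simp add: l_def)
  qed
  define m where "m J = embed_pmf (l J)" for J
  have pmf_m: "pmf (m J) \<eta> = l J \<eta>" if J: "finite J" "J \<subseteq> I" for J \<eta>
    unfolding m_def
  proof (rule pmf_embed_pmf)
    show "0 \<le> l J \<eta>" for \<eta> by (rule l0[OF J])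
    have sum_lim: "(\<lambda>n. measure (p (r n) J) H) \<longlonglongrightarrow> (\<Sum>\<eta>\<in>H. l J \<eta>)" if "finite H" for H
      using that by (simp add: measure_measure_pmf_finite) (intro tendsto_sum l J)
    have "(\<integral>\<^sup>+\<eta>. ennreal (l J \<eta>) \<partial>count_space UNIV) \<le> ennreal 1"
    proof (rule nn_integral_count_space_le)
      fix H :: "('v \<Rightarrow> int) set" assume H: "finite H"
      show "(\<Sum>\<eta>\<in>H. l J \<eta>) \<le> 1" by (rule LIMSEQ_le_const2[OF sum_lim[OF H]]) auto
    qed (rule l0[OF J])
    moreover have "ennreal 1 \<le> (\<integral>\<^sup>+\<eta>. ennreal (l J \<eta>) \<partial>count_space UNIV)"
    proof -
      define D where "D = (\<Sum>x\<in>J. C x)"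
      have "ennreal (1 - D / (real (Suc k))\<^sup>2) \<le> (\<integral>\<^sup>+\<eta>. ennreal (l J \<eta>) \<partial>count_space UNIV)" for k
      proof -
        have fin: "finite (height_box J k)" by (rule finite_height_box[OF J(1)])
        \<comment> \<open>Leaving the box of radius \<open>k\<close> forces some height to have
          absolute value at least \<open>k + 1\<close>; a union bound over \<open>J\<close> gives
          \<open>D\<close>.\<close>
        have "1 - D / (real (Suc k))\<^sup>2 \<le> measure (p n J) (height_box J k)" for n
        proof -
          have "1 - measure (p n J) (height_box J k) = measure (p n J) (- height_box J k)"
            using measure_pmf.prob_compl[of "height_box J k" "p n J"] by (simp add: Compl_eq_Diff_UNIV)
          also have "\<dots> = measure (\<mu> n) {h. restrict h J \<notin> height_box J k}"
            by (simp add: p_def vimage_def)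
          also have "\<dots> \<le> measure (\<mu> n) (\<Union>x\<in>J. {h. int (Suc k) \<le> \<bar>h x\<bar>})"
            by (rule measure_pmf.finite_measure_mono) (force simp: height_box_def PiE_iff)+
          also have "\<dots> \<le> (\<Sum>x\<in>J. measure (\<mu> n) {h. int (Suc k) \<le> \<bar>h x\<bar>})"
            using J by (intro measure_pmf.finite_measure_subadditive_finite) auto
          also have "\<dots> \<le> (\<Sum>x\<in>J. C x / (real (Suc k))\<^sup>2)"
            using J by (intro sum_mono tight) auto
          also have "\<dots> = D / (real (Suc k))\<^sup>2" by (simp add: D_def sum_divide_distrib)
          finally show ?thesis by simp
        qed
        then have "1 - D / (real (Suc k))\<^sup>2 \<le> (\<Sum>\<eta>\<in>height_box J k. l J \<eta>)"
          by (intro LIMSEQ_le_const[OF sum_lim[OF fin]]) auto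
        then have "ennreal (1 - D / (real (Suc k))\<^sup>2) \<le> ennreal (\<Sum>\<eta>\<in>height_box J k. l J \<eta>)"
          by (rule ennreal_leI)
        also have "\<dots> = (\<integral>\<^sup>+\<eta>. ennreal (l J \<eta>) \<partial>count_space (height_box J k))"
          by (simp add: nn_integral_count_space_finite[OF fin] sum_ennreal l0[OF J])
        also have "\<dots> \<le> (\<integral>\<^sup>+\<eta>. ennreal (l J \<eta>) \<partial>count_space UNIV)"
          by (subst nn_integral_count_space_indicator) (auto intro!: nn_integral_mono simp: indicator_def)
        finally show ?thesis .
      qed
      moreover have "(\<lambda>k. ennreal (1 - D / (real (Suc k))\<^sup>2)) \<longlonglongrightarrow> ennreal 1"
        by (intro tendsto_ennrealI) real_asymp
      ultimately show ?thesis by (intro LIMSEQ_le_const2) auto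
    qed
    ultimately show "(\<integral>\<^sup>+\<eta>. ennreal (l J \<eta>) \<partial>count_space UNIV) = 1" by (intro antisym) auto
  qed
  have lim_pm: "(\<lambda>n. measure_pmf.expectation (p (r n) J) f) \<longlonglongrightarrow> measure_pmf.expectation (m J) f"
    if "finite J" "J \<subseteq> I" "\<And>\<eta>. \<bar>f \<eta>\<bar> \<le> 1" for J and f :: "('v \<Rightarrow> int) \<Rightarrow> real"
    by (rule pmf_tendsto_expectation) (use that l pmf_m in auto)
  have supp_m: "set_pmf (m J) \<subseteq> J \<rightarrow>\<^sub>E UNIV" if "finite J" "J \<subseteq> I" for J
    using l_out[of _ J] by (auto simp: set_pmf_eq pmf_m[OF that])
  have cons_m: "m J = map_pmf (\<lambda>f. restrict f J) (m H)" if J: "J \<subseteq> H" "finite H" "H \<subseteq> I" for J H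
  proof (rule pmf_eqI)
    fix \<eta> :: "'v \<Rightarrow> int"
    have J': "finite J" "J \<subseteq> I" using J finite_subset by auto
    let ?S = "(\<lambda>f. restrict f J) -` {\<eta>}"
    \<comment> \<open>The fibre \<open>?S\<close> is infinite in general, so convergence of single
      masses is not enough and the Scheffe form is applied.\<close>
    have "(\<lambda>n. measure (p (r n) H) ?S) \<longlonglongrightarrow> measure (m H) ?S"
      using lim_pm[OF J(2,3), of "indicator ?S"] by (simp add: indicator_def)
    moreover have "measure (p n H) ?S = pmf (p n J) \<eta>" for n
    proof -
      have "p n J = map_pmf (\<lambda>f. restrict f J) (p n H)"
        using J(1) by (simp add: p_def map_pmf_comp Int_absorb1)
      then show ?thesis by (simp add: pmf_map)
    qed
    ultimately have "(\<lambda>n. pmf (p (r n) J) \<eta>) \<longlonglongrightarrow> measure (m H) ?S" by simp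
    then have "measure (m H) ?S = l J \<eta>"
      using l[OF J'] by (rule LIMSEQ_unique)
    then show "pmf (m J) \<eta> = pmf (map_pmf (\<lambda>f. restrict f J) (m H)) \<eta>"
      by (simp add: pmf_m[OF J'] pmf_map)
  qed
  show thesis
  proof (rule kolmogorov_extension_heights[of I m])
    fix \<nu>
    assume \<nu>: "prob_space \<nu>" "sets \<nu> = sets (heights I)"
      "\<And>J X. finite J \<Longrightarrow> J \<subseteq> I \<Longrightarrow> emeasure \<nu> {h\<in>space (heights I). restrict h J \<in> X} = emeasure (m J) X"
    show thesis
    proof (rule that[OF r(1) \<nu>(1,2)])
    fix J and f :: "('v \<Rightarrow> int) \<Rightarrow> real" assume J: "finite J" "J \<subseteq> I" and f: "\<And>\<eta>. \<bar>f \<eta>\<bar> \<le> 1"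
    have mr: "(\<lambda>h. restrict h J) \<in> measurable \<nu> (count_space UNIV)"
    proof (rule measurableI)
      fix X :: "('v \<Rightarrow> int) set"
      have "(\<lambda>h. restrict h J) -` X \<inter> space \<nu> = {h\<in>space (heights I). restrict h J \<in> X}"
        using sets_eq_imp_space_eq[OF \<nu>(2)] by auto
      then show "(\<lambda>h. restrict h J) -` X \<inter> space \<nu> \<in> sets \<nu>"
        using sets_heights_local[OF J, of X] \<nu>(2) by simp
    qed simp
    have "distr \<nu> (count_space UNIV) (\<lambda>h. restrict h J) = measure_pmf (m J)"
    proof (rule measure_eqI)
      fix X assume "X \<in> sets (distr \<nu> (count_space UNIV) (\<lambda>h. restrict h J))"
      have "emeasure (distr \<nu> (count_space UNIV) (\<lambda>h. restrict h J)) X = emeasure \<nu> {h\<in>space (heights I). restrict h J \<in> X}"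
        using sets_eq_imp_space_eq[OF \<nu>(2)] by (subst emeasure_distr[OF mr]) (auto intro!: arg_cong[where f="emeasure \<nu>"])
      then show "emeasure (distr \<nu> (count_space UNIV) (\<lambda>h. restrict h J)) X = emeasure (m J) X"
        by (simp add: \<nu>(3)[OF J])
    qed simp
    then have "measure_pmf.expectation (m J) f = (\<integral>h. f (restrict h J) \<partial>\<nu>)"
      using integral_distr[OF mr, of f] by simp
    moreover have "measure_pmf.expectation (p n J) f = measure_pmf.expectation (\<mu> n) (\<lambda>h. f (restrict h J))" for n
      by (simp add: p_def)
    ultimately show "(\<lambda>n. measure_pmf.expectation (\<mu> (r n)) (\<lambda>h. f (restrict h J))) \<longlonglongrightarrow> (\<integral>h. f (restrict h J) \<partial>\<nu>)"
      using lim_pm[where f=f, OF J f] by simp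
    qed
  qed ((rule supp_m, assumption+), (rule cons_m, assumption+))
qed

section \<open>Limits of finite volume measures are Gibbs measures\<close>

lemma integral_indicator_restrict:
  "(\<integral>h. indicator X (restrict h J) \<partial>\<nu>) = measure \<nu> {h\<in>space \<nu>. restrict h J \<in> X}"
proof -
  have "(\<integral>h. indicator X (restrict h J) \<partial>\<nu>) = (\<integral>h. indicator {h\<in>space \<nu>. restrict h J \<in> X} h \<partial>\<nu>)"
    by (intro Bochner_Integration.integral_cong) (auto simp: indicator_def)
  also have "\<dots> = measure \<nu> ({h\<in>space \<nu>. restrict h J \<in> X} \<inter> space \<nu>)"
    by (rule Bochner_Integration.integral_indicator)
  also have "{h\<in>space \<nu>. restrict h J \<in> X} \<inter> space \<nu> = {h\<in>space \<nu>. restrict h J \<in> X}" by auto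
  finally show ?thesis .
qed

context height_model
begin

text \<open>On a discrete space all bounded functions are continuous, so this is weak convergence of
  the finite-dimensional marginals; the bound 1 is a normalisation.\<close>

definition converges_locally :: "(nat \<Rightarrow> ('v \<Rightarrow> int) pmf) \<Rightarrow> ('v \<Rightarrow> int) measure \<Rightarrow> bool" where
  "converges_locally \<mu> \<nu> \<longleftrightarrow> (\<forall>J (f :: ('v \<Rightarrow> int) \<Rightarrow> real). finite J \<longrightarrow> J \<subseteq> V \<longrightarrow> (\<forall>\<eta>. \<bar>f \<eta>\<bar> \<le> 1) \<longrightarrow>
     (\<lambda>n. measure_pmf.expectation (\<mu> n) (\<lambda>h. f (restrict h J))) \<longlonglongrightarrow> (\<integral>h. f (restrict h J) \<partial>\<nu>))"

lemma converges_locally_prob: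
  assumes "converges_locally \<mu> \<nu>" "finite J" "J \<subseteq> V"
  shows "(\<lambda>n. measure (\<mu> n) {h. restrict h J \<in> X}) \<longlonglongrightarrow> measure \<nu> {h\<in>space \<nu>. restrict h J \<in> X}"
proof -
  have "\<forall>\<eta>. \<bar>indicator X \<eta> :: real\<bar> \<le> 1" by (simp add: indicator_def)
  then have "(\<lambda>n. measure_pmf.expectation (\<mu> n) (\<lambda>h. indicator X (restrict h J) :: real)) \<longlonglongrightarrow> (\<integral>h. indicator X (restrict h J) \<partial>\<nu>)"
    using assms unfolding converges_locally_def by blast
  then show ?thesis unfolding integral_indicator_restrict by simp
qed

definition dlr_pmf :: "'v set \<Rightarrow> ('v \<Rightarrow> int) pmf \<Rightarrow> bool" where
  "dlr_pmf \<Lambda> p \<longleftrightarrow> (\<forall>\<phi>\<in>set_pmf p. 0 < partition_sum \<Lambda> \<phi> \<and> partition_sum \<Lambda> \<phi> < \<infinity>) \<and>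
     (\<forall>A\<in>sets (heights \<Lambda>). (\<integral>\<^sup>+\<phi>. dlr_kernel \<Lambda> A \<phi> \<partial>p) = emeasure p {h. restrict h \<Lambda> \<in> A})"

lemma dlr_finite_volume:
  assumes "finite \<Lambda>'" "\<Lambda>' \<subseteq> V" "\<Lambda> \<subseteq> \<Lambda>'"
  shows "dlr_pmf \<Lambda> (finite_volume \<Lambda>')"
  unfolding dlr_pmf_def
proof (intro conjI ballI)
  fix \<phi> assume "\<phi> \<in> set_pmf (finite_volume \<Lambda>')"
  then show "0 < partition_sum \<Lambda> \<phi>" "partition_sum \<Lambda> \<phi> < \<infinity>"
    by (rule finite_volume_partition[OF assms])+
qed (rule finite_volume_dlr[OF assms])

text \<open>Both halves of \<open>dlr_pmf\<close> survive mixing: the support of a mixture is the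
  union of the supports, and the two integrals are affine in the measure. This admits averages of
  finite volume measures.\<close>

lemma dlr_bind:
  assumes "\<And>x. x \<in> set_pmf q \<Longrightarrow> dlr_pmf \<Lambda> (p x)"
  shows "dlr_pmf \<Lambda> (bind_pmf q p)"
proof -
  have "(\<integral>\<^sup>+x. (\<integral>\<^sup>+\<phi>. dlr_kernel \<Lambda> A \<phi> \<partial>p x) \<partial>q) = (\<integral>\<^sup>+x. emeasure (p x) {h. restrict h \<Lambda> \<in> A} \<partial>q)"
    if "A \<in> sets (heights \<Lambda>)" for A
    using assms that by (intro nn_integral_cong_AE) (auto simp: AE_measure_pmf_iff dlr_pmf_def)
  then show ?thesis using assms by (auto simp: dlr_pmf_def)
qed

text \<open>Every requirement for a fixed \<open>\<Lambda>\<close> concerns the heights on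
  \<open>halo \<Lambda>\<close> only, holds exactly for all late \<open>\<mu> n\<close>, and is
  expressed by bounded test functions.\<close>

lemma gibbs_measure_limit:
  assumes \<nu>: "prob_space \<nu>" "sets \<nu> = sets (heights V)" and conv: "converges_locally \<mu> \<nu>"
    and dlr: "\<And>\<Lambda>. finite \<Lambda> \<Longrightarrow> \<Lambda> \<subseteq> V \<Longrightarrow> eventually (\<lambda>n. dlr_pmf \<Lambda> (\<mu> n)) sequentially"
  shows "gibbs_measure V E U \<nu>"
proof -
  interpret prob_space \<nu> by (rule \<nu>(1))
  have sp: "space \<nu> = space (heights V)" by (rule sets_eq_imp_space_eq[OF \<nu>(2)])
  have main: "(AE \<phi> in \<nu>. 0 < partition_sum \<Lambda> \<phi> \<and> partition_sum \<Lambda> \<phi> < \<infinity>) \<and>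
      (\<forall>A\<in>sets (heights \<Lambda>). emeasure (marginal \<Lambda> \<nu>) A = (\<integral>\<^sup>+\<phi>. dlr_kernel \<Lambda> A \<phi> \<partial>\<nu>))"
    if \<Lambda>: "finite \<Lambda>" "\<Lambda> \<subseteq> V" for \<Lambda>
  proof -
    let ?J = "halo \<Lambda>"
    have J: "finite ?J" "?J \<subseteq> V" using halo(1)[OF \<Lambda>] halo(2)[OF \<Lambda>(2)] by auto
    have rJ: "restrict (restrict h ?J) \<Lambda> = restrict h \<Lambda>" for h :: "'v \<Rightarrow> int"
      using halo(3)[of \<Lambda>] by (simp add: Int_absorb1)
    have meas: "(\<lambda>h. f (restrict h ?J)) \<in> borel_measurable \<nu>" for f :: "('v \<Rightarrow> int) \<Rightarrow> real"
      using measurable_heights_local[OF J, of f] by (simp add: measurable_cong_sets[OF \<nu>(2) refl])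
    have intg: "integrable \<nu> (\<lambda>h. f (restrict h ?J))" if "\<And>\<eta>. \<bar>f \<eta>\<bar> \<le> 1" for f :: "('v \<Rightarrow> int) \<Rightarrow> real"
      by (rule integrable_const_bound[where B=1]) (use meas that in auto)
    have ind: "(\<integral>h. indicator S (restrict h ?J) \<partial>\<nu>) = prob {h\<in>space \<nu>. restrict h ?J \<in> S}" for S
      by (rule integral_indicator_restrict)
    have lim: "(\<lambda>n. measure_pmf.expectation (\<mu> n) (\<lambda>h. f (restrict h ?J))) \<longlonglongrightarrow> (\<integral>h. f (restrict h ?J) \<partial>\<nu>)"
      if "\<And>\<eta>. \<bar>f \<eta>\<bar> \<le> 1" for f :: "('v \<Rightarrow> int) \<Rightarrow> real"
      using conv J that unfolding converges_locally_def by blast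
    note ev = dlr[OF \<Lambda>]
    \<comment> \<open>The nondegenerate boundary conditions: an event of the halo with probability 1
      under all late \<open>\<mu> n\<close>, hence under \<open>\<nu>\<close>.\<close>
    define G where "G = {\<eta>. 0 < partition_sum \<Lambda> \<eta> \<and> partition_sum \<Lambda> \<eta> < \<infinity>}"
    have G: "restrict h ?J \<in> G \<longleftrightarrow> h \<in> G" for h
      using partition_local[OF \<Lambda>(2), of "restrict h ?J" h] by (simp add: G_def)
    have "eventually (\<lambda>n. measure_pmf.expectation (\<mu> n) (\<lambda>h. indicator G (restrict h ?J)) = (1::real)) sequentially"
      using ev
    proof eventually_elim
      case (elim n)
      have "measure_pmf.expectation (\<mu> n) (\<lambda>h. indicator G (restrict h ?J)) = measure_pmf.expectation (\<mu> n) (\<lambda>h. 1 :: real)"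
        using elim by (intro integral_cong_AE) (auto simp: AE_measure_pmf_iff dlr_pmf_def indicator_def G, auto simp: G_def)
      then show ?case by simp
    qed
    then have "(\<integral>h. indicator G (restrict h ?J) \<partial>\<nu>) = (1 :: real)"
      using LIMSEQ_unique[OF lim[of "indicator G"] tendsto_eventually] by auto
    then have "prob {h\<in>space \<nu>. restrict h ?J \<in> G} = 1" by (simp add: ind)
    then have "AE h in \<nu>. h \<in> {h\<in>space \<nu>. restrict h ?J \<in> G}"
      using sets_heights_local[OF J, of G] \<nu>(2) sp by (subst (asm) prob_eq_1) auto
    then have 1: "AE \<phi> in \<nu>. 0 < partition_sum \<Lambda> \<phi> \<and> partition_sum \<Lambda> \<phi> < \<infinity>"
      by (rule AE_mp) (auto simp: G, simp add: G_def)
    have 2: "emeasure (marginal \<Lambda> \<nu>) A = (\<integral>\<^sup>+\<phi>. dlr_kernel \<Lambda> A \<phi> \<partial>\<nu>)" if A: "A \<in> sets (heights \<Lambda>)" for A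
    proof -
      \<comment> \<open>\<open>f1\<close> and \<open>f2\<close> are the two sides of the DLR
        relation as test functions; their expectations agree for all late \<open>n\<close>.\<close>
      define f1 :: "('v \<Rightarrow> int) \<Rightarrow> real" where "f1 \<eta> = indicator A (restrict \<eta> \<Lambda>)" for \<eta>
      define f2 where "f2 \<eta> = enn2real (dlr_kernel \<Lambda> A \<eta>)" for \<eta>
      have k1: "dlr_kernel \<Lambda> A \<eta> \<le> 1" for \<eta> by (rule dlr_kernel_le_1[OF \<Lambda>(2) A])
      have k2: "dlr_kernel \<Lambda> A \<eta> = ennreal (f2 \<eta>)" for \<eta>
        using k1[of \<eta>] unfolding f2_def by (intro ennreal_enn2real[symmetric]) (auto simp: less_top[symmetric] top_unique)
      have b: "\<bar>f1 \<eta>\<bar> \<le> 1" "\<bar>f2 \<eta>\<bar> \<le> 1" for \<eta>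
        using k1[of \<eta>] enn2real_mono[of "dlr_kernel \<Lambda> A \<eta>" 1] by (auto simp: f1_def f2_def indicator_def)
      have f2_local: "f2 (restrict h ?J) = f2 h" for h
        unfolding f2_def by (intro arg_cong[where f=enn2real] dlr_kernel_local[OF \<Lambda>(2) A]) auto
      have f1_local: "f1 (restrict h ?J) = indicator {h. restrict h \<Lambda> \<in> A} h" for h
        unfolding f1_def rJ by (simp add: indicator_def)
      have "eventually (\<lambda>n. measure_pmf.expectation (\<mu> n) (\<lambda>h. f1 (restrict h ?J)) = measure_pmf.expectation (\<mu> n) (\<lambda>h. f2 (restrict h ?J))) sequentially"
        using ev
      proof eventually_elim
        case (elim n)
        have "ennreal (measure_pmf.expectation (\<mu> n) f2) = (\<integral>\<^sup>+\<phi>. dlr_kernel \<Lambda> A \<phi> \<partial>\<mu> n)"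
          unfolding k2 by (intro nn_integral_eq_integral[symmetric] measure_pmf.integrable_const_bound[where B=1])
            (use b in \<open>auto simp: f2_def\<close>)
        also have "\<dots> = emeasure (\<mu> n) {h. restrict h \<Lambda> \<in> A}" using elim A by (auto simp: dlr_pmf_def)
        also have "\<dots> = ennreal (measure (\<mu> n) {h. restrict h \<Lambda> \<in> A})" by (rule measure_pmf.emeasure_eq_measure)
        finally have "measure_pmf.expectation (\<mu> n) f2 = measure (\<mu> n) {h. restrict h \<Lambda> \<in> A}"
          by (subst (asm) ennreal_inj) (auto intro!: Bochner_Integration.integral_nonneg simp: f2_def)
        then show ?case unfolding f1_local f2_local by simp
      qed
      from Lim_transform_eventually[OF lim[of f1, OF b(1)] this] lim[of f2, OF b(2)]
      have "(\<integral>h. f1 (restrict h ?J) \<partial>\<nu>) = (\<integral>h. f2 (restrict h ?J) \<partial>\<nu>)"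
        by (rule LIMSEQ_unique)
      moreover have "emeasure (marginal \<Lambda> \<nu>) A = ennreal (\<integral>h. f1 (restrict h ?J) \<partial>\<nu>)"
      proof -
        have m: "(\<lambda>h. restrict h \<Lambda>) \<in> measurable \<nu> (heights \<Lambda>)"
          using measurable_restrict_heights[OF \<Lambda>(2)] by (simp add: measurable_cong_sets[OF \<nu>(2) refl])
        have "emeasure (marginal \<Lambda> \<nu>) A = emeasure \<nu> ((\<lambda>h. restrict h \<Lambda>) -` A \<inter> space \<nu>)"
          unfolding marginal_def by (rule emeasure_distr[OF m A])
        also have "(\<lambda>h. restrict h \<Lambda>) -` A \<inter> space \<nu> = {h\<in>space \<nu>. restrict h ?J \<in> {\<eta>. restrict \<eta> \<Lambda> \<in> A}}"
          using rJ by (auto simp del: restrict_restrict)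
        also have "emeasure \<nu> \<dots> = ennreal (\<integral>h. indicator {\<eta>. restrict \<eta> \<Lambda> \<in> A} (restrict h ?J) \<partial>\<nu>)"
          unfolding ind by (rule emeasure_eq_measure)
        also have "(\<integral>h. indicator {\<eta>. restrict \<eta> \<Lambda> \<in> A} (restrict h ?J) \<partial>\<nu>) = (\<integral>h. f1 (restrict h ?J) \<partial>\<nu>)"
          by (intro Bochner_Integration.integral_cong) (auto simp: f1_def indicator_def)
        finally show ?thesis .
      qed
      moreover have "(\<integral>\<^sup>+\<phi>. dlr_kernel \<Lambda> A \<phi> \<partial>\<nu>) = ennreal (\<integral>h. f2 (restrict h ?J) \<partial>\<nu>)"
      proof -
        have "(\<integral>\<^sup>+\<phi>. dlr_kernel \<Lambda> A \<phi> \<partial>\<nu>) = (\<integral>\<^sup>+h. ennreal (f2 (restrict h ?J)) \<partial>\<nu>)"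
          by (simp only: k2 f2_local)
        also have "\<dots> = ennreal (\<integral>h. f2 (restrict h ?J) \<partial>\<nu>)"
          by (intro nn_integral_eq_integral intg b AE_I2) (simp add: f2_def)
        finally show ?thesis .
      qed
      ultimately show ?thesis by simp
    qed
    show ?thesis using 1 2 by blast
  qed
  show ?thesis
    unfolding gibbs_measure_def using \<nu> main unfolding partition_sum_def dlr_kernel_def by blast
qed

section \<open>Exhaustion by balls and existence\<close>

primrec graph_ball :: "'v \<Rightarrow> nat \<Rightarrow> 'v set" where
  "graph_ball x 0 = {x}"
| "graph_ball x (Suc n) = halo (graph_ball x n)"

lemma graph_ball: "x \<in> V \<Longrightarrow> finite (graph_ball x n) \<and> graph_ball x n \<subseteq> V"
proof (induction n)
  case (Suc n)
  then show ?case using halo(1)[of "graph_ball x n"] halo(2)[of "graph_ball x n"] by simp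
qed simp

lemma graph_ball_mono: "m \<le> n \<Longrightarrow> graph_ball x m \<subseteq> graph_ball x n"
  by (rule lift_Suc_mono_le[of "graph_ball x"]) (auto simp: halo_def)

lemma in_graph_ball: assumes "x \<in> V" "y \<in> V" shows "\<exists>n. y \<in> graph_ball x n"
proof -
  have "(x, y) \<in> {(u, v). {u, v} \<in> E}\<^sup>*" using conn assms by (auto simp: connected_graph_def)
  then show ?thesis
  proof (induction rule: rtrancl_induct)
    case base
    show ?case by (rule exI[of _ 0]) simp
  next
    case (step y z)
    then obtain n where "y \<in> graph_ball x n" by auto
    then have "z \<in> graph_ball x (Suc n)" using step.hyps by (auto simp: halo_def neighbours_def)
    then show ?case ..
  qed
qed

lemma exhaustion:
  obtains D :: "nat \<Rightarrow> 'v set" where "\<And>n. finite (D n)" "\<And>n. D n \<subseteq> V"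
    "\<And>\<Lambda>. finite \<Lambda> \<Longrightarrow> \<Lambda> \<subseteq> V \<Longrightarrow> eventually (\<lambda>n. \<Lambda> \<subseteq> D n) sequentially"
proof -
  obtain x where x: "x \<in> V" using infinite_imp_nonempty[OF inf] by auto
  have "eventually (\<lambda>n. \<Lambda> \<subseteq> graph_ball x n) sequentially" if "finite \<Lambda>" "\<Lambda> \<subseteq> V" for \<Lambda>
  proof -
    have "eventually (\<lambda>n. y \<in> graph_ball x n) sequentially" if "y \<in> \<Lambda>" for y
    proof -
      obtain m where "y \<in> graph_ball x m" using in_graph_ball[OF x, of y] \<open>\<Lambda> \<subseteq> V\<close> \<open>y \<in> \<Lambda>\<close> by auto
      then have "\<forall>n\<ge>m. y \<in> graph_ball x n" using graph_ball_mono[of m _ x] by blast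
      then show ?thesis by (auto simp: eventually_sequentially)
    qed
    then have "eventually (\<lambda>n. \<forall>y\<in>\<Lambda>. y \<in> graph_ball x n) sequentially"
      using \<open>finite \<Lambda>\<close> by (simp add: eventually_ball_finite)
    then show ?thesis by (simp add: subset_eq)
  qed
  then show ?thesis using that[of "graph_ball x"] graph_ball[OF x] by blast
qed

lemma countable_V: "countable V"
proof -
  obtain x where x: "x \<in> V" using infinite_imp_nonempty[OF inf] by auto
  have "V \<subseteq> (\<Union>n. graph_ball x n)" using in_graph_ball[OF x] by auto
  moreover have "countable (\<Union>n. graph_ball x n)" using graph_ball[OF x] by (auto intro: countable_finite)
  ultimately show ?thesis by (rule countable_subset)
qed

text \<open>Stated for arbitrary tight sequences, so that it serves both plain finite volume
  measures and their averages. The convergence is returned as well, for the proof of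
  invariance.\<close>

lemma tight_gibbs_limit:
  fixes \<mu> :: "nat \<Rightarrow> ('v \<Rightarrow> int) pmf" and C :: "'v \<Rightarrow> real"
  assumes tight: "\<And>x n m. x \<in> V \<Longrightarrow> 0 < m \<Longrightarrow> measure (\<mu> n) {h. int m \<le> \<bar>h x\<bar>} \<le> C x / (real m)\<^sup>2"
    and dlr: "\<And>\<Lambda>. finite \<Lambda> \<Longrightarrow> \<Lambda> \<subseteq> V \<Longrightarrow> eventually (\<lambda>n. dlr_pmf \<Lambda> (\<mu> n)) sequentially"
  obtains r :: "nat \<Rightarrow> nat" and \<nu> where "strict_mono r" "gibbs_measure V E U \<nu>" "converges_locally (\<mu> \<circ> r) \<nu>"
proof (rule tight_heights_limit[of V \<mu> C, OF countable_V])
  fix r :: "nat \<Rightarrow> nat" and \<nu>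
  assume r: "strict_mono r" and \<nu>: "prob_space \<nu>" "sets \<nu> = sets (heights V)"
    and conv: "\<And>J (f :: ('v \<Rightarrow> int) \<Rightarrow> real). finite J \<Longrightarrow> J \<subseteq> V \<Longrightarrow> (\<And>\<eta>. \<bar>f \<eta>\<bar> \<le> 1) \<Longrightarrow>
      (\<lambda>n. measure_pmf.expectation (\<mu> (r n)) (\<lambda>h. f (restrict h J))) \<longlonglongrightarrow> (\<integral>h. f (restrict h J) \<partial>\<nu>)"
  have c: "converges_locally (\<mu> \<circ> r) \<nu>" using conv by (auto simp: converges_locally_def)
  have "gibbs_measure V E U \<nu>"
  proof (rule gibbs_measure_limit[OF \<nu> c])
    show "eventually (\<lambda>n. dlr_pmf \<Lambda> ((\<mu> \<circ> r) n)) sequentially" if "finite \<Lambda>" "\<Lambda> \<subseteq> V" for \<Lambda>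
      using eventually_subseq[OF r dlr[OF that]] by simp
  qed
  from r this c show thesis by (rule that)
qed (rule tight)

lemma exists_gibbs_measure: "\<exists>\<nu>. gibbs_measure V E U \<nu>"
proof (rule exhaustion, rule finite_volume_tail)
  fix D :: "nat \<Rightarrow> 'v set" and C :: "'v \<Rightarrow> real"
  assume D: "\<And>n. finite (D n)" "\<And>n. D n \<subseteq> V"
    "\<And>\<Lambda>. finite \<Lambda> \<Longrightarrow> \<Lambda> \<subseteq> V \<Longrightarrow> eventually (\<lambda>n. \<Lambda> \<subseteq> D n) sequentially"
    and C: "\<And>\<Lambda> x (m::nat). finite \<Lambda> \<Longrightarrow> \<Lambda> \<subseteq> V \<Longrightarrow> x \<in> V \<Longrightarrow> 0 < m \<Longrightarrow> measure (finite_volume \<Lambda>) {h. int m \<le> \<bar>h x\<bar>} \<le> C x / (real m)\<^sup>2"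
  show "\<exists>\<nu>. gibbs_measure V E U \<nu>"
  proof (rule tight_gibbs_limit[of "\<lambda>n. finite_volume (D n)" C])
    show "measure (finite_volume (D n)) {h. int m \<le> \<bar>h x\<bar>} \<le> C x / (real m)\<^sup>2" if "x \<in> V" "0 < m" for x n m
      by (rule C[OF D(1,2) that])
    show "eventually (\<lambda>n. dlr_pmf \<Lambda> (finite_volume (D n))) sequentially" if "finite \<Lambda>" "\<Lambda> \<subseteq> V" for \<Lambda>
      using D(3)[OF that] by eventually_elim (rule dlr_finite_volume[OF D(1,2)])
  qed blast
qed

end

section \<open>Translation invariance\<close>

lemma measure_bind_pmf_of_set:
  assumes "finite A" "A \<noteq> {}"
  shows "measure (bind_pmf (pmf_of_set A) p) X = (\<Sum>g\<in>A. measure (p g) X) / card A"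
proof -
  have "emeasure (bind_pmf (pmf_of_set A) p) X = (\<integral>\<^sup>+g. ennreal (measure (p g) X) \<partial>pmf_of_set A)"
    by (subst emeasure_bind_pmf) (simp only: measure_pmf.emeasure_eq_measure)
  also have "\<dots> = ennreal ((\<Sum>g\<in>A. measure (p g) X) / card A)"
    by (rule nn_integral_pmf_of_set_real[OF assms]) simp
  finally show ?thesis
    by (simp add: measure_pmf.emeasure_eq_measure sum_nonneg divide_nonneg_nonneg)
qed

locale cayley_model = height_model V E U + group G
  for V :: "'v set" and E U and G :: "('v, 'm) monoid_scheme" (structure) +
  fixes S :: "'v set"
  assumes cayley: "cayley_graph G S V E"
begin

lemma carrier [simp]: "carrier G = V"
  using cayley by (simp add: cayley_graph_def)

lemma closed [simp, intro]: "x \<in> V \<Longrightarrow> y \<in> V \<Longrightarrow> x \<otimes> y \<in> V" "x \<in> V \<Longrightarrow> inv x \<in> V"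
  using m_closed[of x y] inv_closed[of x] by simp_all

lemma cancel [simp]:
  assumes "k \<in> V" "x \<in> V"
  shows "inv k \<otimes> (k \<otimes> x) = x" "k \<otimes> (inv k \<otimes> x) = x" "(x \<otimes> inv k) \<otimes> k = x" "(x \<otimes> k) \<otimes> inv k = x"
proof -
  have c: "k \<in> carrier G" "x \<in> carrier G" using assms by simp_all
  show "inv k \<otimes> (k \<otimes> x) = x" using c m_assoc[of "inv k" k x] by (simp del: carrier)
  show "k \<otimes> (inv k \<otimes> x) = x" using c m_assoc[of k "inv k" x] by (simp del: carrier)
  show "(x \<otimes> inv k) \<otimes> k = x" using c m_assoc[of x "inv k" k] by (simp del: carrier)
  show "(x \<otimes> k) \<otimes> inv k = x" using c m_assoc[of x k "inv k"] by (simp del: carrier)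
qed

definition act :: "'v \<Rightarrow> ('v \<Rightarrow> int) \<Rightarrow> 'v \<Rightarrow> int" where
  "act k h = (\<lambda>x\<in>V. h (k \<otimes> x))"

text \<open>The translate of \<open>\<Lambda>\<close> by \<open>inv k\<close>, in preimage form to
  match \<open>act\<close>: if \<open>h\<close> vanishes outside \<open>\<Lambda>\<close>, then
  \<open>act k h\<close> vanishes on \<open>V\<close> outside
  \<open>shift k \<Lambda>\<close>.\<close>

definition shift :: "'v \<Rightarrow> 'v set \<Rightarrow> 'v set" where
  "shift k \<Lambda> = {x\<in>V. k \<otimes> x \<in> \<Lambda>}"

lemma shift_subset: "shift k \<Lambda> \<subseteq> V"
  by (auto simp: shift_def)

lemma finite_shift: assumes "finite \<Lambda>" "k \<in> V" shows "finite (shift k \<Lambda>)"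
proof (rule finite_subset)
  show "shift k \<Lambda> \<subseteq> (\<lambda>x. inv k \<otimes> x) ` \<Lambda>"
    using assms by (force simp: shift_def)
qed (use assms in auto)

text \<open>Preimages compose in reverse order. Translating by \<open>k\<close> thus acts on the
  index \<open>g\<close> of a shifted volume by right multiplication, which is why
  \<open>defect\<close> compares \<open>F\<close> with its right translates.\<close>

lemma shift_shift:
  assumes "g \<in> V" "k \<in> V"
  shows "shift k (shift g \<Lambda>) = shift (g \<otimes> k) \<Lambda>"
proof -
  have "x \<in> shift k (shift g \<Lambda>) \<longleftrightarrow> x \<in> shift (g \<otimes> k) \<Lambda>" for x
  proof (cases "x \<in> V")
    case True
    then have "(g \<otimes> k) \<otimes> x = g \<otimes> (k \<otimes> x)" using m_assoc[of g k x] assms by simp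
    then show ?thesis using True assms by (simp add: shift_def)
  qed (simp add: shift_def)
  then show ?thesis by blast
qed

lemma edges_eq: "E = {{g, g \<otimes> s} | g s. g \<in> V \<and> s \<in> S}"
  using cayley unfolding cayley_graph_def carrier by (elim conjE)

lemma generators_subset: "S \<subseteq> V"
  using cayley unfolding cayley_graph_def carrier by (elim conjE)

lemma generate_eq: "generate G S = V"
  using cayley unfolding cayley_graph_def carrier by (elim conjE)

text \<open>Generators multiply on the right, so by associativity left translation keeps
  them.\<close>

lemma translate_edge:
  assumes "e \<in> E" "k \<in> V"
  shows "(\<lambda>x. k \<otimes> x) ` e \<in> E"
proof -
  obtain g s where gs: "e = {g, g \<otimes> s}" "g \<in> V" "s \<in> S"
    using assms(1) edges_eq by blast
  then have "s \<in> V" using generators_subset by blast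
  then have "(\<lambda>x. k \<otimes> x) ` e = {k \<otimes> g, (k \<otimes> g) \<otimes> s}" using gs assms(2) by (simp add: m_assoc)
  moreover have "k \<otimes> g \<in> V" using gs assms(2) by blast
  ultimately show ?thesis using gs(3) unfolding edges_eq by blast
qed

lemma bij_edges:
  assumes k: "k \<in> V" and \<Lambda>: "\<Lambda> \<subseteq> V"
  shows "bij_betw (\<lambda>e. (\<lambda>x. k \<otimes> x) ` e) (T (shift k \<Lambda>)) (T \<Lambda>)"
proof (rule bij_betwI[where g="\<lambda>e. (\<lambda>x. inv k \<otimes> x) ` e"])
  show "(\<lambda>e. (\<lambda>x. k \<otimes> x) ` e) \<in> T (shift k \<Lambda>) \<rightarrow> T \<Lambda>"
    using translate_edge[OF _ k] by (force simp: edges_touching_def shift_def)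
  show "(\<lambda>e. (\<lambda>x. inv k \<otimes> x) ` e) \<in> T \<Lambda> \<rightarrow> T (shift k \<Lambda>)"
  proof
    fix e assume "e \<in> T \<Lambda>"
    then obtain y where e: "e \<in> E" "y \<in> e" "y \<in> \<Lambda>" by (auto simp: edges_touching_def)
    then have "inv k \<otimes> y \<in> shift k \<Lambda>" using k \<Lambda> by (auto simp: shift_def)
    then show "(\<lambda>x. inv k \<otimes> x) ` e \<in> T (shift k \<Lambda>)"
      using translate_edge[of e "inv k"] e k by (auto simp: edges_touching_def)
  qed
  show "(\<lambda>x. inv k \<otimes> x) ` (\<lambda>x. k \<otimes> x) ` e = e" if "e \<in> T (shift k \<Lambda>)" for e
  proof -
    have "x \<in> V" if "x \<in> e" for x using that \<open>e \<in> _\<close> edge_in_V by (auto simp: edges_touching_def)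
    then show ?thesis using k by (force simp: image_image)
  qed
  show "(\<lambda>x. k \<otimes> x) ` (\<lambda>x. inv k \<otimes> x) ` e = e" if "e \<in> T \<Lambda>" for e
  proof -
    have "x \<in> V" if "x \<in> e" for x using that \<open>e \<in> _\<close> edge_in_V by (auto simp: edges_touching_def)
    then show ?thesis using k by (force simp: image_image)
  qed
qed

lemma weight_act:
  assumes k: "k \<in> V" and \<Lambda>: "\<Lambda> \<subseteq> V"
  shows "w (shift k \<Lambda>) (act k h) = w \<Lambda> h"
proof -
  have "(\<Sum>e\<in>T (shift k \<Lambda>). edge_energy U (act k h) e) = (\<Sum>e\<in>T (shift k \<Lambda>). edge_energy U h ((\<lambda>x. k \<otimes> x) ` e))"
  proof (rule sum.cong[OF refl])
    fix e assume "e \<in> T (shift k \<Lambda>)"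
    then have e: "e \<in> E" by (simp add: edges_touching_def)
    then obtain x y where xy: "{x, y} = e" using edge_doubleton by metis
    then have V: "x \<in> V" "y \<in> V" using edge_endpoints[of x y] e by auto
    have "edge_energy U (act k h) e = U (h (k \<otimes> y) - h (k \<otimes> x))"
      using edge_energy_eq[OF xy] V by (simp add: act_def)
    also have "\<dots> = edge_energy U h ((\<lambda>x. k \<otimes> x) ` e)"
      using edge_energy_eq[of "k \<otimes> x" "k \<otimes> y" "(\<lambda>x. k \<otimes> x) ` e" h] xy by auto
    finally show "edge_energy U (act k h) e = edge_energy U h ((\<lambda>x. k \<otimes> x) ` e)" .
  qed
  also have "\<dots> = (\<Sum>e\<in>T \<Lambda>. edge_energy U h e)"
    by (rule sum.reindex_bij_betw[OF bij_edges[OF assms]])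
  finally show ?thesis unfolding gibbs_weight_def by simp
qed

lemma bij_act:
  assumes k: "k \<in> V" and \<Lambda>: "\<Lambda> \<subseteq> V"
  shows "bij_betw (act k) (with_boundary V \<Lambda> zero_heights) (with_boundary V (shift k \<Lambda>) zero_heights)"
proof (rule bij_betwI[where g="act (inv k)"])
  show "act k \<in> with_boundary V \<Lambda> zero_heights \<rightarrow> with_boundary V (shift k \<Lambda>) zero_heights"
    using k by (auto simp: with_boundary_def act_def shift_def)
  show "act (inv k) \<in> with_boundary V (shift k \<Lambda>) zero_heights \<rightarrow> with_boundary V \<Lambda> zero_heights"
    using k by (auto simp: with_boundary_def act_def shift_def)
  show "act (inv k) (act k h) = h" if "h \<in> with_boundary V \<Lambda> zero_heights" for h
    using that k by (auto simp: with_boundary_def act_def fun_eq_iff PiE_iff extensional_def)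
  show "act k (act (inv k) h) = h" if "h \<in> with_boundary V (shift k \<Lambda>) zero_heights" for h
    using that k by (auto simp: with_boundary_def act_def fun_eq_iff PiE_iff extensional_def)
qed

text \<open>Translation is a bijection of configurations that preserves weights, and therefore the
  partition function as well.\<close>

lemma map_finite_volume:
  assumes k: "k \<in> V" and \<Lambda>: "finite \<Lambda>" "\<Lambda> \<subseteq> V"
  shows "map_pmf (act k) (finite_volume \<Lambda>) = finite_volume (shift k \<Lambda>)"
proof (rule pmf_eqI)
  fix h' :: "'v \<Rightarrow> int"
  let ?X = "with_boundary V \<Lambda> zero_heights" and ?X' = "with_boundary V (shift k \<Lambda>) zero_heights"
  note bij = bij_act[OF k \<Lambda>(2)]
  have \<Lambda>': "finite (shift k \<Lambda>)" "shift k \<Lambda> \<subseteq> V" using finite_shift[OF \<Lambda>(1) k] shift_subset by auto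
  have norm: "norm_const (shift k \<Lambda>) = norm_const \<Lambda>"
    unfolding norm_const_def partition_sum_def partition_function_def
    using nn_integral_bij_count_space[OF bij, of "\<lambda>h. ennreal (w (shift k \<Lambda>) h)"] by (simp add: weight_act[OF k \<Lambda>(2)])
  have supp: "set_pmf (finite_volume \<Lambda>) \<subseteq> ?X" by (rule set_pmf_finite_volume[OF \<Lambda>])
  show "pmf (map_pmf (act k) (finite_volume \<Lambda>)) h' = pmf (finite_volume (shift k \<Lambda>)) h'"
  proof (cases "h' \<in> ?X'")
    case True
    then obtain h where h: "h \<in> ?X" "h' = act k h" using bij by (auto simp: bij_betw_def)
    have "pmf (map_pmf (act k) (finite_volume \<Lambda>)) h' = measure (finite_volume \<Lambda>) (act k -` {h'})"
      by (rule pmf_map)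
    also have "\<dots> = measure (finite_volume \<Lambda>) {h}"
    proof (rule measure_pmf.finite_measure_eq_AE)
      show "AE x in finite_volume \<Lambda>. (x \<in> act k -` {h'}) = (x \<in> {h})"
        unfolding AE_measure_pmf_iff using supp h bij by (auto simp: bij_betw_def inj_on_def)
    qed auto
    also have "\<dots> = pmf (finite_volume \<Lambda>) h" by (rule measure_pmf_single)
    finally show ?thesis
      using h True by (simp add: pmf_finite_volume[OF \<Lambda>] pmf_finite_volume[OF \<Lambda>'] norm weight_act[OF k \<Lambda>(2)])
  next
    case False
    have "h' \<notin> set_pmf (map_pmf (act k) (finite_volume \<Lambda>))"
      using False supp bij by (auto simp: bij_betw_def)
    then show ?thesis using False by (simp add: pmf_finite_volume[OF \<Lambda>'] set_pmf_eq)
  qed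
qed

section \<open>Foelner sets for right translations\<close>

definition defect :: "'v \<Rightarrow> 'v set \<Rightarrow> nat" where
  "defect k F = card ((\<lambda>g. g \<otimes> k) ` F - F)"

lemma inj_right:
  assumes "k \<in> V" "F \<subseteq> V"
  shows "inj_on (\<lambda>g. g \<otimes> k) F"
proof (rule inj_on_inverseI[where g="\<lambda>g. g \<otimes> inv k"])
  show "(g \<otimes> k) \<otimes> inv k = g" if "g \<in> F" for g
    using cancel(4)[of k g] assms that by blast
qed

lemma card_right: "k \<in> V \<Longrightarrow> F \<subseteq> V \<Longrightarrow> card ((\<lambda>g. g \<otimes> k) ` F) = card F"
  by (rule card_image) (rule inj_right)

text \<open>\<open>F\<close> and its right translate have the same size, so the two halves of their
  symmetric difference do too.\<close>

lemma card_symmetric_defect: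
  assumes "finite F" "F \<subseteq> V" "k \<in> V"
  shows "card (F - (\<lambda>g. g \<otimes> k) ` F) = defect k F"
proof -
  let ?Fk = "(\<lambda>g. g \<otimes> k) ` F"
  have "card (F - ?Fk) = card F - card (F \<inter> ?Fk)" using assms by (intro card_Diff_subset_Int) auto
  also have "\<dots> = card ?Fk - card (?Fk \<inter> F)" by (simp only: card_right[OF assms(3,2)] Int_commute)
  also have "\<dots> = card (?Fk - F)" using assms by (intro card_Diff_subset_Int[symmetric]) auto
  finally show ?thesis by (simp only: defect_def)
qed

text \<open>Each \<open>g\<close> in \<open>F\<close> with \<open>g \<otimes> s\<close> outside
  \<open>F\<close> yields a boundary edge, and \<open>g\<close> is recovered as its only endpoint in
  \<open>F\<close>.\<close>

lemma defect_generator: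
  assumes F: "finite F" "F \<subseteq> V" and s: "s \<in> S"
  shows "defect s F \<le> card {e\<in>E. e \<inter> F \<noteq> {} \<and> \<not> e \<subseteq> F}"
proof -
  have sV: "s \<in> V" using s generators_subset by blast
  let ?A = "{g\<in>F. g \<otimes> s \<notin> F}"
  have "(\<lambda>g. g \<otimes> s) ` F - F = (\<lambda>g. g \<otimes> s) ` ?A" by auto
  then have "defect s F = card ?A"
    unfolding defect_def using F sV by (simp add: card_right subset_eq)
  also have "\<dots> \<le> card {e\<in>E. e \<inter> F \<noteq> {} \<and> \<not> e \<subseteq> F}"
  proof (rule card_inj_on_le[where f="\<lambda>g. {g, g \<otimes> s}"])
    show "inj_on (\<lambda>g. {g, g \<otimes> s}) ?A" by (auto simp: inj_on_def doubleton_eq_iff)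
    show "(\<lambda>g. {g, g \<otimes> s}) ` ?A \<subseteq> {e\<in>E. e \<inter> F \<noteq> {} \<and> \<not> e \<subseteq> F}"
      using F s edges_eq by blast
    have "{e\<in>E. e \<inter> F \<noteq> {} \<and> \<not> e \<subseteq> F} \<subseteq> T F" by (auto simp: edges_touching_def)
    then show "finite {e\<in>E. e \<inter> F \<noteq> {} \<and> \<not> e \<subseteq> F}" using finite_edges_touching[OF F] finite_subset by blast
  qed
  finally show ?thesis .
qed

text \<open>Right multiplication by \<open>k\<close> carries what the translate by
  \<open>inv k\<close> adds to \<open>F\<close> onto what \<open>F\<close> has beyond its translate
  by \<open>k\<close>.\<close>

lemma defect_inv:
  assumes F: "finite F" "F \<subseteq> V" and k: "k \<in> V"
  shows "defect (inv k) F = defect k F"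
proof -
  let ?A = "(\<lambda>g. g \<otimes> inv k) ` F - F"
  have A: "?A \<subseteq> V" using F k by auto
  have "(\<lambda>g. g \<otimes> k) ` ?A = F - (\<lambda>g. g \<otimes> k) ` F"
  proof -
    have *: "(g \<otimes> inv k) \<otimes> k = g" "(g \<otimes> k) \<otimes> inv k = g" if "g \<in> V" for g
      using that k by simp_all
    have "g \<in> (\<lambda>g. g \<otimes> k) ` ?A \<longleftrightarrow> g \<in> F - (\<lambda>g. g \<otimes> k) ` F" for g
    proof
      assume "g \<in> (\<lambda>g. g \<otimes> k) ` ?A"
      then obtain f where f: "f \<in> F" "f \<otimes> inv k \<notin> F" "g = (f \<otimes> inv k) \<otimes> k" by auto
      then have "g = f" using * F by auto
      moreover have "f \<noteq> f' \<otimes> k" if "f' \<in> F" for f'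
        using f(2) * that F by auto
      ultimately show "g \<in> F - (\<lambda>g. g \<otimes> k) ` F" using f by auto
    next
      assume g: "g \<in> F - (\<lambda>g. g \<otimes> k) ` F"
      then have gV: "g \<in> V" using F by auto
      have "g \<otimes> inv k \<notin> F" using g *(1)[OF gV] by (metis DiffD2 imageI)
      then have "g \<otimes> inv k \<in> ?A" using g by auto
      then show "g \<in> (\<lambda>g. g \<otimes> k) ` ?A" using *(1)[OF gV] by (metis imageI)
    qed
    then show ?thesis by blast
  qed
  then have "card (F - (\<lambda>g. g \<otimes> k) ` F) = card ?A"
    using card_right[OF k A] by simp
  then show ?thesis using card_symmetric_defect[OF F k] by (simp add: defect_def)
qed

text \<open>If \<open>g \<otimes> k \<otimes> l\<close> leaves \<open>F\<close>, then either
  \<open>g \<otimes> k\<close> has already left, or the exit happens at the multiplication by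
  \<open>l\<close>.\<close>

lemma defect_mult:
  assumes F: "finite F" "F \<subseteq> V" and k: "k \<in> V" "l \<in> V"
  shows "defect (k \<otimes> l) F \<le> defect k F + defect l F"
proof -
  have "(\<lambda>g. g \<otimes> (k \<otimes> l)) ` F - F \<subseteq> (\<lambda>g. g \<otimes> l) ` ((\<lambda>g. g \<otimes> k) ` F - F) \<union> ((\<lambda>g. g \<otimes> l) ` F - F)"
  proof
    fix x assume x: "x \<in> (\<lambda>g. g \<otimes> (k \<otimes> l)) ` F - F"
    then obtain g where g: "g \<in> F" "x = g \<otimes> (k \<otimes> l)" by auto
    then have "x = (g \<otimes> k) \<otimes> l" using F k by (auto simp: m_assoc)
    then show "x \<in> (\<lambda>g. g \<otimes> l) ` ((\<lambda>g. g \<otimes> k) ` F - F) \<union> ((\<lambda>g. g \<otimes> l) ` F - F)"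
      using g(1) x by (cases "g \<otimes> k \<in> F") auto
  qed
  then have "defect (k \<otimes> l) F \<le> card ((\<lambda>g. g \<otimes> l) ` ((\<lambda>g. g \<otimes> k) ` F - F) \<union> ((\<lambda>g. g \<otimes> l) ` F - F))"
    unfolding defect_def using F by (intro card_mono) auto
  also have "\<dots> \<le> card ((\<lambda>g. g \<otimes> l) ` ((\<lambda>g. g \<otimes> k) ` F - F)) + card ((\<lambda>g. g \<otimes> l) ` F - F)"
    by (rule card_Un_le)
  also have "\<dots> \<le> defect k F + defect l F"
    unfolding defect_def using F by (intro add_mono card_image_le) auto
  finally show ?thesis .
qed

text \<open>A small edge boundary controls the defect of each generator only; inverses and products
  extend this to the group they generate, pointwise in \<open>k\<close>.\<close>

lemma foelner_sequence:
  assumes "amenable_graph V E"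
  obtains F :: "nat \<Rightarrow> 'v set" where "\<And>n. finite (F n)" "\<And>n. F n \<noteq> {}" "\<And>n. F n \<subseteq> V"
    "\<And>k. k \<in> V \<Longrightarrow> (\<lambda>n. real (defect k (F n)) / real (card (F n))) \<longlonglongrightarrow> 0"
proof -
  define good where "good n F \<longleftrightarrow> finite F \<and> F \<noteq> {} \<and> F \<subseteq> V \<and>
    real (card {e\<in>E. e \<inter> F \<noteq> {} \<and> \<not> e \<subseteq> F}) \<le> (1 / real (Suc n)) * real (card F)" for n F
  have "\<forall>n. \<exists>F. good n F"
  proof
    fix n
    have "0 < 1 / real (Suc n)" by simp
    then show "\<exists>F. good n F" using assms unfolding amenable_graph_def good_def by blast
  qed
  then obtain F where "\<forall>n. good n (F n)" by (rule choice[THEN exE])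
  then have F: "\<And>n. finite (F n)" "\<And>n. F n \<noteq> {}" "\<And>n. F n \<subseteq> V"
    "\<And>n. real (card {e\<in>E. e \<inter> F n \<noteq> {} \<and> \<not> e \<subseteq> F n}) \<le> (1 / real (Suc n)) * real (card (F n))"
    unfolding good_def by blast+
  have pos: "0 < card (F n)" for n using F by (simp add: card_gt_0_iff)
  have gen: "(\<lambda>n. real (defect s (F n)) / real (card (F n))) \<longlonglongrightarrow> 0" if s: "s \<in> S" for s
  proof (rule tendsto_sandwich[OF always_eventually always_eventually tendsto_const])
    show "\<forall>n. real (defect s (F n)) / real (card (F n)) \<le> 1 / real (Suc n)"
    proof
      fix n
      have "real (defect s (F n)) \<le> (1 / real (Suc n)) * real (card (F n))"
        using defect_generator[OF F(1,3) s, of n] F(4)[of n] by linarith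
      then show "real (defect s (F n)) / real (card (F n)) \<le> 1 / real (Suc n)"
        using pos[of n] by (simp add: divide_le_eq)
    qed
    show "(\<lambda>n. 1 / real (Suc n)) \<longlonglongrightarrow> 0" by real_asymp
  qed simp
  have lim: "(\<lambda>n. real (defect k (F n)) / real (card (F n))) \<longlonglongrightarrow> 0" if "k \<in> generate G S" for k
    using that
  proof (induction rule: generate.induct)
    case one
    have "(\<lambda>g. g \<otimes> \<one>) ` F n = F n" for n
      using F(3)[of n] by (force simp: subset_eq)
    then show ?case by (simp add: defect_def)
  next
    case (incl s)
    then show ?case by (rule gen)
  next
    case (inv s)
    have "s \<in> V" using inv generators_subset by blast
    then show ?case using gen[OF inv] defect_inv[OF F(1,3)] by simp
  next
    case (eng k l)
    have V: "k \<in> V" "l \<in> V" using eng.hyps generate_eq by blast+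
    show ?case
    proof (rule tendsto_sandwich[OF always_eventually always_eventually tendsto_const])
      show "\<forall>n. real (defect (k \<otimes> l) (F n)) / real (card (F n)) \<le>
        real (defect k (F n)) / real (card (F n)) + real (defect l (F n)) / real (card (F n))"
      proof
        fix n
        have "real (defect (k \<otimes> l) (F n)) \<le> real (defect k (F n)) + real (defect l (F n))"
          using defect_mult[OF F(1,3) V, of n] by linarith
        then show "real (defect (k \<otimes> l) (F n)) / real (card (F n)) \<le>
          real (defect k (F n)) / real (card (F n)) + real (defect l (F n)) / real (card (F n))"
          by (simp add: add_divide_distrib[symmetric] divide_right_mono)
      qed
      show "(\<lambda>n. real (defect k (F n)) / real (card (F n)) + real (defect l (F n)) / real (card (F n))) \<longlonglongrightarrow> 0"
        using tendsto_add[OF eng.IH] by simp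
    qed simp
  qed
  then show ?thesis using that[of F] F(1-3) generate_eq by blast
qed

lemma exists_invariant_gibbs_measure:
  assumes amenable: "amenable_graph V E"
  shows "\<exists>\<nu>. gibbs_measure V E U \<nu> \<and> translation_invariant G \<nu>"
proof (rule exhaustion, rule finite_volume_tail, rule foelner_sequence[OF amenable])
  fix D :: "nat \<Rightarrow> 'v set" and C :: "'v \<Rightarrow> real" and F :: "nat \<Rightarrow> 'v set"
  assume D: "\<And>n. finite (D n)" "\<And>n. D n \<subseteq> V"
    "\<And>\<Lambda>. finite \<Lambda> \<Longrightarrow> \<Lambda> \<subseteq> V \<Longrightarrow> eventually (\<lambda>n. \<Lambda> \<subseteq> D n) sequentially"
    and C: "\<And>\<Lambda> x (m::nat). finite \<Lambda> \<Longrightarrow> \<Lambda> \<subseteq> V \<Longrightarrow> x \<in> V \<Longrightarrow> 0 < m \<Longrightarrow> measure (finite_volume \<Lambda>) {h. int m \<le> \<bar>h x\<bar>} \<le> C x / (real m)\<^sup>2"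
    and F: "\<And>n. finite (F n)" "\<And>n. F n \<noteq> {}" "\<And>n. F n \<subseteq> V"
    and foelner: "\<And>k. k \<in> V \<Longrightarrow> (\<lambda>n. real (defect k (F n)) / real (card (F n))) \<longlonglongrightarrow> 0"
  \<comment> \<open>Chosen so that \<open>shift g (L n)\<close> contains \<open>D n\<close> for
    every \<open>g\<close> in \<open>F n\<close>: all volumes in the average exhaust the graph
    simultaneously.\<close>
  define L where "L n = (\<Union>g\<in>F n. (\<lambda>x. g \<otimes> x) ` D n)" for n
  have L: "finite (L n)" "L n \<subseteq> V" for n
    using D(1) F(1) by (auto simp: L_def dest!: subsetD[OF D(2)] subsetD[OF F(3)])
  have sh: "finite (shift g (L n))" "shift g (L n) \<subseteq> V" if "g \<in> V" for g n
    using finite_shift[OF L(1) that] shift_subset by auto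
  define \<mu> where "\<mu> n = bind_pmf (pmf_of_set (F n)) (\<lambda>g. finite_volume (shift g (L n)))" for n
  have \<mu>: "measure (\<mu> n) X = (\<Sum>g\<in>F n. measure (finite_volume (shift g (L n))) X) / card (F n)" for n X
    unfolding \<mu>_def by (rule measure_bind_pmf_of_set[OF F(1,2)])
  have pos: "0 < card (F n)" for n using F by (simp add: card_gt_0_iff)
  have tight: "measure (\<mu> n) {h. int m \<le> \<bar>h x\<bar>} \<le> C x / (real m)\<^sup>2" if "x \<in> V" "0 < m" for x n m
  proof -
    \<comment> \<open>The same \<open>C x\<close> bounds every term, since it does not depend on the
      volume.\<close>
    have "(\<Sum>g\<in>F n. measure (finite_volume (shift g (L n))) {h. int m \<le> \<bar>h x\<bar>}) \<le> real (card (F n)) * (C x / (real m)\<^sup>2)"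
    proof (rule sum_bounded_above)
      fix g assume "g \<in> F n"
      then have "g \<in> V" using F(3) by blast
      then show "measure (finite_volume (shift g (L n))) {h. int m \<le> \<bar>h x\<bar>} \<le> C x / (real m)\<^sup>2"
        by (intro C sh that)
    qed
    then show ?thesis unfolding \<mu> using pos[of n] by (simp add: divide_le_eq mult.commute)
  qed
  have dlr: "eventually (\<lambda>n. dlr_pmf \<Lambda> (\<mu> n)) sequentially" if "finite \<Lambda>" "\<Lambda> \<subseteq> V" for \<Lambda>
    using D(3)[OF that]
  proof eventually_elim
    case (elim n)
    show ?case
      unfolding \<mu>_def
    proof (rule dlr_bind)
      fix g assume "g \<in> set_pmf (pmf_of_set (F n))"
      then have g: "g \<in> F n" using set_pmf_of_set[OF F(2,1)] by blast
      then have gV: "g \<in> V" using F(3) by blast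
      have "\<Lambda> \<subseteq> shift g (L n)"
        using g elim \<open>\<Lambda> \<subseteq> V\<close> unfolding shift_def L_def by blast
      then show "dlr_pmf \<Lambda> (finite_volume (shift g (L n)))"
        by (rule dlr_finite_volume[OF sh[OF gV]])
    qed
  qed
  show ?thesis
  proof (rule tight_gibbs_limit[of \<mu> C, OF tight dlr])
    fix r :: "nat \<Rightarrow> nat" and \<nu>
    assume r: "strict_mono r" and gibbs: "gibbs_measure V E U \<nu>" and conv: "converges_locally (\<mu> \<circ> r) \<nu>"
    have \<nu>: "prob_space \<nu>" "sets \<nu> = sets (heights V)" using gibbs by (auto simp: gibbs_measure_def)
    interpret prob_space \<nu> by (rule \<nu>(1))
    have sp: "space \<nu> = space (heights V)" by (rule sets_eq_imp_space_eq[OF \<nu>(2)])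
    have lim: "(\<lambda>n. measure (\<mu> (r n)) {h. restrict h J \<in> X}) \<longlonglongrightarrow> prob {h\<in>space \<nu>. restrict h J \<in> X}"
      if "finite J" "J \<subseteq> V" for J X
      using converges_locally_prob[OF conv that, of X] by simp
    have inv: "distr \<nu> (heights V) (act k) = \<nu>" if k: "k \<in> V" for k
    proof -
      have m: "act k \<in> measurable \<nu> (heights V)"
      proof -
        have "act k \<in> measurable (heights V) (heights V)"
          unfolding act_def[abs_def] by (intro measurable_restrict measurable_component_singleton) (use k in auto)
        then show ?thesis by (simp add: measurable_cong_sets[OF \<nu>(2) refl])
      qed
      have cyl: "prob {h\<in>space \<nu>. restrict (act k h) J \<in> X} = prob {h\<in>space \<nu>. restrict h J \<in> X}"
        if J: "finite J" "J \<subseteq> V" for J X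
      proof -
        let ?J = "(\<lambda>x. k \<otimes> x) ` J"
        let ?X = "{\<eta>. (\<lambda>x\<in>J. \<eta> (k \<otimes> x)) \<in> X}"
        have kJ: "finite ?J" "?J \<subseteq> V" using J k by auto
        have loc: "restrict h ?J \<in> ?X \<longleftrightarrow> restrict (act k h) J \<in> X" for h
        proof -
          have "(\<lambda>x\<in>J. (restrict h ?J) (k \<otimes> x)) = restrict (act k h) J"
            using J by (auto simp: act_def fun_eq_iff)
          then show ?thesis by simp
        qed
        define a where "a n g = measure (finite_volume (shift g (L n))) {h. restrict h J \<in> X}" for n g
        have a: "0 \<le> a n g" "a n g \<le> 1" for n g by (auto simp: a_def)
        have b: "measure (\<mu> n) {h. restrict h J \<in> X} = (\<Sum>g\<in>F n. a n g) / card (F n)" for n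
          unfolding \<mu> a_def ..
        \<comment> \<open>The translated average runs over the right translate of \<open>F n\<close>
          by \<open>k\<close>, with the same summands \<open>a n\<close>.\<close>
        have c: "measure (\<mu> n) {h. restrict h ?J \<in> ?X} = (\<Sum>g\<in>(\<lambda>g. g \<otimes> k) ` F n. a n g) / card (F n)" for n
        proof -
          have "measure (finite_volume (shift g (L n))) {h. restrict h ?J \<in> ?X} = a n (g \<otimes> k)" if "g \<in> F n" for g
          proof -
            have g: "g \<in> V" using that F by auto
            have "a n (g \<otimes> k) = measure (map_pmf (act k) (finite_volume (shift g (L n)))) {h. restrict h J \<in> X}"
              unfolding a_def map_finite_volume[OF k sh[OF g]] shift_shift[OF g k] ..
            then show ?thesis unfolding loc by (simp add: vimage_def)
          qed
          then show ?thesis unfolding \<mu> using inj_right[OF k F(3)] by (simp add: sum.reindex)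
        qed
        have diff: "\<bar>measure (\<mu> n) {h. restrict h ?J \<in> ?X} - measure (\<mu> n) {h. restrict h J \<in> X}\<bar> \<le> real (defect k (F n)) / real (card (F n))" for n
        proof -
          let ?Fk = "(\<lambda>g. g \<otimes> k) ` F n"
          have fin: "finite ?Fk" "finite (F n)" using F by auto
          have s1: "(\<Sum>g\<in>?Fk. a n g) = (\<Sum>g\<in>?Fk - F n. a n g) + (\<Sum>g\<in>?Fk \<inter> F n. a n g)"
            using sum.Int_Diff[OF fin(1), of "a n" "F n"] by (simp add: add.commute)
          have s2: "(\<Sum>g\<in>F n. a n g) = (\<Sum>g\<in>F n - ?Fk. a n g) + (\<Sum>g\<in>?Fk \<inter> F n. a n g)"
            using sum.Int_Diff[OF fin(2), of "a n" "?Fk"] by (simp add: add.commute Int_commute)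
          have "(\<Sum>g\<in>?Fk - F n. a n g) \<le> real (card (?Fk - F n)) * 1" "(\<Sum>g\<in>F n - ?Fk. a n g) \<le> real (card (F n - ?Fk)) * 1"
            by (intro sum_bounded_above a)+
          moreover have "0 \<le> (\<Sum>g\<in>?Fk - F n. a n g)" "0 \<le> (\<Sum>g\<in>F n - ?Fk. a n g)"
            by (intro sum_nonneg a)+
          \<comment> \<open>The common indices cancel. Both remainders lie between 0 and the defect,
            so their difference is at most one defect in absolute value.\<close>
          ultimately have "\<bar>(\<Sum>g\<in>?Fk. a n g) - (\<Sum>g\<in>F n. a n g)\<bar> \<le> real (defect k (F n))"
            unfolding s1 s2 using card_symmetric_defect[OF F(1,3) k, of n] by (simp add: defect_def)
          then show ?thesis unfolding b c
            using pos[of n] by (simp add: diff_divide_distrib[symmetric] divide_right_mono)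
        qed
        have "(\<lambda>n. measure (\<mu> (r n)) {h. restrict h ?J \<in> ?X} - measure (\<mu> (r n)) {h. restrict h J \<in> X}) \<longlonglongrightarrow> 0"
          by (rule Lim_null_comparison[OF _ LIMSEQ_subseq_LIMSEQ[OF foelner[OF k] r, unfolded o_def]])
             (use diff in auto)
        moreover have "(\<lambda>n. measure (\<mu> (r n)) {h. restrict h ?J \<in> ?X} - measure (\<mu> (r n)) {h. restrict h J \<in> X}) \<longlonglongrightarrow>
            prob {h\<in>space \<nu>. restrict h ?J \<in> ?X} - prob {h\<in>space \<nu>. restrict h J \<in> X}"
          by (intro tendsto_diff lim J kJ)
        ultimately have "prob {h\<in>space \<nu>. restrict h ?J \<in> ?X} - prob {h\<in>space \<nu>. restrict h J \<in> X} = 0"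
          using LIMSEQ_unique by blast
        then show ?thesis unfolding loc by simp
      qed
      show ?thesis
      proof (rule measure_eqI_PiM_infinite[where I=V and M="\<lambda>_. count_space UNIV"])
        show "finite_measure (distr \<nu> (heights V) (act k))"
          using prob_space_distr[OF m] by (simp add: prob_space_def)
        fix A and J :: "'v set" assume J: "finite J" "J \<subseteq> V"
        let ?B = "prod_emb V (\<lambda>_. count_space UNIV) J (Pi\<^sub>E J A) :: ('v \<Rightarrow> int) set"
        have B: "?B = {h\<in>space (heights V). restrict h J \<in> Pi\<^sub>E J A}"
          by (auto simp: prod_emb_def space_PiM)
        have Bs: "?B \<in> sets (heights V)" unfolding B by (rule sets_heights_local[OF J])
        have "emeasure (distr \<nu> (heights V) (act k)) ?B = emeasure \<nu> (act k -` ?B \<inter> space \<nu>)"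
          by (rule emeasure_distr[OF m Bs])
        also have "act k -` ?B \<inter> space \<nu> = {h\<in>space \<nu>. restrict (act k h) J \<in> Pi\<^sub>E J A}"
          unfolding B using measurable_space[OF m] by auto
        also have "emeasure \<nu> \<dots> = emeasure \<nu> {h\<in>space \<nu>. restrict h J \<in> Pi\<^sub>E J A}"
          unfolding emeasure_eq_measure cyl[OF J] ..
        also have "{h\<in>space \<nu>. restrict h J \<in> Pi\<^sub>E J A} = ?B" unfolding B sp ..
        finally show "emeasure (distr \<nu> (heights V) (act k)) ?B = emeasure \<nu> ?B" .
      qed (use \<nu>(2) in auto)
    qed
    show ?thesis
      using gibbs inv unfolding translation_invariant_def act_def[abs_def] carrier by blast
  qed
qed

end

theorem theorem3p2:
  fixes V :: "'v set" and E :: "'v set set" and U :: "int \<Rightarrow> ereal"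
    and G :: "('v, 'm) monoid_scheme" and S :: "'v set"
  assumes "simple_graph V E"
    and "infinite V"
    and "locally_finite_graph V E"
    and "connected_graph V E"
    and "srw_transient V E"
    and "height_function_potential U"
  shows "(\<exists>\<nu>. gibbs_measure V E U \<nu>) \<and>
    (cayley_graph G S V E \<and> amenable_graph V E \<longrightarrow>
      (\<exists>\<nu>. gibbs_measure V E U \<nu> \<and> translation_invariant G \<nu>))"
proof -
  interpret height_model V E U
    by (intro height_model.intro transient_graph.intro height_model_axioms.intro assms)
  have "\<exists>\<nu>. gibbs_measure V E U \<nu> \<and> translation_invariant G \<nu>" if "cayley_graph G S V E" "amenable_graph V E"
  proof -
    interpret cayley_model V E U G S
      using that(1) by (intro cayley_model.intro height_model_axioms cayley_model_axioms.intro) (simp_all add: cayley_graph_def)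
    show ?thesis by (rule exists_invariant_gibbs_measure[OF that(2)])
  qed
  then show ?thesis using exists_gibbs_measure by blast
qed

end
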